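(* Let $\mathbf{F}$ be a field of characteristic $3$ and let $\lambda=(\lambda_1,\lambda_2)$ and $\mu=(\mu_1,\mu_2)$ be partitions of $r$ with at most two parts such that the Young module $Y^\mu$ is (isomorphic to) a direct summand of $M^\lambda$. Put $m=\lambda_1-\lambda_2$ and $g=\lambda_2-\mu_2$. Then $e_{m,g}$ is the primitive idempotent in $S_\mathbf{F}(\lambda)$ such that $e_{m,g}M^\lambda\cong Y^\mu$.
   Context: For a partition $\lambda=(\lambda_1,\lambda_2)$ of $r$, $M^\lambda$ is the $\mathbf{F}S_r$-permutation module on the cosets of the Young subgroup $S_{\lambda_1}\times S_{\lambda_2}$, and $S_\mathbf{F}(\lambda)=\operatorname{End}_{\mathbf{F}S_r}(M^\lambda)$. The Young module $Y^\mu$ is the (unique up to isomorphism) indecomposable direct summand of $M^\mu$ containing the Specht module $S^\mu$. Let $E$ have basis $v_1,v_2$; $S_r$ acts on $E^{\otimes r}$ by place permutations, $M^\lambda$ is identified with the span of $v_{i_1}\otimes\cdots\otimes v_{i_r}$ having exactly $\lambda_1$ entries $1$ and $\lambda_2$ entries $2$, and $1_\lambda$ is the projection of $E^{\otimes r}$ onto $M^\lambda$. With $e=e_{21},f=e_{12}\in\mathfrak{gl}_2$ acting on $E^{\otimes r}$ and divided powers $e^{(i)}=e^i/i!$, $f^{(i)}=f^i/i!$ (defined integrally and reduced mod 3), $b(i)=1_\lambda f^{(i)}e^{(i)}1_\lambda\in S_\mathbf{F}(\lambda)$. Then $S_\mathbf{F}(\lambda)$ is commutative with basis $b(0)=\mathbf{1},\dots,b(\lambda_2)$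 and $b(i)b(j)=\sum_{h=\max\{i,j\}}^{i+j}\binom{h}{i}\binom{h}{j}\binom{m+i+j}{i+j-h}b(h)$, with $b(a)=0$ for $a>\lambda_2$. $B(m,g)=\binom{m+2g}{g}$. For $B(m,g)\not\equiv0\pmod3$, with base-3 digits $(m+2g)_u,g_u$, let $I^{(0)}=\{u: g_u=0,(m+2g)_u=0\}$, $J^{(0)}=\{u:g_u=1,(m+2g)_u=2\}$, $I^{(1)}=\{u:g_u=0,(m+2g)_u=1\}$, $J^{(1)}=\{u:g_u=2,(m+2g)_u=2\}$, $I^{(2)}=\{u:g_u=0,(m+2g)_u=2\}$, $J^{(2)}=\{u:g_u=1,(m+2g)_u=1\}$ and \[e_{m,g}=\prod_{u\in I^{(0)}}(\mathbf{1}+b(3^u)-b(2\cdot3^u))\prod_{u\in J^{(0)}}(b(2\cdot3^u)-b(3^u))\prod_{u\in I^{(1)}}(\mathbf{1}-b(2\cdot3^u))\prod_{u\in J^{(1)}}b(2\cdot3^u)\prod_{u\in I^{(2)}}(\mathbf{1}-b(3^u)+b(2\cdot3^u))\prod_{u\in J^{(2)}}(b(3^u)-b(2\cdot3^u)),\] with $b(a)=0$ for $a>\lambda_2$. *)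

theory Defs
  imports "HOL-Combinatorics.Permutations"
begin

text \<open>Tensor space E^{\<otimes> r} over a field: a vector is a function from subsets S of
  {0..<r} (the set of tensor positions carrying v_2) to the field; the basis vector
  [S] is v_{i_1} \<otimes> ... \<otimes> v_{i_r} with i_j = 2 iff j \<in> S.\<close>

definition tensor_sp :: "nat \<Rightarrow> (nat set \<Rightarrow> 'a::field) set" where
  "tensor_sp r = {x. \<forall>S. x S \<noteq> 0 \<longrightarrow> S \<subseteq> {0..<r}}"

text \<open>Permutation module M^\<lambda> for \<lambda> = (r - k, k): span of basis tensors with exactly k entries 2.\<close>
definition Mperm :: "nat \<Rightarrow> nat \<Rightarrow> (nat set \<Rightarrow> 'a::field) set" where
  "Mperm r k = {x. \<forall>S. x S \<noteq> 0 \<longrightarrow> S \<subseteq> {0..<r} \<and> card S = k}"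

definition vzero :: "nat set \<Rightarrow> 'a::field" where "vzero = (\<lambda>S. 0)"
definition vadd :: "(nat set \<Rightarrow> 'a::field) \<Rightarrow> (nat set \<Rightarrow> 'a) \<Rightarrow> (nat set \<Rightarrow> 'a)" where
  "vadd x y = (\<lambda>S. x S + y S)"
definition vscale :: "'a::field \<Rightarrow> (nat set \<Rightarrow> 'a) \<Rightarrow> (nat set \<Rightarrow> 'a)" where
  "vscale c x = (\<lambda>S. c * x S)"

text \<open>Place-permutation action: \<sigma>\<cdot>[S] = [\<sigma> ` S].\<close>
definition act :: "(nat \<Rightarrow> nat) \<Rightarrow> (nat set \<Rightarrow> 'a::field) \<Rightarrow> (nat set \<Rightarrow> 'a)" where
  "act \<sigma> x = (\<lambda>S. x (inv \<sigma> ` S))"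

definition submodule :: "nat \<Rightarrow> (nat set \<Rightarrow> 'a::field) set \<Rightarrow> bool" where
  "submodule r U \<longleftrightarrow> U \<subseteq> tensor_sp r \<and> vzero \<in> U \<and>
     (\<forall>x\<in>U. \<forall>y\<in>U. vadd x y \<in> U) \<and> (\<forall>c. \<forall>x\<in>U. vscale c x \<in> U) \<and>
     (\<forall>\<sigma>. \<sigma> permutes {0..<r} \<longrightarrow> (\<forall>x\<in>U. act \<sigma> x \<in> U))"

definition is_direct_sum :: "nat \<Rightarrow> (nat set \<Rightarrow> 'a::field) set \<Rightarrow> (nat set \<Rightarrow> 'a) set \<Rightarrow> (nat set \<Rightarrow> 'a) set \<Rightarrow> bool" where
  "is_direct_sum r V U W \<longleftrightarrow> submodule r U \<and> submodule r W \<and> U \<subseteq> V \<and> W \<subseteq> V \<and>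
     U \<inter> W = {vzero} \<and> (\<forall>v\<in>V. \<exists>u\<in>U. \<exists>w\<in>W. v = vadd u w)"

definition direct_summand :: "nat \<Rightarrow> (nat set \<Rightarrow> 'a::field) set \<Rightarrow> (nat set \<Rightarrow> 'a) set \<Rightarrow> bool" where
  "direct_summand r U V \<longleftrightarrow> (\<exists>W. is_direct_sum r V U W)"

definition indecomposable :: "nat \<Rightarrow> (nat set \<Rightarrow> 'a::field) set \<Rightarrow> bool" where
  "indecomposable r U \<longleftrightarrow> submodule r U \<and> U \<noteq> {vzero} \<and>
     \<not> (\<exists>A B. is_direct_sum r U A B \<and> A \<noteq> {vzero} \<and> B \<noteq> {vzero})"

definition module_iso :: "nat \<Rightarrow> (nat set \<Rightarrow> 'a::field) set \<Rightarrow> (nat set \<Rightarrow> 'a) set \<Rightarrow> bool" where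
  "module_iso r U V \<longleftrightarrow> (\<exists>\<phi>. bij_betw \<phi> U V \<and>
     (\<forall>x\<in>U. \<forall>y\<in>U. \<phi> (vadd x y) = vadd (\<phi> x) (\<phi> y)) \<and>
     (\<forall>c. \<forall>x\<in>U. \<phi> (vscale c x) = vscale c (\<phi> x)) \<and>
     (\<forall>\<sigma>. \<sigma> permutes {0..<r} \<longrightarrow> (\<forall>x\<in>U. \<phi> (act \<sigma> x) = act \<sigma> (\<phi> x))))"

text \<open>Polytabloid e_t for \<mu> = (r-k, k): a j, b j (j < k) are the entries of the j-th column
  of t (first and second row); the tabloid {t} corresponds to the set of second-row entries.\<close>
definition polytabloid :: "nat \<Rightarrow> (nat \<Rightarrow> nat) \<Rightarrow> (nat \<Rightarrow> nat) \<Rightarrow> (nat set \<Rightarrow> 'a::field)" where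
  "polytabloid k a b = (\<lambda>S. \<Sum>c\<in>Pow {0..<k}.
      if S = b ` ({0..<k} - c) \<union> a ` c then (-1) ^ card c else 0)"

definition column_data :: "nat \<Rightarrow> nat \<Rightarrow> (nat \<Rightarrow> nat) \<Rightarrow> (nat \<Rightarrow> nat) \<Rightarrow> bool" where
  "column_data r k a b \<longleftrightarrow> inj_on a {0..<k} \<and> inj_on b {0..<k} \<and>
     a ` {0..<k} \<subseteq> {0..<r} \<and> b ` {0..<k} \<subseteq> {0..<r} \<and> a ` {0..<k} \<inter> b ` {0..<k} = {}"

text \<open>Specht module S^\<mu>: the F-span of all polytabloids (requires k \<le> r - k).\<close>
definition specht :: "nat \<Rightarrow> nat \<Rightarrow> (nat set \<Rightarrow> 'a::field) set" where
  "specht r k = {x. \<exists>n (c :: nat \<Rightarrow> 'a) a b. (\<forall>i<n. column_data r k (a i) (b i)) \<and>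
      x = (\<lambda>S. \<Sum>i<n. c i * polytabloid k (a i) (b i) S)}"

definition young :: "nat \<Rightarrow> nat \<Rightarrow> (nat set \<Rightarrow> 'a::field) set \<Rightarrow> bool" where
  "young r k Y \<longleftrightarrow> direct_summand r Y (Mperm r k) \<and> indecomposable r Y \<and> specht r k \<subseteq> Y"

type_synonym 'a op = "(nat set \<Rightarrow> 'a) \<Rightarrow> (nat set \<Rightarrow> 'a)"

definition proj :: "nat \<Rightarrow> nat \<Rightarrow> 'a::field op" where
  "proj r k x = (\<lambda>S. if S \<subseteq> {0..<r} \<and> card S = k then x S else 0)"

text \<open>Divided powers: e^(i)[T] = \<Sum> of [U] over U \<subseteq> T with |T - U| = i (i entries 2 turned
  into 1), f^(i)[U] = \<Sum> of [T] over U \<subseteq> T \<subseteq> {0..<r} with |T - U| = i.\<close>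
definition e_div :: "nat \<Rightarrow> nat \<Rightarrow> 'a::field op" where
  "e_div r i x = (\<lambda>U. if U \<subseteq> {0..<r} then
      (\<Sum>T\<in>{T. U \<subseteq> T \<and> T \<subseteq> {0..<r} \<and> card (T - U) = i}. x T) else 0)"

definition f_div :: "nat \<Rightarrow> nat \<Rightarrow> 'a::field op" where
  "f_div r i x = (\<lambda>T. if T \<subseteq> {0..<r} then
      (\<Sum>U\<in>{U. U \<subseteq> T \<and> card (T - U) = i}. x U) else 0)"

definition bop :: "nat \<Rightarrow> nat \<Rightarrow> nat \<Rightarrow> 'a::field op" where
  "bop r k i = proj r k \<circ> f_div r i \<circ> e_div r i \<circ> proj r k"

definition oadd :: "'a::field op \<Rightarrow> 'a op \<Rightarrow> 'a op" where
  "oadd \<phi> \<psi> = (\<lambda>x S. \<phi> x S + \<psi> x S)"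
definition osub :: "'a::field op \<Rightarrow> 'a op \<Rightarrow> 'a op" where
  "osub \<phi> \<psi> = (\<lambda>x S. \<phi> x S - \<psi> x S)"
definition ozero :: "'a::field op" where
  "ozero = (\<lambda>x S. 0)"

text \<open>The Schur algebra S_F(\<lambda>) = End_{F S_r}(M^\<lambda>), realised as 1_\<lambda> S 1_\<lambda>: operators
  \<phi> = 1_\<lambda> \<phi> 1_\<lambda> that are linear and S_r-equivariant on M^\<lambda>; unit 1_\<lambda> = proj r k.\<close>
definition schur :: "nat \<Rightarrow> nat \<Rightarrow> 'a::field op set" where
  "schur r k = {\<phi>. (\<forall>x. \<phi> x = proj r k (\<phi> (proj r k x))) \<and>
     (\<forall>x\<in>Mperm r k. \<forall>y\<in>Mperm r k. \<phi> (vadd x y) = vadd (\<phi> x) (\<phi> y)) \<and>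
     (\<forall>c. \<forall>x\<in>Mperm r k. \<phi> (vscale c x) = vscale c (\<phi> x)) \<and>
     (\<forall>\<sigma>. \<sigma> permutes {0..<r} \<longrightarrow> (\<forall>x\<in>Mperm r k. \<phi> (act \<sigma> x) = act \<sigma> (\<phi> x)))}"

definition primitive_idem :: "nat \<Rightarrow> nat \<Rightarrow> 'a::field op \<Rightarrow> bool" where
  "primitive_idem r k e \<longleftrightarrow> e \<in> schur r k \<and> e \<circ> e = e \<and> e \<noteq> ozero \<and>
     \<not> (\<exists>e1\<in>schur r k. \<exists>e2\<in>schur r k. e1 \<circ> e1 = e1 \<and> e2 \<circ> e2 = e2 \<and>
          e1 \<noteq> ozero \<and> e2 \<noteq> ozero \<and> e1 \<circ> e2 = ozero \<and> e2 \<circ> e1 = ozero \<and> e = oadd e1 e2)"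

definition digit3 :: "nat \<Rightarrow> nat \<Rightarrow> nat" where
  "digit3 n u = n div 3 ^ u mod 3"

definition efactor :: "nat \<Rightarrow> nat \<Rightarrow> nat \<Rightarrow> nat \<Rightarrow> nat \<Rightarrow> 'a::field op" where
  "efactor r k n g u =
    (let nu = digit3 n u; gu = digit3 g u; one = proj r k;
         b1 = bop r k (3 ^ u); b2 = bop r k (2 * 3 ^ u) in
     if gu = 0 \<and> nu = 0 then osub (oadd one b1) b2
     else if gu = 1 \<and> nu = 2 then osub b2 b1
     else if gu = 0 \<and> nu = 1 then osub one b2
     else if gu = 2 \<and> nu = 2 then b2
     else if gu = 0 \<and> nu = 2 then oadd (osub one b1) b2
     else if gu = 1 \<and> nu = 1 then osub b1 b2
     else one)"

text \<open>e_{m,g} in S_F(\<lambda>), \<lambda>_2 = k, r = \<lambda>_1 + \<lambda>_2. Digit positions u > r contribute the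
  factor 1 (all b(a) with a > \<lambda>_2 vanish and the digits of m + 2g \<le> r vanish there).\<close>
definition e_mg :: "nat \<Rightarrow> nat \<Rightarrow> nat \<Rightarrow> nat \<Rightarrow> 'a::field op" where
  "e_mg r k m g = foldr (\<lambda>u acc. efactor r k (m + 2 * g) g u \<circ> acc) [0..<Suc r] (proj r k)"

end

theory Submission
  imports Defs
begin

text \<open>
  With respect to the basis of \<open>k\<close>-subsets, every endomorphism of the permutation module has matrix
  entries depending only on intersection sizes, so the algebra is spanned by the commuting
  operators \<open>b(i)\<close>. In characteristic 3 the product formula and Lucas' theorem give \<open>b(i)\<close> as a
  product over the base-3 digits of \<open>i\<close>, and turn the relations for \<open>b(3\<^sup>u)\<close> and \<open>b(2 \<cdot> 3\<^sup>u)\<close> into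
  relations of a three-dimensional algebra, once the lower digits have been split off by an
  idempotent. Hence the factors of \<open>e\<^sub>m\<^sub>,\<^sub>g\<close> may be multiplied up digit by digit, and the result is an
  idempotent \<open>e\<close> such that every \<open>b(i)\<^sup>3 e\<close> is a scalar multiple of \<open>e\<close>. Since cubing is additive, an
  idempotent \<open>f = f e = f\<^sup>3 e\<close> is a scalar multiple of \<open>e\<close>, so \<open>e\<close> is primitive.

  If an idempotent \<open>e'\<close> has image isomorphic to \<open>Y\<^sup>\<mu>\<close>, let \<open>w\<close> be the vector in its image corresponding to
  a polytabloid. The symmetry of \<open>w\<close> determines it up to a scalar, so every \<open>b(i)\<close> acts on \<open>w\<close> by a
  scalar, a product of two binomial coefficients, and \<open>e\<close> fixes \<open>w\<close>. Thus \<open>e e'\<close> is a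
  nonzero idempotent below \<open>e\<close>, hence equal to \<open>e\<close>, and \<open>e = e'\<close> because \<open>Y\<^sup>\<mu>\<close> is indecomposable.
\<close>

section \<open>Binomial coefficients in characteristic three\<close>

text \<open>The six shapes of digit factor come from a cubic. Let \<open>q = 3 ^ u\<close> and let
  \<open>s\<close> be the digit of \<open>m\<close> at \<open>u\<close> plus the incoming carry.
  Below the idempotent of the lower digits, b(2q) equals x^2 - (s + 2) x for x = b(q), and x is a
  root of X^2 (X + 1) if s is 0 or 1 mod 3, of X (X - 1)^2 if s is 2 mod 3. Two distinct roots give
  two complementary idempotents, the factors belonging to I^(s) and J^(s). Because of the double
  root, b(i) e is in general not a scalar multiple of e; cubing is additive and kills the nilpotent
  part. Nonvanishing of B(m,g) makes each digit of g at most the digit of m + 2g, which leaves six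
  pairs of digits, one for each factor. This nonvanishing is itself extracted from the splitting of
  the Young module: the map from M^\<lambda> through Y^\<mu> into M^\<mu>, applied to the vector w
  and read off at a single tabloid, is a multiple of B(m,g).\<close>

lemma of_nat_add_three_mult:
  assumes "(3::'r::comm_ring_1) = 0"
  shows "(of_nat (3 * a + c) :: 'r) = of_nat c"
  using assms by simp

lemma of_nat_mod_three:
  assumes "(3::'r::comm_ring_1) = 0"
  shows "(of_nat a :: 'r) = of_nat (a mod 3)"
  using of_nat_add_three_mult[OF assms, of "a div 3" "a mod 3"] by simp

text \<open>Coefficient of X^y in the Frobenius identity (1 + X)^(x + q) = (1 + X)^x (1 + X^q) for
  \<open>q = 3 ^ u\<close>. It is stated in a ring with 3 = 0 because all later coefficients live
  there.\<close>

lemma choose_add_pow3: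
  assumes "(3::'r::comm_ring_1) = 0"
  shows "(of_nat ((x + 3 ^ u) choose y) :: 'r)
       = of_nat (x choose y) + (if 3 ^ u \<le> y then of_nat (x choose (y - 3 ^ u)) else 0)"
proof (induction u arbitrary: x y)
  case 0
  show ?case by (cases y) (simp_all add: add.commute)
next
  case (Suc u)
  let ?q = "3 ^ u :: nat"
  have e: "x + 3 ^ Suc u = x + ?q + ?q + ?q" by simp
  have t: "a + a + a = 0" for a :: 'r
  proof -
    have "a + a + a = 3 * a" by (simp add: algebra_simps)
    then show ?thesis using assms by simp
  qed
  have t': "a + (a + (a + c)) = c" for a c :: 'r
    using t[of a] by (simp add: add.assoc[symmetric])
  \<comment> \<open>Adding \<open>?q\<close> three times puts the weights 1, 3, 3, 1 on the shifts
    \<open>f 0\<close> to \<open>f 3\<close>, so the middle two vanish.\<close>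
  define f where "f j = (if j * ?q \<le> y then of_nat (x choose (y - j * ?q)) else 0 :: 'r)" for j
  have "(of_nat ((x + 3 ^ Suc u) choose y) :: 'r) = f 0 + f 1 + f 1 + f 1 + f 2 + f 2 + f 2 + f 3"
    unfolding e Suc f_def by (auto simp: algebra_simps le_diff_conv2 diff_diff_eq numeral_eq_Suc)
  also have "\<dots> = f 0 + f 3"
    using t[of "f 1"] t[of "f 2"] by (simp add: add.assoc t')
  finally show ?case by (simp add: f_def)
qed

text \<open>Lucas' theorem cut at one position: \<open>a\<close> and \<open>c\<close> hold the high
  digits, \<open>i\<close> and \<open>j\<close> the low ones. Each induction step splits off one
  factor 1 + X^(3^u), so the high part obeys Pascal's rule.\<close>

lemma lucas_pow3:
  assumes "(3::'r::comm_ring_1) = 0" "i < 3 ^ u" "j < 3 ^ u"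
  shows "(of_nat ((3 ^ u * a + i) choose (3 ^ u * c + j)) :: 'r)
       = of_nat (a choose c) * of_nat (i choose j)"
proof (induction a arbitrary: c)
  case 0
  show ?case
  proof (cases c)
    case (Suc c')
    have "i < 3 ^ u * c + j" using assms(2) Suc by simp
    then show ?thesis using Suc by (simp add: binomial_eq_0)
  qed simp
next
  case (Suc a)
  let ?q = "3 ^ u :: nat"
  have e: "?q * Suc a + i = (?q * a + i) + ?q" by simp
  show ?case
  proof (cases c)
    case 0
    then show ?thesis unfolding e choose_add_pow3[OF assms(1)] Suc using assms(3) by simp
  next
    case (Suc c')
    have "?q * c + j - ?q = ?q * c' + j" "?q \<le> ?q * c + j" using Suc by simp_all
    then show ?thesis unfolding e choose_add_pow3[OF assms(1)]
      using Suc.IH[of c] Suc.IH[of c'] Suc by (simp add: algebra_simps)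
  qed
qed

lemma lucas_pow3':
  assumes "(3::'r::comm_ring_1) = 0"
  shows "(of_nat (x choose y) :: 'r)
       = of_nat (x div 3 ^ u choose (y div 3 ^ u)) * of_nat (x mod 3 ^ u choose (y mod 3 ^ u))"
  using lucas_pow3[OF assms, of "x mod 3 ^ u" u "y mod 3 ^ u" "x div 3 ^ u" "y div 3 ^ u"] by simp

lemma lucas_pow3_digit:
  assumes "(3::'r::comm_ring_1) = 0" "c < 3"
  shows "(of_nat (x choose (c * 3 ^ u)) :: 'r) = of_nat (digit3 x u choose c)"
proof -
  have "(of_nat (x choose (c * 3 ^ u)) :: 'r) = of_nat ((x div 3 ^ u) choose c)"
    using lucas_pow3'[OF assms(1), of x "c * 3 ^ u" u] by simp
  also have "\<dots> = of_nat (digit3 x u choose c)"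
    using lucas_pow3'[OF assms(1), of "x div 3 ^ u" c 1] assms(2) by (simp add: digit3_def)
  finally show ?thesis .
qed

text \<open>By Lucas a nonzero binomial has a nonzero low part at every cut. In other words,
  subtracting \<open>g\<close> from \<open>n\<close> never borrows across position
  \<open>u\<close>.\<close>

lemma choose_nonzero_mod_le:
  assumes "(3::'r::comm_ring_1) = 0" "(of_nat (n choose g) :: 'r) \<noteq> 0"
  shows "g mod 3 ^ u \<le> n mod 3 ^ u"
proof (rule ccontr)
  assume "\<not> ?thesis"
  then have z: "n mod 3 ^ u choose (g mod 3 ^ u) = 0" by (simp add: binomial_eq_0)
  have "(of_nat (n choose g) :: 'r) = 0" unfolding lucas_pow3'[OF assms(1), of n g u] z by simp
  with assms(2) show False ..
qed

lemma choose_nonzero_digit_le: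
  assumes "(3::'r::comm_ring_1) = 0" "(of_nat (n choose g) :: 'r) \<noteq> 0"
  shows "digit3 g u \<le> digit3 n u"
proof -
  have "(of_nat ((n div 3 ^ u) choose (g div 3 ^ u)) :: 'r) \<noteq> 0"
    using lucas_pow3'[OF assms(1), of n g u] assms(2) by auto
  from choose_nonzero_mod_le[OF assms(1) this, of 1] show ?thesis by (simp add: digit3_def)
qed

text \<open>Without borrows, subtraction works digit by digit. With \<open>n = m + 2 * g\<close>
  this yields the digits of \<open>m + g\<close>, on which the eigenvalues of the b(i)
  depend.\<close>

lemma digit_diff:
  assumes "\<And>u. digit3 g u \<le> digit3 n u" "\<And>u. g mod 3 ^ u \<le> n mod 3 ^ u" "g \<le> n"
  shows "digit3 (n - g) u = digit3 n u - digit3 g u"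
proof -
  let ?q = "3 ^ u :: nat"
  have d: "g div ?q \<le> n div ?q" using assms(3) by (rule div_le_mono)
  have "n - g = (n div ?q * ?q + n mod ?q) - (g div ?q * ?q + g mod ?q)"
    by (simp only: div_mult_mod_eq)
  also have "\<dots> = (n div ?q - g div ?q) * ?q + (n mod ?q - g mod ?q)"
    using assms(2)[of u] d mult_le_mono1[OF d, of ?q] by (simp only: diff_mult_distrib)
  finally have "(n - g) div ?q = n div ?q - g div ?q"
    by (simp add: less_imp_diff_less)
  moreover have "(n div ?q - g div ?q) mod 3 = n div ?q mod 3 - g div ?q mod 3"
  proof -
    have "n div ?q - g div ?q = 3 * (n div ?q div 3 - g div ?q div 3) + (n div ?q mod 3 - g div ?q mod 3)"
      using assms(1)[of u] div_le_mono[OF d, of 3]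
        mult_div_mod_eq[of 3 "n div ?q"] mult_div_mod_eq[of 3 "g div ?q"]
      unfolding digit3_def diff_mult_distrib2 by linarith
    then show ?thesis by (simp add: less_imp_diff_less mod_less)
  qed
  ultimately show ?thesis by (simp add: digit3_def)
qed

section \<open>The idempotent in the abstract algebra\<close>

text \<open>Isolates what the digit calculus uses. The sum may start at 0 instead of max(i,j), since
  the additional terms contain a vanishing binomial coefficient.\<close>

locale b_ring =
  fixes b :: "nat \<Rightarrow> 'r::comm_ring_1" and m :: nat
  assumes three: "(3::'r) = 0" and b0: "b 0 = 1"
    and mult: "\<And>i j. b i * b j = (\<Sum>h\<le>i + j. of_nat ((h choose i) * (h choose j) * ((m + i + j) choose (i + j - h))) * b h)"
begin

text \<open>Only the top term of the product formula survives: below \<open>3 ^ u * c\<close> the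
  factor \<open>h choose (3 ^ u * c)\<close> is 0, and for \<open>h = 3 ^ u * c + t\<close> with
  \<open>t < a\<close> Lucas reduces \<open>h choose a\<close> to \<open>t choose a\<close>, which
  is 0. Iterated, this is the factorisation of b(i) over the digits of i.\<close>

lemma b_mult_low:
  assumes "a < 3 ^ u"
  shows "b a * b (3 ^ u * c) = b (3 ^ u * c + a)"
proof -
  let ?q = "3 ^ u :: nat" and ?N = "a + 3 ^ u * c"
  let ?t = "\<lambda>h. of_nat ((h choose a) * (h choose (?q * c)) * ((m + a + ?q * c) choose (?N - h))) * b h"
  have z: "?t h = 0" if "h < ?N" for h
  proof (cases "h < ?q * c")
    case True
    then show ?thesis by (simp add: binomial_eq_0)
  next
    case False
    then obtain t where t: "h = ?q * c + t" "t < a" using \<open>h < ?N\<close>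
      by (metis add.commute add_less_cancel_left le_add_diff_inverse not_less)
    have "(of_nat (h choose a) :: 'r) = 0"
      using lucas_pow3[OF three, of t u a c 0] t assms by (simp add: binomial_eq_0)
    then show ?thesis by simp
  qed
  have "b a * b (?q * c) = (\<Sum>h\<le>?N. ?t h)" by (rule mult)
  also have "\<dots> = ?t ?N + sum ?t ({..?N} - {?N})" by (rule sum.remove) auto
  also have "sum ?t ({..?N} - {?N}) = 0" by (rule sum.neutral) (use z in auto)
  also have "?t ?N = b ?N"
    using lucas_pow3[OF three, of a u a c 0] lucas_pow3[OF three, of a u 0 c c] assms
    by (simp add: add.commute)
  finally show ?thesis by (simp add: add.commute)
qed

text \<open>The contribution of the digits below \<open>q\<close> to the relations between \<open>b(q)\<close> and \<open>b(2q)\<close>. The idempotent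
  built from these digits turns it into a scalar, the carry in the addition \<open>m + 2g\<close>.\<close>
definition Z :: "nat \<Rightarrow> 'r" where
  "Z q = (\<Sum>s\<in>{0<..<q}. of_nat (m choose (q - s)) * b s)"

lemma Z_1: "Z (Suc 0) = 0"
proof -
  have "{0<..<Suc 0} = {}" by auto
  then show ?thesis by (simp add: Z_def)
qed

lemma sum_union_three:
  assumes "finite A" "finite B" "finite C" "A \<inter> B = {}" "A \<inter> C = {}" "B \<inter> C = {}"
  shows "sum f (A \<union> B \<union> C) = sum f A + sum f B + (sum f C :: 'r)"
  using assms by (simp add: sum.union_disjoint Int_Un_distrib2)

lemma sum_block:
  fixes f :: "nat \<Rightarrow> 'r"
  assumes "q > 0"
  shows "sum f {q * c..<q * Suc c} = f (q * c) + (\<Sum>s\<in>{0<..<q}. f (q * c + s))"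
proof -
  have "sum f {q * c..<q * Suc c} = (\<Sum>s\<in>{0..<q}. f (q * c + s))"
    using sum.shift_bounds_nat_ivl[of f 0 "q * c" q] by (simp add: add.commute)
  also have "{0..<q} = insert 0 {0<..<q}" using assms by auto
  finally show ?thesis by simp
qed

text \<open>Lucas for an index with nonzero low part \<open>3 ^ u - s\<close>. The low factor is
  written with \<open>m\<close> instead of \<open>m mod 3 ^ u\<close>, which has the same value mod
  3, so that it matches the coefficients of \<open>Z\<close>.\<close>

lemma choose_complement:
  assumes "0 < s" "s < 3 ^ u"
  shows "(of_nat ((m + 3 ^ u * a) choose (3 ^ u * c + (3 ^ u - s))) :: 'r)
       = of_nat ((m div 3 ^ u + a) choose c) * of_nat (m choose (3 ^ u - s))"
proof -
  have "(3 ^ u * c + (3 ^ u - s)) div 3 ^ u = c" "(3 ^ u * c + (3 ^ u - s)) mod 3 ^ u = 3 ^ u - s"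
    using assms by (simp_all only: div_mult_self4 mod_mult_self4) simp_all
  then show ?thesis
    using lucas_pow3'[OF three, of "m + 3 ^ u * a" "3 ^ u * c + (3 ^ u - s)" u]
      lucas_pow3'[OF three, of m "3 ^ u - s" u] assms
    by (simp only: div_mult_self2 mod_mult_self2) (simp add: add.commute)
qed

lemma choose_multiple:
  "(of_nat ((m + 3 ^ u * a) choose (3 ^ u * c)) :: 'r) = of_nat ((m div 3 ^ u + a) choose c)"
  using lucas_pow3'[OF three, of "m + 3 ^ u * a" "3 ^ u * c" u] by (simp add: add.commute)

text \<open>A block consists of the \<open>h\<close> with a fixed quotient \<open>c\<close> by
  \<open>q = 3 ^ u\<close>. Its first term has no low part and gives a pure scalar; the terms
  \<open>h = q * c + s\<close> give \<open>b s * b (q * c)\<close> with weight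
  \<open>m choose (q - s)\<close> and add up to \<open>Z q\<close>. The weight \<open>w\<close> is
  the part of the coefficient that Lucas shows to be constant on the block.\<close>

lemma block_product:
  assumes "\<And>h. 3 ^ u * c \<le> h \<Longrightarrow> h < 3 ^ u * Suc c \<Longrightarrow>
      f h = w * of_nat ((m + 3 ^ u * a) choose (3 ^ u * (c + Suc d) - h)) * b h"
  shows "sum f {3 ^ u * c..<3 ^ u * Suc c}
      = w * (of_nat ((m div 3 ^ u + a) choose Suc d) + of_nat ((m div 3 ^ u + a) choose d) * Z (3 ^ u)) * b (3 ^ u * c)"
proof -
  let ?q = "3 ^ u :: nat"
  have 1: "f (?q * c) = w * of_nat ((m div ?q + a) choose Suc d) * b (?q * c)"
  proof -
    have "?q * (c + Suc d) - ?q * c = ?q * Suc d" by (simp add: algebra_simps)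
    then show ?thesis using assms[of "?q * c"] choose_multiple[of u a "Suc d"] by simp
  qed
  have 2: "f (?q * c + s) = w * of_nat ((m div ?q + a) choose d) * (of_nat (m choose (?q - s)) * b s) * b (?q * c)"
    if "s \<in> {0<..<?q}" for s
  proof -
    have "?q * (c + Suc d) - (?q * c + s) = ?q * d + (?q - s)"
      using that by (simp add: algebra_simps)
    then have "f (?q * c + s) = w * (of_nat ((m div ?q + a) choose d) * of_nat (m choose (?q - s))) * (b s * b (?q * c))"
      using assms[of "?q * c + s"] choose_complement[of s u a d] b_mult_low[of s u c] that
      by simp
    then show ?thesis by (simp only: mult.assoc)
  qed
  have "(\<Sum>s\<in>{0<..<?q}. f (?q * c + s))
      = (\<Sum>s\<in>{0<..<?q}. w * of_nat ((m div ?q + a) choose d) * (of_nat (m choose (?q - s)) * b s) * b (?q * c))"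
    by (rule sum.cong[OF refl 2])
  also have "\<dots> = w * of_nat ((m div ?q + a) choose d) * Z ?q * b (?q * c)"
    by (simp add: Z_def sum_distrib_left sum_distrib_right)
  finally show ?thesis
    unfolding sum_block[of ?q f c, OF zero_less_power[OF zero_less_numeral]] 1
    by (simp only: distrib_left distrib_right mult.assoc)
qed


section \<open>The relations between b(q) and b(2q), and the recursion for Z\<close>

lemma b1_square:
  "b (3 ^ u) * b (3 ^ u) = (of_nat (m div 3 ^ u + 2) + Z (3 ^ u)) * b (3 ^ u) + b (2 * 3 ^ u)"
proof -
  let ?q = "3 ^ u :: nat"
  let ?t = "\<lambda>h. of_nat ((h choose ?q) * (h choose ?q) * ((m + ?q + ?q) choose (?q + ?q - h))) * b h"
  have s: "{..?q + ?q} = {..<?q} \<union> {?q * 1..<?q * Suc 1} \<union> {?q + ?q}" by auto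
  have "b ?q * b ?q = (\<Sum>h\<le>?q + ?q. ?t h)" by (rule mult)
  also have "\<dots> = sum ?t {..<?q} + sum ?t {?q * 1..<?q * Suc 1} + ?t (?q + ?q)"
    unfolding s by (subst sum_union_three) auto
  also have "sum ?t {..<?q} = 0" by (rule sum.neutral) (simp add: binomial_eq_0)
  also have "sum ?t {?q * 1..<?q * Suc 1} = 1 * (of_nat ((m div 3 ^ u + 2) choose Suc 0) + of_nat ((m div 3 ^ u + 2) choose 0) * Z ?q) * b (?q * 1)"
  proof (rule block_product)
    fix h assume h: "?q * 1 \<le> h" "h < ?q * Suc 1"
    have "(of_nat (h choose ?q) :: 'r) = 1"
      using lucas_pow3[OF three, of "h - ?q" u 0 1 1] h by simp
    then show "?t h = 1 * of_nat (m + ?q * 2 choose (?q * (1 + Suc 0) - h)) * b h"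
      by (simp add: algebra_simps mult_2)
  qed
  also have "?t (?q + ?q) = b (2 * ?q)"
  proof -
    have "(of_nat ((?q + ?q) choose ?q) :: 'r) = 2"
      using lucas_pow3[OF three, of 0 u 0 2 1] by (simp add: mult_2 mult.commute)
    moreover have "(2 * 2 :: 'r) = 1"
    proof -
      have "(2 * 2 :: 'r) = 3 + 1" by simp
      then show ?thesis using three by simp
    qed
    ultimately show ?thesis by (simp add: mult_2)
  qed
  finally show ?thesis by simp
qed

lemma b1_b2:
  "b (3 ^ u) * b (2 * 3 ^ u) = 2 * (of_nat (m div 3 ^ u) + Z (3 ^ u)) * b (2 * 3 ^ u)"
proof -
  let ?q = "3 ^ u :: nat"
  let ?t = "\<lambda>h. of_nat ((h choose ?q) * (h choose (2 * ?q)) * ((m + ?q + 2 * ?q) choose (?q + 2 * ?q - h))) * b h"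
  have s: "{..?q + 2 * ?q} = {..<2 * ?q} \<union> {?q * 2..<?q * Suc 2} \<union> {?q + 2 * ?q}" by auto
  have "b ?q * b (2 * ?q) = (\<Sum>h\<le>?q + 2 * ?q. ?t h)" by (rule mult)
  also have "\<dots> = sum ?t {..<2 * ?q} + sum ?t {?q * 2..<?q * Suc 2} + ?t (?q + 2 * ?q)"
    unfolding s by (subst sum_union_three) auto
  also have "sum ?t {..<2 * ?q} = 0" by (rule sum.neutral) (simp add: binomial_eq_0)
  \<comment> \<open>On this block \<open>h choose ?q\<close> is 2 and
    \<open>h choose (2 * ?q)\<close> is 1, hence the weight 2. The shift by 3 comes from
    \<open>m + 3 * ?q\<close> and disappears mod 3 at the end.\<close>
  also have "sum ?t {?q * 2..<?q * Suc 2} = 2 * (of_nat ((m div 3 ^ u + 3) choose Suc 0) + of_nat ((m div 3 ^ u + 3) choose 0) * Z ?q) * b (?q * 2)"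
  proof (rule block_product)
    fix h assume h: "?q * 2 \<le> h" "h < ?q * Suc 2"
    have "(of_nat (h choose ?q) :: 'r) = 2"
      using lucas_pow3[OF three, of "h - ?q * 2" u 0 2 1] h by simp
    moreover have "(of_nat (h choose (2 * ?q)) :: 'r) = 1"
      using lucas_pow3[OF three, of "h - ?q * 2" u 0 2 2] h by (simp add: mult.commute)
    moreover have "m + ?q + 2 * ?q = m + ?q * 3" "?q + 2 * ?q = ?q * (2 + Suc 0)" by simp_all
    ultimately show "?t h = 2 * of_nat (m + ?q * 3 choose (?q * (2 + Suc 0) - h)) * b h"
      by (simp only: of_nat_mult mult_1_right)
  qed
  also have "?t (?q + 2 * ?q) = 0"
  proof -
    have "(of_nat ((?q + 2 * ?q) choose ?q) :: 'r) = 0"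
      using lucas_pow3[OF three, of 0 u 0 3 1] three by (simp add: mult.commute)
    then show ?thesis by simp
  qed
  finally show ?thesis using three by (simp add: mult.commute)
qed

lemma b2_square:
  "b (2 * 3 ^ u) * b (2 * 3 ^ u)
   = (of_nat ((m div 3 ^ u + 4) choose 2) + of_nat (m div 3 ^ u + 1) * Z (3 ^ u)) * b (2 * 3 ^ u)"
proof -
  let ?q = "3 ^ u :: nat"
  let ?t = "\<lambda>h. of_nat ((h choose (2 * ?q)) * (h choose (2 * ?q)) * ((m + 2 * ?q + 2 * ?q) choose (2 * ?q + 2 * ?q - h))) * b h"
  have s: "{..2 * ?q + 2 * ?q} = {..<2 * ?q} \<union> {?q * 2..<?q * Suc 2} \<union> {?q * 3..2 * ?q + 2 * ?q}" by auto
  have "b (2 * ?q) * b (2 * ?q) = (\<Sum>h\<le>2 * ?q + 2 * ?q. ?t h)" by (rule mult)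
  also have "\<dots> = sum ?t {..<2 * ?q} + sum ?t {?q * 2..<?q * Suc 2} + sum ?t {?q * 3..2 * ?q + 2 * ?q}"
    unfolding s by (subst sum_union_three) auto
  also have "sum ?t {..<2 * ?q} = 0" by (rule sum.neutral) (simp add: binomial_eq_0)
  also have "sum ?t {?q * 2..<?q * Suc 2} = 1 * (of_nat ((m div 3 ^ u + 4) choose Suc 1) + of_nat ((m div 3 ^ u + 4) choose 1) * Z ?q) * b (?q * 2)"
  proof (rule block_product)
    fix h assume h: "?q * 2 \<le> h" "h < ?q * Suc 2"
    have "(of_nat (h choose (2 * ?q)) :: 'r) = 1"
      using lucas_pow3[OF three, of "h - ?q * 2" u 0 2 2] h by (simp add: mult.commute)
    moreover have "m + 2 * ?q + 2 * ?q = m + ?q * 4" "2 * ?q + 2 * ?q = ?q * (2 + Suc 1)" by simp_all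
    ultimately show "?t h = 1 * of_nat (m + ?q * 4 choose (?q * (2 + Suc 1) - h)) * b h"
      by (simp only: of_nat_mult mult_1_right)
  qed
  \<comment> \<open>For the quotients 3 and 4 the factor \<open>h choose (2 * ?q)\<close> is 3 or 6,
    so nothing above the block of b(2q) survives and the relations close up within one
    digit.\<close>
  also have "sum ?t {?q * 3..2 * ?q + 2 * ?q} = 0"
  proof (rule sum.neutral, rule ballI)
    fix h assume h: "h \<in> {?q * 3..2 * ?q + 2 * ?q}"
    have "(of_nat (h choose (2 * ?q)) :: 'r) = 0"
    proof (cases "h = ?q * 4")
      case True
      have "(of_nat (4 choose 2) :: 'r) = 2 * 3" by (simp add: choose_two)
      then show ?thesis
        using lucas_pow3[OF three, of 0 u 0 4 2] True three by (simp add: mult.commute)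
    next
      case False
      then have "h - ?q * 3 < ?q" using h by auto
      moreover have "(of_nat (3 choose 2) :: 'r) = 3" by (simp add: choose_two)
      ultimately show ?thesis
        using lucas_pow3[OF three, of "h - ?q * 3" u 0 3 2] h three by (simp add: mult.commute)
    qed
    then show "?t h = 0" by simp
  qed
  finally have "b (2 * ?q) * b (2 * ?q) = (of_nat ((m div ?q + 4) choose 2) + of_nat (m div ?q + 4) * Z ?q) * b (2 * ?q)"
    by (simp only: add_0 add_0_right mult_1_left binomial_1 One_nat_def numeral_2_eq_2 mult.commute[of _ "Suc (Suc 0)"] choose_one)
  moreover have "(of_nat (m div ?q + 4) :: 'r) = of_nat (m div ?q + 1)"
    using of_nat_add_three_mult[OF three, of 1 "m div ?q + 1"] by (simp add: add.commute)
  ultimately show ?thesis by (simp only:)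
qed

text \<open>The range is cut at \<open>3 ^ u\<close> and \<open>2 * 3 ^ u\<close>: the lowest part
  reproduces \<open>Z (3 ^ u)\<close> with a scalar in front, the other two are blocks. The
  recursion is what lets \<open>Z\<close> be evaluated along with the digit factors.\<close>

lemma Z_step:
  "Z (3 ^ Suc u) = of_nat ((m div 3 ^ u) choose 2) * b (3 ^ u) + of_nat (m div 3 ^ u) * b (2 * 3 ^ u)
     + Z (3 ^ u) * (of_nat ((m div 3 ^ u) choose 2) + of_nat (m div 3 ^ u) * b (3 ^ u) + b (2 * 3 ^ u))"
proof -
  let ?q = "3 ^ u :: nat"
  let ?t = "\<lambda>s. of_nat (m choose (3 ^ Suc u - s)) * b s"
  have s: "{0<..<3 ^ Suc u} = {0<..<?q} \<union> {?q * 1..<?q * Suc 1} \<union> {?q * 2..<?q * Suc 2}"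
    by (auto simp: not_le)
  have e: "3 ^ Suc u = ?q * (1 + Suc 1)" "3 ^ Suc u = ?q * (2 + Suc 0)" by simp_all
  have "Z (3 ^ Suc u) = sum ?t {0<..<?q} + sum ?t {?q * 1..<?q * Suc 1} + sum ?t {?q * 2..<?q * Suc 2}"
    unfolding Z_def s by (subst sum_union_three) auto
  also have "sum ?t {0<..<?q} = of_nat ((m div 3 ^ u) choose 2) * Z ?q"
  proof -
    have "?t s = of_nat ((m div 3 ^ u) choose 2) * (of_nat (m choose (?q - s)) * b s)" if "s \<in> {0<..<?q}" for s
    proof -
      have e: "3 ^ Suc u - s = ?q * 2 + (?q - s)" using that by simp
      have "0 < s" "s < ?q" using that by simp_all
      from choose_complement[OF this, of 0 2] show ?thesis
        unfolding e by (simp only: mult_0_right add_0_right mult.assoc)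
    qed
    then show ?thesis unfolding Z_def sum_distrib_left by (rule sum.cong[OF refl])
  qed
  also have "sum ?t {?q * 1..<?q * Suc 1} = 1 * (of_nat ((m div 3 ^ u + 0) choose Suc 1) + of_nat ((m div 3 ^ u + 0) choose 1) * Z ?q) * b (?q * 1)"
    by (rule block_product) (simp only: e(1) mult_0_right add_0_right mult_1_left)
  also have "sum ?t {?q * 2..<?q * Suc 2} = 1 * (of_nat ((m div 3 ^ u + 0) choose Suc 0) + of_nat ((m div 3 ^ u + 0) choose 0) * Z ?q) * b (?q * 2)"
    by (rule block_product) (simp only: e(2) mult_0_right add_0_right mult_1_left)
  finally have eq: "Z (3 ^ Suc u) = of_nat ((m div 3 ^ u) choose 2) * Z ?q
      + (of_nat ((m div 3 ^ u) choose 2) + of_nat (m div 3 ^ u) * Z ?q) * b ?q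
      + (of_nat (m div 3 ^ u) + Z ?q) * b (2 * ?q)"
    by (simp only: mult_1_left mult_1_right add_0_right Suc_1 choose_one binomial_n_0 of_nat_1
        One_nat_def[symmetric] mult.commute[of ?q 2])
  have "c * z + (c + k * z) * x + (k + z) * y = c * x + k * y + z * (c + k * x + y)"
    for c z k x y :: 'r by (simp add: algebra_simps)
  then show ?thesis unfolding eq .
qed


end

section \<open>One base-3 digit\<close>

lemma char3_numerals:
  assumes "(3::'r::comm_ring_1) = 0"
  shows "(2::'r) = - 1" "(4::'r) = 1" "(5::'r) = - 1" "(6::'r) = 0"
proof -
  have "(2::'r) = 3 - 1" "(4::'r) = 3 + 1" "(5::'r) = 3 + 3 - 1" "(6::'r) = 3 + 3" by simp_all
  then show "(2::'r) = - 1" "(4::'r) = 1" "(5::'r) = - 1" "(6::'r) = 0" unfolding assms by simp_all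
qed

text \<open>\<open>efactor\<close> over an arbitrary commutative ring: \<open>gd\<close> and
  \<open>nd\<close> are the digits of g and m + 2g, and \<open>x\<close>, \<open>y\<close> stand for
  b(3^u) and b(2 * 3^u).\<close>

definition factor3 :: "nat \<Rightarrow> nat \<Rightarrow> 'r \<Rightarrow> 'r \<Rightarrow> 'r::comm_ring_1" where
  "factor3 gd nd x y =
    (if gd = 0 \<and> nd = 0 then 1 + x - y
     else if gd = 1 \<and> nd = 2 then y - x
     else if gd = 0 \<and> nd = 1 then 1 - y
     else if gd = 2 \<and> nd = 2 then y
     else if gd = 0 \<and> nd = 2 then 1 - x + y
     else if gd = 1 \<and> nd = 1 then x - y
     else 1)"

text \<open>Here \<open>a\<close> is the product of the factors of the lower digits, and
  \<open>s\<close> is the digit of \<open>m\<close> plus the carry, so \<open>s = 3\<close> can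
  occur. For each residue of \<open>s\<close>, the conditions \<open>sn\<close> and
  \<open>gd \<le> nd\<close> leave two pairs of digits, and their two factors add up to 1. The
  scalars for the cubes are the contributions of this digit to the eigenvalues in
  \<open>bop_polysym\<close>. The last two claims turn the next \<open>Z\<close> into the outgoing
  carry; for \<open>s\<close> divisible by 3 that \<open>Z\<close> is already constant below
  \<open>a\<close>.\<close>

lemma factor3_step:
  fixes a x y :: "'r::comm_ring_1"
  assumes three: "(3::'r) = 0" and gn: "gd \<le> nd" "nd < 3" and sn: "(s + 2 * gd) mod 3 = nd"
    and xx: "a * (x * x) = of_nat (s + 2) * (a * x) + a * y"
    and xy: "a * (x * y) = 2 * of_nat s * (a * y)"
    and yy: "a * (y * y) = of_nat ((s + 1) choose 2) * (a * y)"
    and s: "s \<le> 3"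
  shows "a * (factor3 gd nd x y * factor3 gd nd x y) = a * factor3 gd nd x y"
    and "a * factor3 gd nd x y * x ^ 3 = of_nat (gd * (nd - gd + 1)) * (a * factor3 gd nd x y)"
    and "a * factor3 gd nd x y * y ^ 3 = of_nat ((gd choose 2) * ((nd - gd + 2) choose 2)) * (a * factor3 gd nd x y)"
    and "s mod 3 = 1 \<Longrightarrow> a * factor3 gd nd x y * y = of_nat ((s + 2 * gd) div 3) * (a * factor3 gd nd x y)"
    and "s = 2 \<Longrightarrow> a * factor3 gd nd x y * (x - y) = of_nat ((s + 2 * gd) div 3) * (a * factor3 gd nd x y)"
proof -
  note num = three char3_numerals[OF three]
  have c: "a * (z * (v * w)) = z * (a * (v * w))" for z v w by (simp only: mult.left_commute)
  have d: "s = 0 \<or> s = 1 \<or> s = 2 \<or> s = 3" using s by auto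
  consider "s mod 3 = 0" "gd = 0" "nd = 0" | "s mod 3 = 0" "gd = 1" "nd = 2"
    | "s mod 3 = 1" "gd = 0" "nd = 1" | "s mod 3 = 1" "gd = 2" "nd = 2"
    | "s mod 3 = 2" "gd = 0" "nd = 2" | "s mod 3 = 2" "gd = 1" "nd = 1"
  proof -
    have "gd = 0 \<or> gd = 1 \<or> gd = 2" "nd = 0 \<or> nd = 1 \<or> nd = 2" using gn by auto
    then show thesis using that gn sn d by auto
  qed
  then have "a * (factor3 gd nd x y * factor3 gd nd x y) = a * factor3 gd nd x y
    \<and> a * factor3 gd nd x y * x ^ 3 = of_nat (gd * (nd - gd + 1)) * (a * factor3 gd nd x y)
    \<and> a * factor3 gd nd x y * y ^ 3 = of_nat ((gd choose 2) * ((nd - gd + 2) choose 2)) * (a * factor3 gd nd x y)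
    \<and> (s mod 3 = 1 \<longrightarrow> a * factor3 gd nd x y * y = of_nat ((s + 2 * gd) div 3) * (a * factor3 gd nd x y))
    \<and> (s = 2 \<longrightarrow> a * factor3 gd nd x y * (x - y) = of_nat ((s + 2 * gd) div 3) * (a * factor3 gd nd x y))"
  proof cases
    case 1
    \<comment> \<open>\<open>r\<close> gives the relations for this residue of \<open>s\<close>;
      \<open>r3\<close> and \<open>r4\<close> follow on multiplying by \<open>x\<close> or
      \<open>y\<close>. Degree 4 is what a factor times a cube requires.\<close>
    have r: "a * (x * x) = a * y - a * x" "a * (x * y) = 0" "a * (y * y) = 0"
      using xx xy yy d 1(1) num by (auto simp: choose_two)
    have r3: "a * (x * (x * x)) = a * x - a * y" "a * (x * (x * y)) = 0" "a * (x * (y * y)) = 0" "a * (y * (y * y)) = 0"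
      unfolding c by (simp_all add: r algebra_simps num)
    have r4: "a * (x * (x * (x * x))) = a * y - a * x" "a * (x * (x * (x * y))) = 0" "a * (x * (y * (y * y))) = 0" "a * (y * (y * (y * y))) = 0"
      unfolding mult.left_commute[of a x "_ * (_ * _)"] mult.left_commute[of a y "_ * (_ * _)"] by (simp_all add: r r3 algebra_simps num)
    show ?thesis using 1 by (auto simp: factor3_def power3_eq_cube algebra_simps r r3 r4 num choose_two)
  next
    case 2
    have r: "a * (x * x) = a * y - a * x" "a * (x * y) = 0" "a * (y * y) = 0"
      using xx xy yy d 2(1) num by (auto simp: choose_two)
    have r3: "a * (x * (x * x)) = a * x - a * y" "a * (x * (x * y)) = 0" "a * (x * (y * y)) = 0" "a * (y * (y * y)) = 0"
      unfolding c by (simp_all add: r algebra_simps num)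
    have r4: "a * (x * (x * (x * x))) = a * y - a * x" "a * (x * (x * (x * y))) = 0" "a * (x * (y * (y * y))) = 0" "a * (y * (y * (y * y))) = 0"
      unfolding mult.left_commute[of a x "_ * (_ * _)"] mult.left_commute[of a y "_ * (_ * _)"] by (simp_all add: r r3 algebra_simps num)
    show ?thesis using 2 by (auto simp: factor3_def power3_eq_cube algebra_simps r r3 r4 num choose_two)
  next
    case 3
    have r: "a * (x * x) = a * y" "a * (x * y) = - (a * y)" "a * (y * y) = a * y"
      using xx xy yy d 3(1) num by (auto simp: choose_two)
    have r3: "a * (x * (x * x)) = - (a * y)" "a * (x * (x * y)) = a * y" "a * (x * (y * y)) = - (a * y)" "a * (y * (y * y)) = a * y"
      unfolding c by (simp_all add: r algebra_simps num)
    have r4: "a * (x * (x * (x * x))) = a * y" "a * (x * (x * (x * y))) = - (a * y)" "a * (x * (y * (y * y))) = - (a * y)" "a * (y * (y * (y * y))) = a * y"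
      unfolding mult.left_commute[of a x "_ * (_ * _)"] mult.left_commute[of a y "_ * (_ * _)"] by (simp_all add: r r3 algebra_simps num)
    show ?thesis using 3 d by (auto simp: factor3_def power3_eq_cube algebra_simps r r3 r4 num choose_two)
  next
    case 4
    have r: "a * (x * x) = a * y" "a * (x * y) = - (a * y)" "a * (y * y) = a * y"
      using xx xy yy d 4(1) num by (auto simp: choose_two)
    have r3: "a * (x * (x * x)) = - (a * y)" "a * (x * (x * y)) = a * y" "a * (x * (y * y)) = - (a * y)" "a * (y * (y * y)) = a * y"
      unfolding c by (simp_all add: r algebra_simps num)
    have r4: "a * (x * (x * (x * x))) = a * y" "a * (x * (x * (x * y))) = - (a * y)" "a * (x * (y * (y * y))) = - (a * y)" "a * (y * (y * (y * y))) = a * y"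
      unfolding mult.left_commute[of a x "_ * (_ * _)"] mult.left_commute[of a y "_ * (_ * _)"] by (simp_all add: r r3 algebra_simps num)
    show ?thesis using 4 d by (auto simp: factor3_def power3_eq_cube algebra_simps r r3 r4 num choose_two)
  next
    case 5
    have r: "a * (x * x) = a * x + a * y" "a * (x * y) = a * y" "a * (y * y) = 0"
      using xx xy yy d 5(1) num by (auto simp: choose_two)
    have r3: "a * (x * (x * x)) = a * x - a * y" "a * (x * (x * y)) = a * y" "a * (x * (y * y)) = 0" "a * (y * (y * y)) = 0"
      unfolding c by (simp_all add: r algebra_simps num)
    have r4: "a * (x * (x * (x * x))) = a * x" "a * (x * (x * (x * y))) = a * y" "a * (x * (y * (y * y))) = 0" "a * (y * (y * (y * y))) = 0"
      unfolding mult.left_commute[of a x "_ * (_ * _)"] mult.left_commute[of a y "_ * (_ * _)"] by (simp_all add: r r3 algebra_simps num)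
    show ?thesis using 5 by (auto simp: factor3_def power3_eq_cube algebra_simps r r3 r4 num choose_two)
  next
    case 6
    have r: "a * (x * x) = a * x + a * y" "a * (x * y) = a * y" "a * (y * y) = 0"
      using xx xy yy d 6(1) num by (auto simp: choose_two)
    have r3: "a * (x * (x * x)) = a * x - a * y" "a * (x * (x * y)) = a * y" "a * (x * (y * y)) = 0" "a * (y * (y * y)) = 0"
      unfolding c by (simp_all add: r algebra_simps num)
    have r4: "a * (x * (x * (x * x))) = a * x" "a * (x * (x * (x * y))) = a * y" "a * (x * (y * (y * y))) = 0" "a * (y * (y * (y * y))) = 0"
      unfolding mult.left_commute[of a x "_ * (_ * _)"] mult.left_commute[of a y "_ * (_ * _)"] by (simp_all add: r r3 algebra_simps num)
    show ?thesis using 6 by (auto simp: factor3_def power3_eq_cube algebra_simps r r3 r4 num choose_two)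
  qed
  then show "a * (factor3 gd nd x y * factor3 gd nd x y) = a * factor3 gd nd x y"
    and "a * factor3 gd nd x y * x ^ 3 = of_nat (gd * (nd - gd + 1)) * (a * factor3 gd nd x y)"
    and "a * factor3 gd nd x y * y ^ 3 = of_nat ((gd choose 2) * ((nd - gd + 2) choose 2)) * (a * factor3 gd nd x y)"
    and "s mod 3 = 1 \<Longrightarrow> a * factor3 gd nd x y * y = of_nat ((s + 2 * gd) div 3) * (a * factor3 gd nd x y)"
    and "s = 2 \<Longrightarrow> a * factor3 gd nd x y * (x - y) = of_nat ((s + 2 * gd) div 3) * (a * factor3 gd nd x y)"
    by blast+
qed

section \<open>Induction over the digits\<close>

context b_ring
begin

definition E :: "nat \<Rightarrow> nat \<Rightarrow> 'r" where
  "E g u = (\<Prod>v<u. factor3 (digit3 g v) (digit3 (m + 2 * g) v) (b (3 ^ v)) (b (2 * 3 ^ v)))"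

definition carry :: "nat \<Rightarrow> nat \<Rightarrow> nat" where
  "carry g u = (m mod 3 ^ u + 2 * (g mod 3 ^ u)) div 3 ^ u"

lemma digit3_less: "digit3 a u < 3"
  by (simp add: digit3_def)

lemma mod_pow_Suc: "(a::nat) mod 3 ^ Suc u = 3 ^ u * digit3 a u + a mod 3 ^ u"
  using mod_mult2_eq[of a "3 ^ u" 3] by (simp add: digit3_def mult.commute)

text \<open>A carry of 2 is conceivable when three numbers are added. With \<open>q = 3 ^ u\<close>,
  the amount carried is \<open>m mod q + 2 * (g mod q)\<close> minus
  \<open>(m + 2 * g) mod q\<close>; the hypothesis bounds it by \<open>m mod q + g mod q\<close>,
  which is less than \<open>2 * q\<close>.\<close>

lemma carry_le:
  assumes "g mod 3 ^ u \<le> (m + 2 * g) mod 3 ^ u"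
  shows "carry g u \<le> 1"
proof -
  let ?q = "3 ^ u :: nat" and ?x = "m mod 3 ^ u + 2 * (g mod 3 ^ u)"
  have "?x mod ?q = (m + 2 * g) mod ?q"
    using mod_add_eq[of m ?q "2 * (g mod ?q)"] by (simp add: mod_simps)
  moreover have "?x = carry g u * ?q + ?x mod ?q" unfolding carry_def by (simp only: div_mult_mod_eq)
  moreover have "m mod ?q < ?q" "g mod ?q < ?q" by simp_all
  ultimately have "carry g u * ?q < 2 * ?q" using assms by linarith
  then show ?thesis by simp
qed

lemma carry_digit: "(digit3 m u + carry g u + 2 * digit3 g u) mod 3 = digit3 (m + 2 * g) u"
proof -
  let ?q = "3 ^ u :: nat"
  have e: "m + 2 * g = ?q * (m div ?q + 2 * (g div ?q)) + (m mod ?q + 2 * (g mod ?q))"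
    using mult_div_mod_eq[of ?q m] mult_div_mod_eq[of ?q g]
    unfolding distrib_left mult.left_commute[of ?q 2] by linarith
  have "(m + 2 * g) div ?q = m div ?q + 2 * (g div ?q) + carry g u"
    unfolding carry_def by (subst e) simp
  moreover have "(x mod 3 + c + 2 * (y mod 3)) mod 3 = (x + 2 * y + c) mod 3" for x y c :: nat
  proof -
    have "(x mod 3 + c + 2 * (y mod 3)) mod 3 = (x mod 3 + 2 * (y mod 3) + c) mod 3"
      by (simp only: ac_simps)
    also have "\<dots> = (x + 2 * y + c) mod 3"
      by (intro mod_add_cong mod_mult_cong) simp_all
    finally show ?thesis .
  qed
  ultimately show ?thesis by (simp only: digit3_def)
qed

lemma carry_Suc: "carry g (Suc u) = (digit3 m u + carry g u + 2 * digit3 g u) div 3"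
proof -
  let ?q = "3 ^ u :: nat"
  have e: "m mod 3 ^ Suc u + 2 * (g mod 3 ^ Suc u)
      = ?q * (digit3 m u + 2 * digit3 g u) + (m mod ?q + 2 * (g mod ?q))"
    unfolding mod_pow_Suc by (simp add: algebra_simps)
  have "(m mod 3 ^ Suc u + 2 * (g mod 3 ^ Suc u)) div ?q = digit3 m u + 2 * digit3 g u + carry g u"
    unfolding e carry_def by simp
  then show ?thesis unfolding carry_def[of g "Suc u"] power_Suc2 div_mult2_eq
    by (simp add: ac_simps)
qed

lemma of_nat_digit: "(of_nat (m div 3 ^ u) :: 'r) = of_nat (digit3 m u)"
  unfolding digit3_def by (rule of_nat_mod_three[OF three])

text \<open>The factor at \<open>u\<close> is idempotent only once \<open>Z (3 ^ u)\<close> acts on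
  \<open>E g u\<close> as a scalar, so the first two claims are carried through one induction. The
  claims on cubes are obtained from the same step.\<close>

lemma E_invariant:
  assumes "\<And>v. digit3 g v \<le> digit3 (m + 2 * g) v" "\<And>v. g mod 3 ^ v \<le> (m + 2 * g) mod 3 ^ v"
  shows "E g u * E g u = E g u" "E g u * Z (3 ^ u) = of_nat (carry g u) * E g u"
    "E g (Suc u) * b (3 ^ u) ^ 3 = of_nat (digit3 g u * (digit3 (m + 2 * g) u - digit3 g u + 1)) * E g (Suc u)"
    "E g (Suc u) * b (2 * 3 ^ u) ^ 3 = of_nat ((digit3 g u choose 2) * ((digit3 (m + 2 * g) u - digit3 g u + 2) choose 2)) * E g (Suc u)"
proof -
  have "E g u * E g u = E g u \<and> E g u * Z (3 ^ u) = of_nat (carry g u) * E g u"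
    and "E g (Suc u) * b (3 ^ u) ^ 3 = of_nat (digit3 g u * (digit3 (m + 2 * g) u - digit3 g u + 1)) * E g (Suc u)
    \<and> E g (Suc u) * b (2 * 3 ^ u) ^ 3 = of_nat ((digit3 g u choose 2) * ((digit3 (m + 2 * g) u - digit3 g u + 2) choose 2)) * E g (Suc u)"
    for u
  proof -
    have step: "E g (Suc u) * E g (Suc u) = E g (Suc u)
      \<and> E g (Suc u) * Z (3 ^ Suc u) = of_nat (carry g (Suc u)) * E g (Suc u)
      \<and> E g (Suc u) * b (3 ^ u) ^ 3 = of_nat (digit3 g u * (digit3 (m + 2 * g) u - digit3 g u + 1)) * E g (Suc u)
      \<and> E g (Suc u) * b (2 * 3 ^ u) ^ 3 = of_nat ((digit3 g u choose 2) * ((digit3 (m + 2 * g) u - digit3 g u + 2) choose 2)) * E g (Suc u)"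
      if IH: "E g u * E g u = E g u" "E g u * Z (3 ^ u) = of_nat (carry g u) * E g u" for u
    proof -
      define a x y mm dd gd nd where "a = E g u" and "x = b (3 ^ u)" and "y = b (2 * 3 ^ u)"
        and "mm = digit3 m u" and "dd = carry g u" and "gd = digit3 g u" and "nd = digit3 (m + 2 * g) u"
      define F where "F = factor3 gd nd x y"
      note num = three char3_numerals[OF three]
      have ES: "E g (Suc u) = a * F"
        by (simp add: E_def a_def F_def x_def y_def gd_def nd_def)
      have dd: "dd \<le> 1" unfolding dd_def by (rule carry_le[OF assms(2)])
      have mm: "mm < 3" unfolding mm_def by (rule digit3_less)
      have mcases: "mm = 0 \<or> mm = 1 \<or> mm = 2" "dd = 0 \<or> dd = 1" using mm dd by auto
      have aa: "a * a = a" using IH(1) by (simp add: a_def)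
      have aZ: "a * (Z (3 ^ u) * w) = of_nat dd * (a * w)" for w
        using IH(2) by (simp add: a_def dd_def mult.assoc[symmetric])
      have om: "(of_nat (m div 3 ^ u) :: 'r) = of_nat mm" unfolding mm_def by (rule of_nat_digit)
      have oc: "(of_nat ((m div 3 ^ u + 4) choose 2) :: 'r) = of_nat ((mm + 1) mod 3 choose 2)"
        "(of_nat ((m div 3 ^ u) choose 2) :: 'r) = of_nat (mm choose 2)"
      proof -
        have "(m div 3 ^ u + 4) mod 3 = (mm + 1) mod 3"
          unfolding mm_def digit3_def mod_add_left_eq using mod_add_self2[of "m div 3 ^ u + 1" 3]
          by (simp add: add.commute)
        then show "(of_nat ((m div 3 ^ u + 4) choose 2) :: 'r) = of_nat ((mm + 1) mod 3 choose 2)"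
          using lucas_pow3_digit[OF three, of 2 "m div 3 ^ u + 4" 0] by (simp add: digit3_def)
        show "(of_nat ((m div 3 ^ u) choose 2) :: 'r) = of_nat (mm choose 2)"
          using lucas_pow3_digit[OF three, of 2 "m div 3 ^ u" 0] by (simp add: digit3_def mm_def)
      qed
      \<comment> \<open>Multiplied by \<open>a\<close>, every \<open>Z (3 ^ u)\<close> becomes the
        carry \<open>dd\<close>. Digit and carry then enter the relations only through
        \<open>s = mm + dd\<close>.\<close>
      have "a * (x * x) = a * ((of_nat (m div 3 ^ u + 2) + Z (3 ^ u)) * x + y)"
        unfolding x_def y_def b1_square ..
      also have "\<dots> = (of_nat mm + 2) * (a * x) + a * (Z (3 ^ u) * x) + a * y"
        by (simp add: om algebra_simps)
      finally have xx: "a * (x * x) = of_nat (mm + dd + 2) * (a * x) + a * y"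
        unfolding aZ by (simp add: algebra_simps)
      have "a * (x * y) = a * (2 * (of_nat (m div 3 ^ u) + Z (3 ^ u)) * y)"
        unfolding x_def y_def b1_b2 ..
      also have "\<dots> = 2 * of_nat mm * (a * y) + 2 * (a * (Z (3 ^ u) * y))"
        by (simp add: om algebra_simps)
      finally have xy: "a * (x * y) = 2 * of_nat (mm + dd) * (a * y)"
        unfolding aZ by (simp add: algebra_simps)
      have "a * (y * y) = a * ((of_nat ((m div 3 ^ u + 4) choose 2) + of_nat (m div 3 ^ u + 1) * Z (3 ^ u)) * y)"
        unfolding x_def y_def b2_square ..
      also have "\<dots> = of_nat ((mm + 1) mod 3 choose 2) * (a * y) + (of_nat mm + 1) * (a * (Z (3 ^ u) * y))"
        unfolding oc by (simp add: om algebra_simps)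
      finally have yy: "a * (y * y) = of_nat ((mm + dd + 1) choose 2) * (a * y)"
        unfolding aZ using mcases by (auto simp: choose_two num)
      have "a * Z (3 ^ Suc u) = of_nat (mm choose 2) * (a * x) + of_nat mm * (a * y)
          + (of_nat (mm choose 2) * (a * (Z (3 ^ u) * 1)) + of_nat mm * (a * (Z (3 ^ u) * x)) + a * (Z (3 ^ u) * y))"
        unfolding Z_step oc om by (simp add: x_def y_def algebra_simps)
      then have aZ': "a * Z (3 ^ Suc u) = of_nat (mm choose 2) * (a * x) + of_nat mm * (a * y)
          + of_nat dd * (of_nat (mm choose 2) * a + of_nat mm * (a * x) + a * y)"
        unfolding aZ by (simp add: algebra_simps)
      have gn: "gd \<le> nd" "nd < 3" unfolding gd_def nd_def using assms(1) digit3_less by simp_all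
      have sn: "(mm + dd + 2 * gd) mod 3 = nd" unfolding mm_def dd_def gd_def nd_def by (rule carry_digit)
      have s3: "mm + dd \<le> 3" using mm dd by simp
      note st = factor3_step[OF three gn sn xx xy yy s3, folded F_def]
      have cS: "carry g (Suc u) = (mm + dd + 2 * gd) div 3"
        unfolding mm_def dd_def gd_def by (rule carry_Suc)
      have gc: "gd = 0 \<or> gd = 1 \<or> gd = 2" using gn by auto
      have "a * F * Z (3 ^ Suc u) = of_nat (carry g (Suc u)) * (a * F)"
      proof -
        have fz: "a * F * Z (3 ^ Suc u) = F * (a * Z (3 ^ Suc u))" by (simp only: ac_simps)
        \<comment> \<open>Below \<open>a\<close>, the recursion makes the next \<open>Z\<close>
          equal to 0 for \<open>mm + dd = 0\<close>, to 1 for 3, to \<open>y\<close> for 1 and to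
          \<open>x - y\<close> for 2.\<close>
        consider "mm = 0" "dd = 0" | "mm = 2" "dd = 1" | "mm = 1" "dd = 0" | "mm = 0" "dd = 1"
          | "mm = 2" "dd = 0" | "mm = 1" "dd = 1" using mcases by auto
        then show ?thesis
        proof cases
          case 1
          have "gd = 0 \<or> gd = 1" using gc sn gn 1 by auto
          then show ?thesis unfolding fz aZ' cS using 1 by (auto simp: choose_two)
        next
          case 2
          have "gd = 0 \<or> gd = 1" using gc sn gn 2 by auto
          then show ?thesis unfolding fz aZ' cS using 2 num by (auto simp: algebra_simps choose_two)
        next
          case 3
          have "a * F * Z (3 ^ Suc u) = a * F * y" unfolding fz aZ' using 3 by (simp add: ac_simps choose_two)
          then show ?thesis unfolding cS using st(4) 3 by simp
        next
          case 4
          have "a * F * Z (3 ^ Suc u) = a * F * y" unfolding fz aZ' using 4 by (simp add: ac_simps choose_two)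
          then show ?thesis unfolding cS using st(4) 4 by simp
        next
          case 5
          have "a * F * Z (3 ^ Suc u) = a * F * (x - y)" unfolding fz aZ' using 5 num
            by (simp add: algebra_simps choose_two)
          then show ?thesis unfolding cS using st(5) 5 by simp
        next
          case 6
          have "a * F * Z (3 ^ Suc u) = a * F * (x - y)" unfolding fz aZ' using 6 num
            by (simp add: algebra_simps choose_two)
          then show ?thesis unfolding cS using st(5) 6 by simp
        qed
      qed
      moreover have "a * F * (a * F) = a * F"
      proof -
        have "a * F * (a * F) = (a * a) * (F * F)" by (simp only: ac_simps)
        then show ?thesis using aa st(1) by simp
      qed
      ultimately show ?thesis unfolding ES using st(2,3)
        by (simp add: x_def y_def gd_def nd_def)
    qed
    have base: "E g 0 * E g 0 = E g 0 \<and> E g 0 * Z (3 ^ 0) = of_nat (carry g 0) * E g 0"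
      by (simp add: E_def Z_1 carry_def)
    have inv: "E g u * E g u = E g u \<and> E g u * Z (3 ^ u) = of_nat (carry g u) * E g u" for u
      by (induction u) (use base step in blast)+
    show "E g u * E g u = E g u \<and> E g u * Z (3 ^ u) = of_nat (carry g u) * E g u" by (rule inv)
    show "E g (Suc u) * b (3 ^ u) ^ 3 = of_nat (digit3 g u * (digit3 (m + 2 * g) u - digit3 g u + 1)) * E g (Suc u)
      \<and> E g (Suc u) * b (2 * 3 ^ u) ^ 3 = of_nat ((digit3 g u choose 2) * ((digit3 (m + 2 * g) u - digit3 g u + 2) choose 2)) * E g (Suc u)"
      using step inv by blast
  qed
  then show "E g u * E g u = E g u" "E g u * Z (3 ^ u) = of_nat (carry g u) * E g u"
    "E g (Suc u) * b (3 ^ u) ^ 3 = of_nat (digit3 g u * (digit3 (m + 2 * g) u - digit3 g u + 1)) * E g (Suc u)"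
    "E g (Suc u) * b (2 * 3 ^ u) ^ 3 = of_nat ((digit3 g u choose 2) * ((digit3 (m + 2 * g) u - digit3 g u + 2) choose 2)) * E g (Suc u)"
    by blast+
qed

text \<open>\<open>b_mult_low\<close> splits off the top digit of \<open>a\<close>, and cubing
  respects the product. The low part is a scalar on \<open>E g u\<close>, hence on its multiple
  \<open>E g (Suc u)\<close>. The scalars lie in the prime field, so \<open>of_nat\<close> expresses
  them without a base field.\<close>

lemma E_cube_scalar:
  assumes "\<And>v. digit3 g v \<le> digit3 (m + 2 * g) v" "\<And>v. g mod 3 ^ v \<le> (m + 2 * g) mod 3 ^ v"
    and "a < 3 ^ u"
  shows "\<exists>z. E g u * b a ^ 3 = of_nat z * E g u"
  using assms(3)
proof (induction u arbitrary: a)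
  case 0
  then show ?case using b0 by (intro exI[of _ 1]) simp
next
  case (Suc u)
  let ?q = "3 ^ u :: nat"
  obtain z where z: "E g u * b (a mod ?q) ^ 3 = of_nat z * E g u" using Suc.IH[of "a mod ?q"] by auto
  have "\<exists>y. E g (Suc u) * b (?q * (a div ?q)) ^ 3 = of_nat y * E g (Suc u)"
  proof -
    have "a div ?q < 3" using Suc.prems by (simp add: less_mult_imp_div_less)
    then consider "a div ?q = 0" | "a div ?q = 1" | "a div ?q = 2" by linarith
    then show ?thesis
    proof cases
      case 1
      then show ?thesis using b0 by (intro exI[of _ 1]) simp
    next
      case 2
      then show ?thesis using E_invariant(3)[OF assms(1,2), of u]
        by (intro exI) (simp only: mult_1_right)
    next
      case 3
      then show ?thesis using E_invariant(4)[OF assms(1,2), of u]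
        by (intro exI) (simp only: mult.commute[of _ 2])
    qed
  qed
  then obtain y where y: "E g (Suc u) * b (?q * (a div ?q)) ^ 3 = of_nat y * E g (Suc u)" ..
  have ES: "E g (Suc u) * b (a mod ?q) ^ 3 = of_nat z * E g (Suc u)"
  proof -
    obtain F where F: "E g (Suc u) = F * E g u" by (simp add: E_def mult.commute)
    show ?thesis unfolding F using z by (simp add: mult.assoc mult.left_commute)
  qed
  have "b a = b (a mod ?q) * b (?q * (a div ?q))"
    using b_mult_low[of "a mod ?q" u "a div ?q"] by simp
  then have "E g (Suc u) * b a ^ 3 = (E g (Suc u) * b (a mod ?q) ^ 3) * b (?q * (a div ?q)) ^ 3"
    by (simp add: power_mult_distrib mult.assoc)
  also have "\<dots> = of_nat z * (E g (Suc u) * b (?q * (a div ?q)) ^ 3)"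
    unfolding ES by (simp only: mult.assoc)
  also have "\<dots> = of_nat (z * y) * E g (Suc u)" unfolding y by (simp add: mult.assoc)
  finally show ?case ..
qed

end

section \<open>The operators as sums over subsets\<close>

lemma sum_Pow_card:
  fixes f :: "nat \<Rightarrow> 'b::comm_semiring_1"
  assumes "finite A"
  shows "(\<Sum>W\<in>Pow A. f (card W)) = (\<Sum>w\<le>card A. of_nat (card A choose w) * f w)"
proof -
  have "(\<Sum>W\<in>Pow A. f (card W)) = (\<Sum>w\<le>card A. \<Sum>W\<in>{W \<in> Pow A. card W = w}. f (card W))"
    by (rule sum.group[symmetric]) (use assms in \<open>auto simp: card_mono\<close>)
  also have "\<dots> = (\<Sum>w\<le>card A. of_nat (card A choose w) * f w)"
  proof (rule sum.cong[OF refl])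
    fix w
    have "(\<Sum>W\<in>{W \<in> Pow A. card W = w}. f (card W)) = (\<Sum>W\<in>{W \<in> Pow A. card W = w}. f w)"
      by (rule sum.cong) auto
    also have "\<dots> = of_nat (card A choose w) * f w"
      using n_subsets[OF assms, of w] by (simp add: Pow_def)
    finally show "(\<Sum>W\<in>{W \<in> Pow A. card W = w}. f (card W)) = of_nat (card A choose w) * f w" .
  qed
  finally show ?thesis .
qed

lemma card_supersets:
  assumes "finite A" "U \<subseteq> A" "card U \<le> k"
  shows "card {R. U \<subseteq> R \<and> R \<subseteq> A \<and> card R = k} = (card A - card U) choose (k - card U)"
proof -
  have fU: "finite U" using assms finite_subset by blast
  have "bij_betw (\<lambda>R. R - U) {R. U \<subseteq> R \<and> R \<subseteq> A \<and> card R = k} {D. D \<subseteq> A - U \<and> card D = k - card U}"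
  proof (rule bij_betwI[where g = "\<lambda>D. D \<union> U"])
    show "(\<lambda>R. R - U) \<in> {R. U \<subseteq> R \<and> R \<subseteq> A \<and> card R = k} \<rightarrow> {D. D \<subseteq> A - U \<and> card D = k - card U}"
      using fU by (auto simp: card_Diff_subset)
    show "(\<lambda>D. D \<union> U) \<in> {D. D \<subseteq> A - U \<and> card D = k - card U} \<rightarrow> {R. U \<subseteq> R \<and> R \<subseteq> A \<and> card R = k}"
    proof
      fix D assume D: "D \<in> {D. D \<subseteq> A - U \<and> card D = k - card U}"
      then have "card (D \<union> U) = card D + card U"
        using fU assms(1) by (intro card_Un_disjoint) (auto intro: finite_subset)
      then show "D \<union> U \<in> {R. U \<subseteq> R \<and> R \<subseteq> A \<and> card R = k}" using D assms by auto
    qed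
  qed auto
  then have "card {R. U \<subseteq> R \<and> R \<subseteq> A \<and> card R = k} = card {D. D \<subseteq> A - U \<and> card D = k - card U}"
    by (rule bij_betw_same_card)
  also have "\<dots> = (card A - card U) choose (k - card U)"
    using n_subsets[of "A - U"] assms fU by (simp add: card_Diff_subset)
  finally show ?thesis .
qed

definition Ksets :: "nat \<Rightarrow> nat \<Rightarrow> nat set set" where
  "Ksets r k = {T. T \<subseteq> {0..<r} \<and> card T = k}"

lemma finite_Ksets [simp]: "finite (Ksets r k)"
  by (rule finite_subset[of _ "Pow {0..<r}"]) (auto simp: Ksets_def)

text \<open>Writing \<open>card V + j = k\<close> avoids truncated subtraction: for
  \<open>j > k\<close> both sides are 0.\<close>

lemma card_intermediate:
  assumes "finite T" "card T = k"
  shows "card {V. W \<subseteq> V \<and> V \<subseteq> T \<and> card V + j = k} = (if W \<subseteq> T then (k - card W) choose j else 0)"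
proof (cases "W \<subseteq> T")
  case True
  have le: "card W \<le> k" using True assms card_mono by blast
  show ?thesis
  proof (cases "card W + j \<le> k")
    case a: True
    have "{V. W \<subseteq> V \<and> V \<subseteq> T \<and> card V + j = k} = {V. W \<subseteq> V \<and> V \<subseteq> T \<and> card V = k - j}"
      using a by auto
    then have "card {V. W \<subseteq> V \<and> V \<subseteq> T \<and> card V + j = k} = (k - card W) choose (k - j - card W)"
      using card_supersets[OF assms(1) True, of "k - j"] a assms(2) by simp
    also have "k - j - card W = (k - card W) - j" by simp
    also have "(k - card W) choose ((k - card W) - j) = (k - card W) choose j"
      by (rule binomial_symmetric[symmetric]) (use a in simp)
    finally show ?thesis using True by simp
  next
    case False
    have e: "{V. W \<subseteq> V \<and> V \<subseteq> T \<and> card V + j = k} = {}"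
      using False assms by (auto dest: card_mono[rotated] finite_subset)
    show ?thesis unfolding e using False le by (auto simp: binomial_eq_0)
  qed
next
  case False
  then have e: "{V. W \<subseteq> V \<and> V \<subseteq> T \<and> card V + j = k} = {}" by auto
  show ?thesis unfolding e using False by simp
qed

text \<open>The commutation relation between the divided powers of \<open>e\<close> and \<open>f\<close>, written in matrix entries.\<close>
lemma card_common_supersets:
  assumes "r = m + 2 * k" "U \<subseteq> {0..<r}" "V \<subseteq> {0..<r}" "card U + i = k" "card V + j = k"
  shows "card {R. U \<subseteq> R \<and> V \<subseteq> R \<and> R \<in> Ksets r k}
    = (\<Sum>W\<in>Pow (U \<inter> V). if k \<le> i + j + card W then (m + i + j) choose (i + j + card W - k) else 0)"
proof -
  let ?p = "card (U \<inter> V)" and ?M = "m + i + j"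
  let ?f = "\<lambda>w. if k \<le> i + j + w then ?M choose (i + j + w - k) else 0"
  have fin: "finite U" "finite V" using assms finite_subset by blast+
  have un: "card (U \<union> V) + i + j + ?p = 2 * k"
    using card_Un_Int[OF fin] assms(4,5) by linarith
  have S: "{R. U \<subseteq> R \<and> V \<subseteq> R \<and> R \<in> Ksets r k} = {R. U \<union> V \<subseteq> R \<and> R \<subseteq> {0..<r} \<and> card R = k}"
    by (auto simp: Ksets_def)
  have rhs: "(\<Sum>W\<in>Pow (U \<inter> V). ?f (card W)) = (\<Sum>w\<le>?p. (?p choose w) * ?f w)"
    using sum_Pow_card[of "U \<inter> V" ?f] fin by simp
  show ?thesis
  proof (cases "k \<le> i + j + ?p")
    case True
    define N where "N = i + j + ?p - k"
    have "card {R. U \<union> V \<subseteq> R \<and> R \<subseteq> {0..<r} \<and> card R = k} = (r - card (U \<union> V)) choose (k - card (U \<union> V))"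
      using card_supersets[of "{0..<r}" "U \<union> V" k] assms(2,3) un True by simp
    also have "r - card (U \<union> V) = ?p + ?M" using un assms(1) by linarith
    also have "k - card (U \<union> V) = N" using un True by (simp add: N_def)
    also have "(?p + ?M) choose N = (\<Sum>t\<le>N. (?p choose t) * (?M choose (N - t)))"
      by (rule vandermonde[symmetric])
    also have "\<dots> = (\<Sum>t\<le>?p. (?p choose t) * (if t \<le> N then ?M choose (N - t) else 0))"
      by (rule sum.mono_neutral_cong) (auto simp: binomial_eq_0)
    also have "\<dots> = (\<Sum>t\<le>?p. (?p choose (?p - t)) * ?f (?p - t))"
    proof (rule sum.cong[OF refl])
      fix t assume t: "t \<in> {..?p}"
      have e: "N - t = i + j + (?p - t) - k" "t \<le> N \<longleftrightarrow> k \<le> i + j + (?p - t)"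
        unfolding N_def using t True by auto
      show "(?p choose t) * (if t \<le> N then ?M choose (N - t) else 0) = (?p choose (?p - t)) * ?f (?p - t)"
        unfolding e using t binomial_symmetric[of t ?p] by simp
    qed
    also have "\<dots> = (\<Sum>w\<le>?p. (?p choose w) * ?f w)"
      by (rule sum.reindex_bij_witness[of _ "\<lambda>w. ?p - w" "\<lambda>w. ?p - w"]) auto
    finally show ?thesis unfolding S rhs .
  next
    case False
    have "{R. U \<union> V \<subseteq> R \<and> R \<subseteq> {0..<r} \<and> card R = k} = {}"
    proof -
      have "card R \<noteq> k" if "U \<union> V \<subseteq> R" "R \<subseteq> {0..<r}" for R
        using card_mono[of R "U \<union> V"] that un False finite_subset[of R] by auto
      then show ?thesis by auto
    qed
    moreover have "(\<Sum>w\<le>?p. (?p choose w) * ?f w) = 0" using False by (intro sum.neutral) auto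
    ultimately show ?thesis unfolding S rhs by simp
  qed
qed

text \<open>For \<open>card U \<le> k\<close> and \<open>U \<subseteq> {0..<r}\<close> this is the
  coordinate at \<open>U\<close> of e^(i) applied to the component of \<open>x\<close> in the
  permutation module, with i = k - card U. The indicator over a fixed index set makes sums easy to
  interchange.\<close>

definition upsum :: "nat \<Rightarrow> nat \<Rightarrow> (nat set \<Rightarrow> 'a::field) \<Rightarrow> nat set \<Rightarrow> 'a" where
  "upsum r k x U = (\<Sum>T\<in>Ksets r k. of_bool (U \<subseteq> T) * x T)"

lemma bop_apply:
  "bop r k i x S = (if S \<in> Ksets r k
     then \<Sum>U\<in>Pow {0..<r}. of_bool (U \<subseteq> S \<and> card U + i = k) * upsum r k x U else 0)"
proof (cases "S \<in> Ksets r k")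
  case True
  then have S: "S \<subseteq> {0..<r}" "card S = k" by (auto simp: Ksets_def)
  have fS: "finite S" using S(1) finite_subset by blast
  have sets: "{U. U \<subseteq> S \<and> card (S - U) = i} = {U \<in> Pow {0..<r}. U \<subseteq> S \<and> card U + i = k}"
  proof -
    have "card (S - U) = i \<longleftrightarrow> card U + i = k" if "U \<subseteq> S" for U
      using card_Diff_subset[of U S] that S card_mono[OF fS that] finite_subset[OF that fS] by auto
    then show ?thesis using S by auto
  qed
  have inner: "e_div r i (proj r k x) U = upsum r k x U" if U: "U \<subseteq> S" "card U + i = k" for U
  proof -
    have fU: "finite U" using U fS finite_subset by blast
    have "e_div r i (proj r k x) U = (\<Sum>T\<in>{T. U \<subseteq> T \<and> T \<subseteq> {0..<r} \<and> card (T - U) = i}. proj r k x T)"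
      using U S by (auto simp: e_div_def)
    also have "\<dots> = (\<Sum>T\<in>{T \<in> Ksets r k. U \<subseteq> T}. x T)"
    proof (rule sum.cong)
      have "card (T - U) = i \<longleftrightarrow> card T = k" if T: "U \<subseteq> T" "T \<subseteq> {0..<r}" for T
        using card_Diff_subset[OF fU T(1)] card_mono[OF finite_subset[OF T(2)] T(1)] U by auto
      then show "{T. U \<subseteq> T \<and> T \<subseteq> {0..<r} \<and> card (T - U) = i} = {T \<in> Ksets r k. U \<subseteq> T}"
        by (auto simp: Ksets_def)
    qed (auto simp: proj_def Ksets_def)
    also have "\<dots> = upsum r k x U"
      unfolding upsum_def sum.inter_filter[OF finite_Ksets] by (rule sum.cong) auto
    finally show ?thesis .
  qed
  have "bop r k i x S = (\<Sum>U\<in>{U. U \<subseteq> S \<and> card (S - U) = i}. e_div r i (proj r k x) U)"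
    using S by (simp add: bop_def proj_def f_div_def)
  also have "\<dots> = (\<Sum>U\<in>{U \<in> Pow {0..<r}. U \<subseteq> S \<and> card U + i = k}. upsum r k x U)"
    unfolding sets by (rule sum.cong[OF refl]) (use inner in auto)
  also have "\<dots> = (\<Sum>U\<in>Pow {0..<r}. of_bool (U \<subseteq> S \<and> card U + i = k) * upsum r k x U)"
    unfolding sum.inter_filter[OF finite_Pow_iff[THEN iffD2, OF finite_atLeastLessThan]]
    by (rule sum.cong) auto
  finally show ?thesis using True by simp
next
  case False
  then show ?thesis by (auto simp: bop_def proj_def Ksets_def)
qed

lemma bop_0: "bop r k 0 = proj r k"
proof (intro ext)
  fix x :: "nat set \<Rightarrow> 'a" and S
  show "bop r k 0 x S = proj r k x S"
  proof (cases "S \<in> Ksets r k")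
    case True
    then have S: "S \<subseteq> {0..<r}" "card S = k" by (auto simp: Ksets_def)
    have u: "U = S" if "U \<subseteq> S" "card U = k" for U
      using card_subset_eq[of S U] that S finite_subset[of S] by auto
    have up: "upsum r k x S = x S"
    proof -
      have "upsum r k x S = (\<Sum>T\<in>{S}. of_bool (S \<subseteq> T) * x T)"
        unfolding upsum_def
      proof (rule sum.mono_neutral_right)
        show "\<forall>T\<in>Ksets r k - {S}. of_bool (S \<subseteq> T) * x T = 0"
        proof
          fix T assume "T \<in> Ksets r k - {S}"
          then have "\<not> S \<subseteq> T"
            using card_subset_eq[of T S] S finite_subset[of T] by (auto simp: Ksets_def)
          then show "of_bool (S \<subseteq> T) * x T = 0" by simp
        qed
      qed (use True in auto)
      then show ?thesis by simp
    qed
    have "bop r k 0 x S = (\<Sum>U\<in>{S}. of_bool (U \<subseteq> S \<and> card U + 0 = k) * upsum r k x U)"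
    proof -
      have "\<forall>U\<in>Pow {0..<r} - {S}. of_bool (U \<subseteq> S \<and> card U + 0 = k) * upsum r k x U = 0"
        using u by auto
      then show ?thesis unfolding bop_apply if_P[OF True]
        by (intro sum.mono_neutral_right) (use S in auto)
    qed
    then show ?thesis using S up by (simp add: proj_def)
  next
    case False
    then show ?thesis unfolding bop_apply by (auto simp: proj_def Ksets_def)
  qed
qed

lemma sum_of_bool_card:
  assumes "finite A"
  shows "(\<Sum>U\<in>A. of_bool (P U)) = (of_nat (card {U \<in> A. P U}) :: 'a::comm_semiring_1)"
  using assms by (simp add: Int_def flip: sum.inter_filter of_bool_def)

text \<open>A double count over chains S \<supseteq> U \<subseteq> R \<supseteq> V \<subseteq> T.
  \<open>card_common_supersets\<close> trades the sets R above U and V for sets W inside both. After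
  that U runs between W and S, V between W and T, independently of each other, which gives
  \<open>h choose i\<close> and \<open>h choose j\<close> for h = k - card W.\<close>

lemma bop_mult:
  fixes x :: "nat set \<Rightarrow> 'a::field"
  assumes r: "r = m + 2 * k"
  shows "bop r k i (bop r k j x) S
    = (\<Sum>h\<le>i + j. of_nat ((h choose i) * (h choose j) * ((m + i + j) choose (i + j - h))) * bop r k h x S)"
proof (cases "S \<in> Ksets r k")
  case False
  then show ?thesis by (simp add: bop_apply)
next
  case True
  then have S: "S \<subseteq> {0..<r}" "card S = k" by (auto simp: Ksets_def)
  have fS: "finite S" using S(1) finite_subset by blast
  let ?P = "Pow {0..<r}" and ?K = "Ksets r k"
  \<comment> \<open>With h = k - card W this is the last binomial of the product formula, set to 0
    where h exceeds i + j and subtraction would be truncated.\<close>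
  define c :: "nat set \<Rightarrow> 'a" where
    "c W = of_nat (if k \<le> i + j + card W then (m + i + j) choose (i + j + card W - k) else 0)" for W
  let ?y = "upsum r k x"
  let ?A = "\<lambda>U. of_bool (U \<subseteq> S \<and> card U + i = k) :: 'a" and ?B = "\<lambda>V. of_bool (card V + j = k) :: 'a"
  have up: "upsum r k (bop r k j x) U = (\<Sum>V\<in>?P. ?B V * ?y V * (\<Sum>R\<in>?K. of_bool (U \<subseteq> R \<and> V \<subseteq> R)))" for U
  proof -
    have "upsum r k (bop r k j x) U
        = (\<Sum>R\<in>?K. \<Sum>V\<in>?P. of_bool (U \<subseteq> R) * (of_bool (V \<subseteq> R \<and> card V + j = k) * ?y V))"
      unfolding upsum_def[of r k "bop r k j x"] sum_distrib_left[symmetric]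
      by (rule sum.cong[OF refl]) (simp add: bop_apply)
    also have "\<dots> = (\<Sum>V\<in>?P. \<Sum>R\<in>?K. of_bool (U \<subseteq> R) * (of_bool (V \<subseteq> R \<and> card V + j = k) * ?y V))"
      by (rule sum.swap)
    also have "\<dots> = (\<Sum>V\<in>?P. ?B V * ?y V * (\<Sum>R\<in>?K. of_bool (U \<subseteq> R \<and> V \<subseteq> R)))"
      unfolding sum_distrib_left by (intro sum.cong refl) auto
    finally show ?thesis .
  qed
  have count: "?A U * (?B V * ?y V * (\<Sum>R\<in>?K. of_bool (U \<subseteq> R \<and> V \<subseteq> R)))
      = (\<Sum>W\<in>?P. c W * (?A U * of_bool (W \<subseteq> U)) * (?B V * of_bool (W \<subseteq> V) * ?y V))"
    if UV: "U \<in> ?P" "V \<in> ?P" for U V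
  proof (cases "U \<subseteq> S \<and> card U + i = k \<and> card V + j = k")
    case True
    have "(\<Sum>R\<in>?K. of_bool (U \<subseteq> R \<and> V \<subseteq> R)) = (of_nat (card {R. U \<subseteq> R \<and> V \<subseteq> R \<and> R \<in> ?K}) :: 'a)"
      by (subst sum_of_bool_card) (auto intro!: arg_cong[of _ _ "\<lambda>A. of_nat (card A)"])
    also have "\<dots> = (\<Sum>W\<in>Pow (U \<inter> V). c W)"
      using card_common_supersets[OF r, of U V i j] UV True by (simp add: c_def)
    also have "\<dots> = (\<Sum>W\<in>?P. c W * of_bool (W \<subseteq> U) * of_bool (W \<subseteq> V))"
      by (rule sum.mono_neutral_cong_left) (use UV in auto)
    finally show ?thesis using True by (simp add: sum_distrib_left ac_simps)
  qed auto
  have cU: "(\<Sum>U\<in>?P. ?A U * of_bool (W \<subseteq> U)) = (of_bool (W \<subseteq> S) * of_nat ((k - card W) choose i) :: 'a)" for W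
  proof -
    have "(\<Sum>U\<in>?P. ?A U * of_bool (W \<subseteq> U)) = (\<Sum>U\<in>?P. of_bool (W \<subseteq> U \<and> U \<subseteq> S \<and> card U + i = k) :: 'a)"
      by (rule sum.cong) auto
    also have "\<dots> = of_nat (card {U \<in> ?P. W \<subseteq> U \<and> U \<subseteq> S \<and> card U + i = k})"
      by (rule sum_of_bool_card) simp
    also have "{U \<in> ?P. W \<subseteq> U \<and> U \<subseteq> S \<and> card U + i = k} = {U. W \<subseteq> U \<and> U \<subseteq> S \<and> card U + i = k}"
      using S by auto
    finally show ?thesis using card_intermediate[OF fS S(2), of W i] by simp
  qed
  have cV: "(\<Sum>V\<in>?P. ?B V * of_bool (W \<subseteq> V) * ?y V) = of_nat ((k - card W) choose j) * ?y W" for W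
  proof -
    have "(\<Sum>V\<in>?P. ?B V * of_bool (W \<subseteq> V) * ?y V)
        = (\<Sum>V\<in>?P. \<Sum>T\<in>?K. of_bool (W \<subseteq> V \<and> V \<subseteq> T \<and> card V + j = k) * x T)"
      unfolding upsum_def sum_distrib_left by (intro sum.cong refl) auto
    also have "\<dots> = (\<Sum>T\<in>?K. \<Sum>V\<in>?P. of_bool (W \<subseteq> V \<and> V \<subseteq> T \<and> card V + j = k) * x T)"
      by (rule sum.swap)
    also have "\<dots> = (\<Sum>T\<in>?K. of_nat ((k - card W) choose j) * (of_bool (W \<subseteq> T) * x T))"
    proof (rule sum.cong[OF refl])
      fix T assume "T \<in> ?K"
      then have T: "T \<subseteq> {0..<r}" "card T = k" "finite T" by (auto simp: Ksets_def intro: finite_subset)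
      have "(\<Sum>V\<in>?P. of_bool (W \<subseteq> V \<and> V \<subseteq> T \<and> card V + j = k))
          = (of_nat (card {V \<in> ?P. W \<subseteq> V \<and> V \<subseteq> T \<and> card V + j = k}) :: 'a)"
        by (rule sum_of_bool_card) simp
      also have "{V \<in> ?P. W \<subseteq> V \<and> V \<subseteq> T \<and> card V + j = k} = {V. W \<subseteq> V \<and> V \<subseteq> T \<and> card V + j = k}"
        using T by auto
      finally show "(\<Sum>V\<in>?P. of_bool (W \<subseteq> V \<and> V \<subseteq> T \<and> card V + j = k) * x T)
          = of_nat ((k - card W) choose j) * (of_bool (W \<subseteq> T) * x T)"
        using card_intermediate[OF T(3,2), of W j] by (simp flip: sum_distrib_right)
    qed
    finally show ?thesis by (simp only: upsum_def sum_distrib_left)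
  qed
  have "bop r k i (bop r k j x) S
      = (\<Sum>U\<in>?P. \<Sum>V\<in>?P. ?A U * (?B V * ?y V * (\<Sum>R\<in>?K. of_bool (U \<subseteq> R \<and> V \<subseteq> R))))"
    using True by (simp add: bop_apply[of r k i] up sum_distrib_left)
  also have "\<dots> = (\<Sum>U\<in>?P. \<Sum>V\<in>?P. \<Sum>W\<in>?P. c W * (?A U * of_bool (W \<subseteq> U)) * (?B V * of_bool (W \<subseteq> V) * ?y V))"
    by (intro sum.cong refl count)
  also have "\<dots> = (\<Sum>U\<in>?P. \<Sum>W\<in>?P. \<Sum>V\<in>?P. c W * (?A U * of_bool (W \<subseteq> U)) * (?B V * of_bool (W \<subseteq> V) * ?y V))"
    by (intro sum.cong refl sum.swap)
  also have "\<dots> = (\<Sum>W\<in>?P. \<Sum>U\<in>?P. \<Sum>V\<in>?P. c W * (?A U * of_bool (W \<subseteq> U)) * (?B V * of_bool (W \<subseteq> V) * ?y V))"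
    by (rule sum.swap)
  also have "\<dots> = (\<Sum>W\<in>?P. c W * (\<Sum>U\<in>?P. ?A U * of_bool (W \<subseteq> U)) * (\<Sum>V\<in>?P. ?B V * of_bool (W \<subseteq> V) * ?y V))"
  proof (rule sum.cong[OF refl])
    fix W
    show "(\<Sum>U\<in>?P. \<Sum>V\<in>?P. c W * (?A U * of_bool (W \<subseteq> U)) * (?B V * of_bool (W \<subseteq> V) * ?y V))
        = c W * (\<Sum>U\<in>?P. ?A U * of_bool (W \<subseteq> U)) * (\<Sum>V\<in>?P. ?B V * of_bool (W \<subseteq> V) * ?y V)"
      unfolding sum_distrib_left[of "c W"] sum_product ..
  qed
  also have "\<dots> = (\<Sum>W\<in>?P. c W * (of_bool (W \<subseteq> S) * of_nat ((k - card W) choose i)) * (of_nat ((k - card W) choose j) * ?y W))"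
    unfolding cU cV ..
  also have "\<dots> = (\<Sum>W\<in>?P. \<Sum>h\<le>i + j. of_nat ((h choose i) * (h choose j) * ((m + i + j) choose (i + j - h)))
      * (of_bool (W \<subseteq> S \<and> card W + h = k) * ?y W))"
  proof (rule sum.cong[OF refl])
    fix W assume "W \<in> ?P"
    let ?t = "\<lambda>h. of_nat ((h choose i) * (h choose j) * ((m + i + j) choose (i + j - h)))
      * (of_bool (W \<subseteq> S \<and> card W + h = k) * ?y W)"
    show "c W * (of_bool (W \<subseteq> S) * of_nat ((k - card W) choose i)) * (of_nat ((k - card W) choose j) * ?y W)
      = (\<Sum>h\<le>i + j. ?t h)"
    proof (cases "W \<subseteq> S \<and> k \<le> i + j + card W")
      case W: True
      have le: "card W \<le> k" using card_mono[OF fS] W S by auto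
      have "(\<Sum>h\<le>i + j. ?t h) = (\<Sum>h\<in>{k - card W}. ?t h)"
        by (rule sum.mono_neutral_right) (use W le in auto)
      moreover have "i + j - (k - card W) = i + j + card W - k" using W le by linarith
      ultimately show ?thesis using W le by (simp add: c_def ac_simps)
    next
      case False
      then have "(\<Sum>h\<le>i + j. ?t h) = 0" by (intro sum.neutral) auto
      moreover have "c W * of_bool (W \<subseteq> S) = 0" using False by (auto simp: c_def)
      ultimately show ?thesis by (metis mult.assoc mult_zero_left)
    qed
  qed
  also have "\<dots> = (\<Sum>h\<le>i + j. \<Sum>W\<in>?P. of_nat ((h choose i) * (h choose j) * ((m + i + j) choose (i + j - h)))
      * (of_bool (W \<subseteq> S \<and> card W + h = k) * ?y W))"
    by (rule sum.swap)
  also have "\<dots> = (\<Sum>h\<le>i + j. of_nat ((h choose i) * (h choose j) * ((m + i + j) choose (i + j - h))) * bop r k h x S)"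
    using True by (simp only: bop_apply if_True sum_distrib_left)
  finally show ?thesis .
qed

section \<open>Equivariant maps between permutation modules\<close>

text \<open>Colour each point by its membership in \<open>S\<close> and in \<open>T\<close>. The
  assumptions give the four colour classes the same sizes for \<open>(S, T)\<close> and
  \<open>(S', T')\<close>, so some permutation matches the colourings.\<close>

lemma ex_permutes_two_sets:
  assumes "finite A" "S \<subseteq> A" "T \<subseteq> A" "S' \<subseteq> A" "T' \<subseteq> A"
    and "card S = card S'" "card T = card T'" "card (S \<inter> T) = card (S' \<inter> T')"
  obtains \<sigma> where "\<sigma> permutes A" "\<sigma> ` S = S'" "\<sigma> ` T = T'"
proof -
  let ?f = "\<lambda>x. (x \<in> S, x \<in> T)" and ?f' = "\<lambda>x. (x \<in> S', x \<in> T')"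
  have fin: "finite S" "finite T" "finite S'" "finite T'" using assms finite_subset by blast+
  have c: "card {x \<in> A. ?f x = y} = card {x \<in> A. ?f' x = y}" for y
  proof -
    have d1: "card (S - T) = card (S' - T')" "card (T - S) = card (T' - S')"
      using card_Diff_subset_Int[of S T] card_Diff_subset_Int[of S' T']
        card_Diff_subset_Int[of T S] card_Diff_subset_Int[of T' S'] fin assms(6-8)
      by (simp_all add: Int_commute)
    have un: "card (S \<union> T) = card (S' \<union> T')"
      using card_Un_Int[OF fin(1,2)] card_Un_Int[OF fin(3,4)] assms(6-8) by linarith
    have d2: "card (A - (S \<union> T)) = card (A - (S' \<union> T'))"
      using un assms fin by (simp add: card_Diff_subset)
    obtain p q where y: "y = (p, q)" by (cases y)
    have s: "{x \<in> A. ?f x = (True, True)} = S \<inter> T" "{x \<in> A. ?f x = (True, False)} = S - T"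
      "{x \<in> A. ?f x = (False, True)} = T - S" "{x \<in> A. ?f x = (False, False)} = A - (S \<union> T)"
      "{x \<in> A. ?f' x = (True, True)} = S' \<inter> T'" "{x \<in> A. ?f' x = (True, False)} = S' - T'"
      "{x \<in> A. ?f' x = (False, True)} = T' - S'" "{x \<in> A. ?f' x = (False, False)} = A - (S' \<union> T')"
      using assms(2-5) by auto
    show ?thesis unfolding y by (cases p; cases q) (simp_all only: s d1 d2 assms(8))
  qed
  have "image_mset ?f (mset_set A) = image_mset ?f' (mset_set A)"
  proof (rule multiset_eqI)
    fix y
    have "count (image_mset f (mset_set A)) y = card {x \<in> A. f x = y}" for f :: "_ \<Rightarrow> bool \<times> bool"
    proof -
      have "count (image_mset f (mset_set A)) y = (\<Sum>x\<in>{x \<in> A. f x = y}. 1)"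
        unfolding count_image_mset' by (rule sum.cong) (use assms(1) in auto)
      then show ?thesis by simp
    qed
    then show "count (image_mset ?f (mset_set A)) y = count (image_mset ?f' (mset_set A)) y"
      using c[of y] by simp
  qed
  from image_mset_eq_implies_permutes[OF assms(1) this]
  obtain \<sigma> where \<sigma>: "\<sigma> permutes A" "\<forall>x\<in>A. ?f x = ?f' (\<sigma> x)" by blast
  have "\<sigma> ` S = S'"
  proof (rule card_subset_eq)
    show "\<sigma> ` S \<subseteq> S'" using \<sigma>(2) assms(2) by auto
    show "card (\<sigma> ` S) = card S'"
      using card_image[of \<sigma> S] permutes_inj_on[OF \<sigma>(1)] assms(6) by simp
  qed fact
  moreover have "\<sigma> ` T = T'"
  proof (rule card_subset_eq)
    show "\<sigma> ` T \<subseteq> T'" using \<sigma>(2) assms(3) by auto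
    show "card (\<sigma> ` T) = card T'"
      using card_image[of \<sigma> T] permutes_inj_on[OF \<sigma>(1)] assms(7) by simp
  qed fact
  ultimately show thesis using that \<sigma>(1) by blast
qed

text \<open>The matrix with entries \<open>s choose j\<close> is unitriangular, hence the system is
  solvable over every commutative ring, independently of the characteristic.\<close>

lemma binomial_inversion_exists:
  fixes f :: "nat \<Rightarrow> 'a::comm_ring_1"
  shows "\<exists>c. \<forall>s\<le>n. (\<Sum>j\<le>s. of_nat (s choose j) * c j) = f s"
proof (induction n)
  case 0
  show ?case by (rule exI[of _ "\<lambda>_. f 0"]) simp
next
  case (Suc n)
  then obtain c where c: "\<forall>s\<le>n. (\<Sum>j\<le>s. of_nat (s choose j) * c j) = f s" ..
  define c' where "c' = c(Suc n := f (Suc n) - (\<Sum>j\<le>n. of_nat (Suc n choose j) * c j))"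
  have "(\<Sum>j\<le>s. of_nat (s choose j) * c' j) = f s" if "s \<le> Suc n" for s
  proof (cases "s = Suc n")
    case True
    have "(\<Sum>j\<le>n. of_nat (Suc n choose j) * c' j) = (\<Sum>j\<le>n. of_nat (Suc n choose j) * c j)"
      by (rule sum.cong) (auto simp: c'_def)
    then show ?thesis unfolding True by (simp only: sum.atMost_Suc) (simp add: c'_def)
  next
    case False
    have "(\<Sum>j\<le>s. of_nat (s choose j) * c' j) = (\<Sum>j\<le>s. of_nat (s choose j) * c j)"
      by (rule sum.cong) (use False that in \<open>auto simp: c'_def\<close>)
    then show ?thesis using c False that by simp
  qed
  then show ?case by blast
qed

definition delta :: "nat set \<Rightarrow> nat set \<Rightarrow> 'a::field" where
  "delta T = (\<lambda>S. of_bool (S = T))"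

lemma delta_Mperm: "T \<in> Ksets r k \<Longrightarrow> delta T \<in> Mperm r k"
  by (auto simp: delta_def Mperm_def Ksets_def)

lemma Mperm_Ksets: "x \<in> Mperm r k \<longleftrightarrow> (\<forall>S. S \<notin> Ksets r k \<longrightarrow> x S = 0)"
  by (auto simp: Mperm_def Ksets_def)

lemma permutes_image_Ksets:
  assumes "\<sigma> permutes {0..<r}"
  shows "\<sigma> ` T \<in> Ksets r k \<longleftrightarrow> T \<in> Ksets r k"
proof -
  have "\<sigma> ` T \<subseteq> {0..<r} \<longleftrightarrow> T \<subseteq> {0..<r}"
    using permutes_in_image[OF assms] by auto
  moreover have "card (\<sigma> ` T) = card T" by (rule card_image[OF permutes_inj_on[OF assms]])
  ultimately show ?thesis by (simp add: Ksets_def)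
qed

lemma permutes_image_inv:
  assumes "\<sigma> permutes A"
  shows "inv \<sigma> ` \<sigma> ` T = T" "\<sigma> ` inv \<sigma> ` T = T"
  using permutes_inverses[OF assms] by (simp_all add: image_image)

lemma act_delta: "\<sigma> permutes {0..<r} \<Longrightarrow> act \<sigma> (delta T) = delta (\<sigma> ` T)"
proof -
  assume \<sigma>: "\<sigma> permutes {0..<r}"
  have "inv \<sigma> ` S = T \<longleftrightarrow> S = \<sigma> ` T" for S
    using permutes_image_inv[OF \<sigma>, of S] permutes_image_inv[OF \<sigma>, of T] by auto
  then show ?thesis by (simp add: act_def delta_def)
qed

lemma linear_on_Mperm_expand:
  fixes \<phi> :: "(nat set \<Rightarrow> 'a::field) \<Rightarrow> nat set \<Rightarrow> 'a"
  assumes add: "\<And>x y. x \<in> Mperm r k \<Longrightarrow> y \<in> Mperm r k \<Longrightarrow> \<phi> (vadd x y) = vadd (\<phi> x) (\<phi> y)"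
    and scale: "\<And>c x. x \<in> Mperm r k \<Longrightarrow> \<phi> (vscale c x) = vscale c (\<phi> x)"
    and x: "x \<in> Mperm r k"
  shows "\<phi> x S = (\<Sum>T\<in>Ksets r k. x T * \<phi> (delta T) S)"
proof -
  have *: "\<phi> (\<lambda>S. \<Sum>T\<in>A. x T * delta T S) = (\<lambda>S. \<Sum>T\<in>A. x T * \<phi> (delta T) S)" if "finite A" "A \<subseteq> Ksets r k" for A
    using that
  proof (induction A rule: finite_induct)
    case empty
    have "vzero \<in> Mperm r k" by (simp add: vzero_def Mperm_def)
    from scale[OF this, of 0] show ?case by (simp add: vscale_def)
  next
    case (insert T A)
    have 1: "vscale (x T) (delta T) \<in> Mperm r k"
      using delta_Mperm[of T r k] insert.prems by (auto simp: Mperm_def vscale_def)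
    have 2: "(\<lambda>S. \<Sum>T\<in>A. x T * delta T S) \<in> Mperm r k"
      unfolding Mperm_Ksets using insert.prems by (auto simp: delta_def intro!: sum.neutral)
    have "(\<lambda>S. \<Sum>T\<in>insert T A. x T * delta T S) = vadd (vscale (x T) (delta T)) (\<lambda>S. \<Sum>T\<in>A. x T * delta T S)"
      using insert.hyps by (simp add: vadd_def vscale_def)
    then have "\<phi> (\<lambda>S. \<Sum>T\<in>insert T A. x T * delta T S)
        = vadd (vscale (x T) (\<phi> (delta T))) (\<lambda>S. \<Sum>T\<in>A. x T * \<phi> (delta T) S)"
      using add[OF 1 2] scale[OF delta_Mperm[of T r k], of "x T"] insert by simp
    then show ?case using insert.hyps by (simp add: vadd_def vscale_def)
  qed
  have "x = (\<lambda>S. \<Sum>T\<in>Ksets r k. x T * delta T S)"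
  proof
    fix S
    have "(\<Sum>T\<in>Ksets r k. x T * delta T S) = (\<Sum>T\<in>Ksets r k. if T = S then x T else 0)"
      by (rule sum.cong) (auto simp: delta_def)
    also have "\<dots> = x S" using x by (simp add: sum.delta Mperm_Ksets)
    finally show "x S = (\<Sum>T\<in>Ksets r k. x T * delta T S)" by simp
  qed
  then show ?thesis using *[of "Ksets r k"] by (metis finite_Ksets order_refl)
qed

text \<open>The symmetric group acts transitively on pairs \<open>(S, T)\<close> with given \<open>card (S \<inter> T)\<close>; binomial
  inversion then writes the matrix entries as combinations of numbers of common subsets.\<close>
lemma equivariant_form:
  fixes \<phi> :: "(nat set \<Rightarrow> 'a::field) \<Rightarrow> nat set \<Rightarrow> 'a"
  assumes add: "\<And>x y. x \<in> Mperm r k \<Longrightarrow> y \<in> Mperm r k \<Longrightarrow> \<phi> (vadd x y) = vadd (\<phi> x) (\<phi> y)"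
    and scale: "\<And>c x. x \<in> Mperm r k \<Longrightarrow> \<phi> (vscale c x) = vscale c (\<phi> x)"
    and equi: "\<And>\<sigma> x. \<sigma> permutes {0..<r} \<Longrightarrow> x \<in> Mperm r k \<Longrightarrow> \<phi> (act \<sigma> x) = act \<sigma> (\<phi> x)"
  shows "\<exists>c. \<forall>x\<in>Mperm r k. \<forall>S\<in>Ksets r d. \<phi> x S = (\<Sum>U\<in>Pow S. c (card U) * upsum r k x U)"
proof -
  \<comment> \<open>The matrix entry at some chosen pair meeting in \<open>s\<close> points. For an
    \<open>s\<close> that no pair realises the value is arbitrary, which affects no matrix
    entry.\<close>
  define f where "f s = (let (S, T) = (SOME (S, T). S \<in> Ksets r d \<and> T \<in> Ksets r k \<and> card (S \<inter> T) = s) in \<phi> (delta T) S)" for s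
  have f: "\<phi> (delta T) S = f (card (S \<inter> T))" if ST: "S \<in> Ksets r d" "T \<in> Ksets r k" for S T
  proof -
    let ?P = "\<lambda>(S', T'). S' \<in> Ksets r d \<and> T' \<in> Ksets r k \<and> card (S' \<inter> T') = card (S \<inter> T)"
    obtain S' T' where e: "(SOME p. ?P p) = (S', T')" by (cases "SOME p. ?P p")
    have "?P (SOME p. ?P p)" by (rule someI[of ?P "(S, T)"]) (use ST in simp)
    then have ST': "S' \<in> Ksets r d" "T' \<in> Ksets r k" "card (S' \<inter> T') = card (S \<inter> T)"
      unfolding e by auto
    obtain \<sigma> where \<sigma>: "\<sigma> permutes {0..<r}" "\<sigma> ` S = S'" "\<sigma> ` T = T'"
      using ex_permutes_two_sets[of "{0..<r}" S T S' T'] ST ST' by (auto simp: Ksets_def)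
    have "\<phi> (delta T') S' = \<phi> (act \<sigma> (delta T)) S'" by (simp add: act_delta[OF \<sigma>(1)] \<sigma>(3))
    also have "\<dots> = \<phi> (delta T) (inv \<sigma> ` S')"
      using equi[OF \<sigma>(1) delta_Mperm[OF ST(2)]] by (simp add: act_def)
    also have "inv \<sigma> ` S' = S" using permutes_image_inv(1)[OF \<sigma>(1), of S] \<sigma>(2) by simp
    finally show ?thesis unfolding f_def e by simp
  qed
  obtain c where c: "\<forall>s\<le>d. (\<Sum>j\<le>s. of_nat (s choose j) * c j) = f s"
    using binomial_inversion_exists by blast
  have "\<phi> x S = (\<Sum>U\<in>Pow S. c (card U) * upsum r k x U)" if x: "x \<in> Mperm r k" and S: "S \<in> Ksets r d" for x S
  proof -
    have fS: "finite S" using S by (auto simp: Ksets_def intro: finite_subset)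
    have k: "\<phi> (delta T) S = (\<Sum>U\<in>Pow S. c (card U) * of_bool (U \<subseteq> T))" if T: "T \<in> Ksets r k" for T
    proof -
      have "card (S \<inter> T) \<le> d" using S fS card_mono[of S "S \<inter> T"] by (auto simp: Ksets_def)
      then have "\<phi> (delta T) S = (\<Sum>j\<le>card (S \<inter> T). of_nat (card (S \<inter> T) choose j) * c j)"
        using f[OF S T] c by simp
      also have "\<dots> = (\<Sum>U\<in>Pow (S \<inter> T). c (card U))"
        using sum_Pow_card[of "S \<inter> T" c] fS by simp
      also have "\<dots> = (\<Sum>U\<in>Pow S. c (card U) * of_bool (U \<subseteq> T))"
        by (rule sum.mono_neutral_cong_left) (use fS in auto)
      finally show ?thesis .
    qed
    have "\<phi> x S = (\<Sum>T\<in>Ksets r k. x T * \<phi> (delta T) S)"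
      by (rule linear_on_Mperm_expand[OF add scale x])
    also have "\<dots> = (\<Sum>T\<in>Ksets r k. \<Sum>U\<in>Pow S. c (card U) * (of_bool (U \<subseteq> T) * x T))"
      by (rule sum.cong[OF refl]) (simp add: k sum_distrib_left ac_simps del: sum_mult_of_bool_eq sum_of_bool_mult_eq)
    also have "\<dots> = (\<Sum>U\<in>Pow S. \<Sum>T\<in>Ksets r k. c (card U) * (of_bool (U \<subseteq> T) * x T))"
      by (rule sum.swap)
    finally show ?thesis by (simp only: upsum_def sum_distrib_left)
  qed
  then show ?thesis by blast
qed

section \<open>The Schur algebra\<close>

lemma proj_Mperm [simp]: "proj r k x \<in> Mperm r k"
  by (auto simp: proj_def Mperm_def)

lemma proj_id: "x \<in> Mperm r k \<Longrightarrow> proj r k x = x"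
  by (rule ext) (auto simp: proj_def Mperm_def)

lemma proj_eq: "proj r k x = (\<lambda>S. if S \<in> Ksets r k then x S else 0)"
  by (simp add: proj_def Ksets_def)

lemma schurD:
  assumes "\<phi> \<in> schur r k"
  shows "\<phi> (proj r k x) = \<phi> x" "\<phi> x \<in> Mperm r k"
    "x \<in> Mperm r k \<Longrightarrow> y \<in> Mperm r k \<Longrightarrow> \<phi> (vadd x y) = vadd (\<phi> x) (\<phi> y)"
    "x \<in> Mperm r k \<Longrightarrow> \<phi> (vscale c x) = vscale c (\<phi> x)"
    "\<sigma> permutes {0..<r} \<Longrightarrow> x \<in> Mperm r k \<Longrightarrow> \<phi> (act \<sigma> x) = act \<sigma> (\<phi> x)"
proof -
  have *: "\<phi> x = proj r k (\<phi> (proj r k x))" for x using assms unfolding schur_def by blast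
  show "\<phi> x \<in> Mperm r k" by (subst *) simp
  have "\<phi> (proj r k x) = proj r k (\<phi> (proj r k (proj r k x)))" by (rule *)
  also have "\<dots> = \<phi> x" unfolding proj_id[OF proj_Mperm] by (rule *[symmetric])
  finally show "\<phi> (proj r k x) = \<phi> x" .
qed (use assms in \<open>unfold schur_def, blast+\<close>)

lemma schurI:
  assumes "\<And>x. \<phi> (proj r k x) = \<phi> x" "\<And>x. \<phi> x \<in> Mperm r k"
    "\<And>x y. x \<in> Mperm r k \<Longrightarrow> y \<in> Mperm r k \<Longrightarrow> \<phi> (vadd x y) = vadd (\<phi> x) (\<phi> y)"
    "\<And>c x. x \<in> Mperm r k \<Longrightarrow> \<phi> (vscale c x) = vscale c (\<phi> x)"
    "\<And>\<sigma> x. \<sigma> permutes {0..<r} \<Longrightarrow> x \<in> Mperm r k \<Longrightarrow> \<phi> (act \<sigma> x) = act \<sigma> (\<phi> x)"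
  shows "\<phi> \<in> schur r k"
proof -
  have "\<phi> x = proj r k (\<phi> (proj r k x))" for x
    unfolding assms(1) by (rule proj_id[OF assms(2), symmetric])
  then show ?thesis unfolding schur_def using assms(3-5) by blast
qed

lemma upsum_proj: "upsum r k (proj r k x) = upsum r k x"
  by (auto simp: upsum_def proj_eq intro!: ext sum.cong)

lemma upsum_act:
  assumes "\<sigma> permutes {0..<r}"
  shows "upsum r k (act \<sigma> x) (\<sigma> ` U) = upsum r k x U"
  unfolding upsum_def
proof (rule sum.reindex_bij_witness[of _ "\<lambda>T. \<sigma> ` T" "\<lambda>T. inv \<sigma> ` T"])
  fix T assume T: "T \<in> Ksets r k"
  show 1: "\<sigma> ` inv \<sigma> ` T = T" by (rule permutes_image_inv[OF assms])
  show "inv \<sigma> ` T \<in> Ksets r k" using T permutes_image_Ksets[OF permutes_inv[OF assms]] by blast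
  have "U \<subseteq> inv \<sigma> ` T \<longleftrightarrow> \<sigma> ` U \<subseteq> T"
    using inj_image_subset_iff[OF permutes_inj[OF assms], of U "inv \<sigma> ` T"] unfolding 1 by simp
  then show "of_bool (U \<subseteq> inv \<sigma> ` T) * x (inv \<sigma> ` T) = of_bool (\<sigma> ` U \<subseteq> T) * act \<sigma> x T"
    by (simp add: act_def)
next
  fix T assume T: "T \<in> Ksets r k"
  show "inv \<sigma> ` \<sigma> ` T = T" by (rule permutes_image_inv[OF assms])
  show "\<sigma> ` T \<in> Ksets r k" using T permutes_image_Ksets[OF assms] by blast
qed

lemma Mperm_closed:
  "x \<in> Mperm r k \<Longrightarrow> y \<in> Mperm r k \<Longrightarrow> vadd x y \<in> Mperm r k"
  "x \<in> Mperm r k \<Longrightarrow> vscale c x \<in> Mperm r k"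
  "\<sigma> permutes {0..<r} \<Longrightarrow> x \<in> Mperm r k \<Longrightarrow> act \<sigma> x \<in> Mperm r k"
  "vzero \<in> Mperm r k"
  by (simp_all add: Mperm_Ksets vadd_def vscale_def act_def vzero_def permutes_image_Ksets[OF permutes_inv])

lemma bop_schur: "bop r k i \<in> schur r k"
proof (rule schurI)
  fix \<sigma> and x :: "nat set \<Rightarrow> 'a" assume \<sigma>: "\<sigma> permutes {0..<r}"
  note inj = permutes_inj[OF \<sigma>]
  show "bop r k i (act \<sigma> x) = act \<sigma> (bop r k i x)"
  proof
    fix S
    obtain S' where S: "S = \<sigma> ` S'" using permutes_image_inv(2)[OF \<sigma>, of S] by blast
    have "(\<Sum>U\<in>Pow {0..<r}. of_bool (U \<subseteq> \<sigma> ` S' \<and> card U + i = k) * upsum r k (act \<sigma> x) U)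
        = (\<Sum>U\<in>Pow {0..<r}. of_bool (U \<subseteq> S' \<and> card U + i = k) * upsum r k x U)"
    proof (rule sum.reindex_bij_witness[of _ "\<lambda>T. \<sigma> ` T" "\<lambda>T. inv \<sigma> ` T"])
      fix U assume U: "U \<in> Pow {0..<r}"
      show "\<sigma> ` inv \<sigma> ` U = U" by (rule permutes_image_inv[OF \<sigma>])
      show "inv \<sigma> ` U \<in> Pow {0..<r}" using U permutes_in_image[OF permutes_inv[OF \<sigma>]] by auto
      have 1: "\<sigma> ` inv \<sigma> ` U = U" by (rule permutes_image_inv[OF \<sigma>])
      have 2: "inv \<sigma> ` U \<subseteq> S' \<longleftrightarrow> U \<subseteq> \<sigma> ` S'"
        using inj_image_subset_iff[OF inj, of "inv \<sigma> ` U" S'] unfolding 1 by simp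
      have 3: "card (inv \<sigma> ` U) = card U"
        by (rule card_image[OF permutes_inj_on[OF permutes_inv[OF \<sigma>]]])
      have 4: "upsum r k x (inv \<sigma> ` U) = upsum r k (act \<sigma> x) U"
        using upsum_act[OF \<sigma>, of k x "inv \<sigma> ` U"] unfolding 1 by simp
      show "of_bool (inv \<sigma> ` U \<subseteq> S' \<and> card (inv \<sigma> ` U) + i = k) * upsum r k x (inv \<sigma> ` U)
        = of_bool (U \<subseteq> \<sigma> ` S' \<and> card U + i = k) * upsum r k (act \<sigma> x) U"
        unfolding 2 3 4 ..
    next
      fix U assume "U \<in> Pow {0..<r}"
      then show "\<sigma> ` U \<in> Pow {0..<r}" using permutes_in_image[OF \<sigma>] by auto
      show "inv \<sigma> ` \<sigma> ` U = U" by (rule permutes_image_inv[OF \<sigma>])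
    qed
    then show "bop r k i (act \<sigma> x) S = act \<sigma> (bop r k i x) S"
      unfolding bop_apply act_def[of \<sigma> "bop r k i x"] S permutes_image_inv(1)[OF \<sigma>] permutes_image_Ksets[OF \<sigma>]
      by (simp only:)
  qed
next
  fix x y :: "nat set \<Rightarrow> 'a"
  show "bop r k i (proj r k x) = bop r k i x" by (intro ext) (simp only: bop_apply upsum_proj)
  show "bop r k i x \<in> Mperm r k" by (simp add: Mperm_Ksets bop_apply)
  have up: "upsum r k (vadd x y) U = upsum r k x U + upsum r k y U" for U
    unfolding upsum_def vadd_def by (simp only: distrib_left sum.distrib)
  show "bop r k i (vadd x y) = vadd (bop r k i x) (bop r k i y)"
    by (intro ext) (simp only: bop_apply up distrib_left sum.distrib vadd_def[of "bop r k i x"] split: if_splits, simp)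
next
  fix c and x :: "nat set \<Rightarrow> 'a"
  have up: "upsum r k (vscale c x) U = c * upsum r k x U" for U
    unfolding upsum_def vscale_def by (simp only: sum_distrib_left mult.left_commute)
  show "bop r k i (vscale c x) = vscale c (bop r k i x)"
    by (intro ext) (simp only: bop_apply up vscale_def[of c "bop r k i x"] sum_distrib_left mult.left_commute if_distrib[of "(*) c"] mult_zero_right)
qed

lemma proj_schur: "proj r k \<in> schur r k"
  unfolding bop_0[symmetric] by (rule bop_schur)

lemma schur_span:
  assumes "\<phi> \<in> schur r k"
  shows "\<exists>c. \<forall>x S. \<phi> x S = (\<Sum>h\<le>k. c h * bop r k h x S)"
proof -
  have "\<exists>c. \<forall>x\<in>Mperm r k. \<forall>S\<in>Ksets r k. \<phi> x S = (\<Sum>U\<in>Pow S. c (card U) * upsum r k x U)"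
    by (rule equivariant_form) (simp_all add: schurD[OF assms])
  then obtain c where c: "\<forall>x\<in>Mperm r k. \<forall>S\<in>Ksets r k. \<phi> x S = (\<Sum>U\<in>Pow S. c (card U) * upsum r k x U)"
    by blast
  \<comment> \<open>b(h) collects the subsets of size k - h, hence the reversed index.\<close>
  have "\<phi> x S = (\<Sum>h\<le>k. c (k - h) * bop r k h x S)" for x S
  proof (cases "S \<in> Ksets r k")
    case True
    then have S: "S \<subseteq> {0..<r}" "card S = k" by (auto simp: Ksets_def)
    have fS: "finite S" using S finite_subset by blast
    have "\<phi> x S = \<phi> (proj r k x) S" by (simp add: schurD(1)[OF assms])
    also have "\<dots> = (\<Sum>U\<in>Pow S. c (card U) * upsum r k x U)"
      using c True by (simp add: upsum_proj)
    also have "\<dots> = (\<Sum>U\<in>Pow {0..<r}. \<Sum>h\<le>k. c (k - h) * (of_bool (U \<subseteq> S \<and> card U + h = k) * upsum r k x U))"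
    proof (rule sum.mono_neutral_cong_left)
      show "\<forall>U\<in>Pow {0..<r} - Pow S. (\<Sum>h\<le>k. c (k - h) * (of_bool (U \<subseteq> S \<and> card U + h = k) * upsum r k x U)) = 0"
        by (auto intro!: sum.neutral)
      fix U assume U: "U \<in> Pow S"
      have le: "card U \<le> k" using U S fS card_mono by blast
      have "(\<Sum>h\<le>k. c (k - h) * (of_bool (U \<subseteq> S \<and> card U + h = k) * upsum r k x U))
          = (\<Sum>h\<in>{k - card U}. c (k - h) * (of_bool (U \<subseteq> S \<and> card U + h = k) * upsum r k x U))"
        by (rule sum.mono_neutral_right) (use le in auto)
      then show "c (card U) * upsum r k x U = (\<Sum>h\<le>k. c (k - h) * (of_bool (U \<subseteq> S \<and> card U + h = k) * upsum r k x U))"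
        using U le by simp
    qed (use S in auto)
    also have "\<dots> = (\<Sum>h\<le>k. \<Sum>U\<in>Pow {0..<r}. c (k - h) * (of_bool (U \<subseteq> S \<and> card U + h = k) * upsum r k x U))"
      by (rule sum.swap)
    also have "\<dots> = (\<Sum>h\<le>k. c (k - h) * bop r k h x S)"
      using True by (simp only: bop_apply if_True sum_distrib_left)
    finally show ?thesis .
  next
    case False
    then show ?thesis using schurD(2)[OF assms, of x] by (simp add: Mperm_Ksets bop_apply)
  qed
  then show ?thesis by (intro exI[of _ "\<lambda>h. c (k - h)"]) blast
qed

lemma schur_sum:
  assumes "\<phi> \<in> schur r k" "finite A" "\<And>h. h \<in> A \<Longrightarrow> y h \<in> Mperm r k"
  shows "\<phi> (\<lambda>S. \<Sum>h\<in>A. c h * y h S) = (\<lambda>S. \<Sum>h\<in>A. c h * \<phi> (y h) S)"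
  using assms(2,3)
proof (induction A rule: finite_induct)
  case empty
  from schurD(4)[OF assms(1) Mperm_closed(4), of 0] show ?case by (simp add: vscale_def)
next
  case (insert a A)
  have 1: "(\<lambda>S. \<Sum>h\<in>A. c h * y h S) \<in> Mperm r k" "vscale (c a) (y a) \<in> Mperm r k"
    using insert.prems by (auto simp: Mperm_Ksets vscale_def intro!: sum.neutral)
  have "(\<lambda>S. \<Sum>h\<in>insert a A. c h * y h S) = vadd (vscale (c a) (y a)) (\<lambda>S. \<Sum>h\<in>A. c h * y h S)"
    using insert.hyps by (simp add: vadd_def vscale_def)
  then show ?case
    using schurD(3)[OF assms(1) 1(2,1)] schurD(4)[OF assms(1), of "y a" "c a"] insert
    by (simp add: vadd_def vscale_def)
qed

text \<open>The b(h) span the algebra, and the right-hand side of their product formula is symmetric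
  in i and j.\<close>

lemma schur_commute:
  assumes "r = m + 2 * k" "\<phi> \<in> schur r k" "\<psi> \<in> schur r k"
  shows "\<phi> \<circ> \<psi> = \<psi> \<circ> \<phi>"
proof -
  obtain c d where c: "\<forall>x S. \<phi> x S = (\<Sum>h\<le>k. c h * bop r k h x S)"
    and d: "\<forall>x S. \<psi> x S = (\<Sum>h\<le>k. d h * bop r k h x S)"
    using schur_span assms by metis
  have comm: "bop r k i (bop r k j x) S = bop r k j (bop r k i x) S" for i j and x :: "nat set \<Rightarrow> 'a" and S
    unfolding bop_mult[OF assms(1)] by (simp only: ac_simps)
  have ex: "(\<alpha> \<circ> \<beta>) x S = (\<Sum>h\<le>k. \<Sum>l\<le>k. a h * b l * bop r k h (bop r k l x) S)"
    if a: "\<forall>x S. \<alpha> x S = (\<Sum>h\<le>k. a h * bop r k h x S)"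
      and b: "\<forall>x S. \<beta> x S = (\<Sum>h\<le>k. b h * bop r k h x S)" for a b and \<alpha> \<beta> :: "'a op" and x S
  proof -
    have "\<beta> x = (\<lambda>S. \<Sum>l\<le>k. b l * bop r k l x S)" using b by auto
    then have "bop r k h (\<beta> x) = (\<lambda>S. \<Sum>l\<le>k. b l * bop r k h (bop r k l x) S)" for h
      using schur_sum[OF bop_schur, of "{..k}" "\<lambda>l. bop r k l x" r k h b] by (simp add: schurD(2)[OF bop_schur])
    then show ?thesis using a by (simp add: sum_distrib_left mult.assoc)
  qed
  show ?thesis
  proof (intro ext)
    fix x S
    show "(\<phi> \<circ> \<psi>) x S = (\<psi> \<circ> \<phi>) x S"
      unfolding ex[OF c d] ex[OF d c]
      by (subst sum.swap) (intro sum.cong refl arg_cong2[where f = "(*)"] mult.commute comm)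
  qed
qed

lemma ozero_schur: "ozero \<in> schur r k"
  by (rule schurI) (simp_all add: ozero_def Mperm_Ksets vadd_def vscale_def act_def)

lemma oadd_schur:
  assumes "\<phi> \<in> schur r k" "\<psi> \<in> schur r k"
  shows "oadd \<phi> \<psi> \<in> schur r k"
proof (rule schurI)
  fix x show "oadd \<phi> \<psi> x \<in> Mperm r k"
    using schurD(2)[OF assms(1), of x] schurD(2)[OF assms(2), of x] by (simp add: oadd_def Mperm_Ksets)
qed (simp_all add: oadd_def schurD[OF assms(1)] schurD[OF assms(2)], simp_all add: vadd_def vscale_def act_def algebra_simps)

lemma osub_schur:
  assumes "\<phi> \<in> schur r k" "\<psi> \<in> schur r k"
  shows "osub \<phi> \<psi> \<in> schur r k"
proof (rule schurI)
  fix x show "osub \<phi> \<psi> x \<in> Mperm r k"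
    using schurD(2)[OF assms(1), of x] schurD(2)[OF assms(2), of x] by (simp add: osub_def Mperm_Ksets)
qed (simp_all add: osub_def schurD[OF assms(1)] schurD[OF assms(2)], simp_all add: vadd_def vscale_def act_def algebra_simps)

lemma comp_schur:
  assumes "\<phi> \<in> schur r k" "\<psi> \<in> schur r k"
  shows "\<phi> \<circ> \<psi> \<in> schur r k"
  by (rule schurI) (simp_all add: schurD[OF assms(1)] schurD[OF assms(2)])

definition oscale :: "nat \<Rightarrow> nat \<Rightarrow> 'a::field \<Rightarrow> 'a op" where
  "oscale r k c = (\<lambda>x S. c * proj r k x S)"

lemma oscale_schur: "oscale r k c \<in> schur r k"
  by (rule schurI)
    (auto simp: oscale_def Mperm_closed proj_id schurD(5)[OF proj_schur] vadd_def vscale_def act_def algebra_simps Mperm_Ksets proj_eq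
      permutes_image_Ksets[OF permutes_inv])

lemma proj_comp_schur:
  assumes "\<phi> \<in> schur r k"
  shows "proj r k \<circ> \<phi> = \<phi>" "\<phi> \<circ> proj r k = \<phi>"
  by (auto simp: fun_eq_iff schurD(1)[OF assms] proj_id[OF schurD(2)[OF assms]])

lemma comp_oadd_schur:
  assumes "\<alpha> \<in> schur r k" "\<phi> \<in> schur r k" "\<psi> \<in> schur r k"
  shows "\<alpha> \<circ> oadd \<phi> \<psi> = oadd (\<alpha> \<circ> \<phi>) (\<alpha> \<circ> \<psi>)"
proof
  fix x
  have "oadd \<phi> \<psi> x = vadd (\<phi> x) (\<psi> x)" by (simp add: oadd_def vadd_def)
  then show "(\<alpha> \<circ> oadd \<phi> \<psi>) x = oadd (\<alpha> \<circ> \<phi>) (\<alpha> \<circ> \<psi>) x"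
    using schurD(3)[OF assms(1) schurD(2)[OF assms(2)] schurD(2)[OF assms(3)]] by (simp add: oadd_def vadd_def)
qed

text \<open>The algebras \<^term>\<open>schur r k\<close> depend on parameters, so none of them is a type. Their product over
  all \<open>k \<le> r - k\<close>, indexed by \<open>m = r - 2k\<close> and \<open>k\<close>, is one; computations in a single component
  are carried out there.\<close>
typedef (overloaded) 'a::field schurprod = "{F :: nat \<Rightarrow> nat \<Rightarrow> 'a op. \<forall>m k. F m k \<in> schur (m + 2 * k) k}"
  by (rule exI[of _ "\<lambda>_ _. ozero"]) (simp add: ozero_schur)

setup_lifting type_definition_schurprod

instantiation schurprod :: (field) comm_ring_1
begin

lift_definition zero_schurprod :: "'a schurprod" is "\<lambda>_ _. ozero" by (simp add: ozero_schur)
lift_definition one_schurprod :: "'a schurprod" is "\<lambda>m k. proj (m + 2 * k) k" by (simp add: proj_schur)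
lift_definition plus_schurprod :: "'a schurprod \<Rightarrow> 'a schurprod \<Rightarrow> 'a schurprod"
  is "\<lambda>F G m k. oadd (F m k) (G m k)" by (simp add: oadd_schur)
lift_definition minus_schurprod :: "'a schurprod \<Rightarrow> 'a schurprod \<Rightarrow> 'a schurprod"
  is "\<lambda>F G m k. osub (F m k) (G m k)" by (simp add: osub_schur)
lift_definition uminus_schurprod :: "'a schurprod \<Rightarrow> 'a schurprod"
  is "\<lambda>F m k. osub ozero (F m k)" by (simp add: osub_schur ozero_schur)
lift_definition times_schurprod :: "'a schurprod \<Rightarrow> 'a schurprod \<Rightarrow> 'a schurprod"
  is "\<lambda>F G m k. F m k \<circ> G m k" by (simp add: comp_schur)

instance
proof
  fix a b c :: "'a schurprod"
  show "a + b + c = a + (b + c)" by transfer (simp add: oadd_def add.assoc)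
  show "a + b = b + a" by transfer (simp add: oadd_def add.commute)
  show "0 + a = a" by transfer (simp add: oadd_def ozero_def)
  show "- a + a = 0" by transfer (simp add: oadd_def osub_def ozero_def)
  show "a - b = a + - b" by transfer (simp add: oadd_def osub_def ozero_def)
  show "a * b * c = a * (b * c)" by transfer (simp add: comp_assoc)
  show "a * b = b * a"
  proof transfer
    fix F G :: "nat \<Rightarrow> nat \<Rightarrow> 'a op"
    assume "\<forall>m k. F m k \<in> schur (m + 2 * k) k" "\<forall>m k. G m k \<in> schur (m + 2 * k) k"
    then have "F m k \<circ> G m k = G m k \<circ> F m k" for m k using schur_commute[OF refl] by blast
    then show "(\<lambda>m k. F m k \<circ> G m k) = (\<lambda>m k. G m k \<circ> F m k)" by blast
  qed
  show "1 * a = a" by transfer (simp add: proj_comp_schur)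
  show "(a + b) * c = a * c + b * c" by transfer (simp add: oadd_def o_def)
  show "(0::'a schurprod) \<noteq> 1"
  proof transfer
    have "proj (0 + 2 * 0) 0 (delta {}) {} \<noteq> (ozero (delta {}) {} :: 'a)"
      by (simp add: proj_def delta_def ozero_def)
    then show "(\<lambda>_ _. ozero :: 'a op) \<noteq> (\<lambda>m k. proj (m + 2 * k) k)"
      by (metis (mono_tags))
  qed
qed

end

section \<open>Components of the product ring, and the b(i) inside it\<close>

lift_definition comp_at :: "'a::field schurprod \<Rightarrow> nat \<Rightarrow> nat \<Rightarrow> 'a op" is "\<lambda>F m k. F m k" .

lemma comp_at_simps [simp]:
  "comp_at 0 m k = ozero" "comp_at 1 m k = proj (m + 2 * k) k"
  "comp_at (a + b) m k = oadd (comp_at a m k) (comp_at b m k)"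
  "comp_at (a - b) m k = osub (comp_at a m k) (comp_at b m k)"
  "comp_at (a * b) m k = comp_at a m k \<circ> comp_at b m k"
  by (transfer; simp)+

lemma comp_at_schur: "comp_at a m k \<in> schur (m + 2 * k) k"
  by transfer simp

text \<open>Overwrites one component of \<open>d\<close>. The membership guard keeps the result in
  the type for every \<open>\<phi>\<close>.\<close>

lift_definition embed :: "nat \<Rightarrow> nat \<Rightarrow> 'a op \<Rightarrow> 'a::field schurprod \<Rightarrow> 'a schurprod"
  is "\<lambda>m k \<phi> d m' k'. if (m', k') = (m, k) \<and> \<phi> \<in> schur (m + 2 * k) k then \<phi> else d m' k'"
  by auto

lemma comp_at_embed: "\<phi> \<in> schur (m + 2 * k) k \<Longrightarrow> comp_at (embed m k \<phi> d) m k = \<phi>"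
  by transfer simp

lemma schurprod_eqI: "(\<And>m k. comp_at a m k = comp_at b m k) \<Longrightarrow> a = b"
  by transfer (auto intro!: ext)

lemma comp_at_sum: "comp_at (\<Sum>h\<in>A. f h) m k x S = (\<Sum>h\<in>A. comp_at (f h) m k x S)"
  by (induction A rule: infinite_finite_induct) (simp_all add: ozero_def oadd_def)

lemma comp_at_of_nat_mult: "comp_at (of_nat n * a) m k x S = of_nat n * comp_at a m k x S"
  by (induction n) (simp_all add: ozero_def oadd_def distrib_right del: comp_at_simps(5))

lemma schurprod_three:
  assumes "CHAR('a::field) = 3"
  shows "(3 :: 'a schurprod) = 0"
proof -
  have t: "(of_nat 3 :: 'a) = 0" using assms of_nat_CHAR[where 'a = 'a] by simp
  have "(of_nat 3 * 1 :: 'a schurprod) = 0"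
    by (rule schurprod_eqI, intro ext) (simp only: comp_at_of_nat_mult t comp_at_simps(1) ozero_def mult_zero_left)
  then show ?thesis by simp
qed

text \<open>The relations of \<open>b_ring\<close> have to hold in all components, not only at
  \<open>(m, k)\<close>. Elsewhere the sequence 1, 0, 0, ... satisfies them: at h = 0 the
  coefficient is 1 for i = j = 0 and 0 otherwise.\<close>

definition b_at :: "nat \<Rightarrow> nat \<Rightarrow> nat \<Rightarrow> 'a::field schurprod" where
  "b_at m k i = embed m k (bop (m + 2 * k) k i) (of_bool (i = 0))"

lemma comp_at_b_at: "comp_at (b_at m k i) m k = bop (m + 2 * k) k i"
  unfolding b_at_def by (rule comp_at_embed[OF bop_schur])

lemma comp_at_embed_other: "(m', k') \<noteq> (m, k) \<Longrightarrow> comp_at (embed m k \<phi> d) m' k' = comp_at d m' k'"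
  by transfer auto

lemma b_ring_b_at:
  assumes "CHAR('a::field) = 3"
  shows "b_ring (b_at m k :: nat \<Rightarrow> 'a schurprod) m"
proof
  show "(3 :: 'a schurprod) = 0" by (rule schurprod_three[OF assms])
  show "b_at m k 0 = (1 :: 'a schurprod)"
  proof (rule schurprod_eqI)
    fix m' k'
    show "comp_at (b_at m k 0) m' k' = comp_at (1 :: 'a schurprod) m' k'"
      by (cases "(m', k') = (m, k)")
        (auto simp: comp_at_b_at bop_0, auto simp: b_at_def comp_at_embed_other)
  qed
  fix i j
  let ?c = "\<lambda>h. (h choose i) * (h choose j) * ((m + i + j) choose (i + j - h))"
  show "b_at m k i * b_at m k j = (\<Sum>h\<le>i + j. of_nat (?c h) * b_at m k h :: 'a schurprod)"
  proof (rule schurprod_eqI, intro ext)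
    fix m' k' S and x :: "nat set \<Rightarrow> 'a"
    show "comp_at (b_at m k i * b_at m k j) m' k' x S = comp_at (\<Sum>h\<le>i + j. of_nat (?c h) * b_at m k h) m' k' x (S :: nat set) "
    proof (cases "(m', k') = (m, k)")
      case True
      then have "m' = m" "k' = k" by auto
      then show ?thesis
        by (simp only: comp_at_sum comp_at_of_nat_mult)
          (simp only: comp_at_simps(5) comp_at_b_at o_apply bop_mult[OF refl])
    next
      case False
      have e: "comp_at (b_at m k h) m' k' = comp_at (of_bool (h = 0) :: 'a schurprod) m' k'" for h
        unfolding b_at_def by (rule comp_at_embed_other[OF False])
      have "(of_bool (i = 0) * of_bool (j = 0) :: 'a schurprod) = (\<Sum>h\<le>i + j. of_nat (?c h) * of_bool (h = 0))"
      proof -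
        have "(\<Sum>h\<le>i + j. of_nat (?c h) * of_bool (h = 0) :: 'a schurprod) = (\<Sum>h\<in>{0}. of_nat (?c h) * of_bool (h = 0))"
          by (rule sum.mono_neutral_right) auto
        then show ?thesis by (cases i; cases j) auto
      qed
      then have "comp_at (of_bool (i = 0) * of_bool (j = 0) :: 'a schurprod) m' k' x S
          = comp_at (\<Sum>h\<le>i + j. of_nat (?c h) * of_bool (h = 0)) m' k' x S" by simp
      then show ?thesis
        by (simp only: comp_at_sum comp_at_of_nat_mult) (simp only: comp_at_simps(5) e)
    qed
  qed
qed

section \<open>Vectors with the symmetry of a polytabloid\<close>

text \<open>The vectors of \<open>M\<close> transforming like the polytabloid of the tableau with columns
  \<open>(j, d + j)\<close>, \<open>j < d\<close>, and remaining first row entries \<open>2d, \<dots>, r - 1\<close>.\<close>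
definition polysym :: "nat \<Rightarrow> nat \<Rightarrow> nat \<Rightarrow> (nat set \<Rightarrow> 'a::field) set" where
  "polysym r k d = {x \<in> Mperm r k. (\<forall>j<d. act (transpose j (d + j)) x = vscale (- 1) x)
     \<and> (\<forall>\<sigma>. \<sigma> permutes {2 * d..<r} \<longrightarrow> act \<sigma> x = x)}"

lemma transpose_permutes_range:
  fixes d r j :: nat
  assumes "2 * d \<le> r" "j < d"
  shows "transpose j (d + j) permutes {0..<r}"
  using assms by (intro permutes_swap_id) auto

lemma permutes_upper:
  fixes d r :: nat
  shows "\<sigma> permutes {2 * d..<r} \<Longrightarrow> \<sigma> permutes {0..<r}"
  by (rule permutes_subset) auto

section \<open>The standard polytabloid\<close>

definition standard_poly :: "nat \<Rightarrow> nat set \<Rightarrow> 'a::field" where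
  "standard_poly d = polytabloid d (\<lambda>j. j) (\<lambda>j. d + j)"

lemma standard_poly_eq:
  "standard_poly d S = (\<Sum>c\<in>Pow {0..<d}. if S = (\<lambda>j. d + j) ` ({0..<d} - c) \<union> c then (-1) ^ card c else 0)"
  by (simp add: standard_poly_def polytabloid_def)

lemma standard_poly_specht:
  assumes "2 * d \<le> r"
  shows "(standard_poly d :: nat set \<Rightarrow> 'a::field) \<in> specht r d"
proof -
  have c: "column_data r d (\<lambda>j. j) (\<lambda>j. d + j)" using assms by (auto simp: column_data_def inj_on_def)
  have s: "standard_poly d = (\<lambda>S. \<Sum>i<Suc 0. (1::'a) * polytabloid d (\<lambda>j. j) (\<lambda>j. d + j) S)"
    by (simp add: standard_poly_def)
  show ?thesis unfolding specht_def mem_Collect_eq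
    by (rule exI[of _ "Suc 0"], rule exI[of _ "\<lambda>_. 1"], rule exI[of _ "\<lambda>_ j. j"],
        rule exI[of _ "\<lambda>_ j. d + j"]) (use s c in auto)
qed

text \<open>Every nonempty \<open>c\<close> brings an element below \<open>d\<close> into the second
  row, so only the term of the identity contributes. This coordinate serves as the witness that
  vectors are nonzero.\<close>

lemma standard_poly_top: "standard_poly d {d..<2 * d} = 1"
proof -
  let ?t = "\<lambda>c. if {d..<2 * d} = (\<lambda>j. d + j) ` ({0..<d} - c) \<union> c then (-1) ^ card c else 0 :: 'a"
  have img: "(\<lambda>j. d + j) ` {0..<d} = {d..<2 * d}" by (simp add: mult_2)
  have z: "?t c = 0" if c: "c \<in> Pow {0..<d} - {{}}" for c
  proof -
    obtain j where j: "j \<in> c" using c by blast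
    then have "j < d" using c by auto
    then have "j \<notin> {d..<2 * d}" by simp
    then have "{d..<2 * d} \<noteq> (\<lambda>j. d + j) ` ({0..<d} - c) \<union> c" using j by blast
    then show ?thesis by simp
  qed
  have "standard_poly d {d..<2 * d} = (\<Sum>c\<in>{{}}. ?t c)"
    unfolding standard_poly_eq by (rule sum.mono_neutral_right) (use z in auto)
  also have "\<dots> = 1" using img by simp
  finally show ?thesis .
qed

lemma standard_poly_Mperm:
  assumes "2 * d \<le> r"
  shows "standard_poly d \<in> Mperm r d"
  unfolding Mperm_Ksets
proof (intro allI impI)
  fix S assume S: "S \<notin> Ksets r d"
  have "(\<lambda>j. d + j) ` ({0..<d} - c) \<union> c \<in> Ksets r d" if "c \<in> Pow {0..<d}" for c
  proof -
    have f: "finite c" using that finite_subset by auto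
    have "card ((\<lambda>j. d + j) ` ({0..<d} - c) \<union> c) = card ((\<lambda>j. d + j) ` ({0..<d} - c)) + card c"
      using that f by (intro card_Un_disjoint) auto
    also have "card ((\<lambda>j. d + j) ` ({0..<d} - c)) = d - card c"
      using that f by (subst card_image) (auto simp: card_Diff_subset)
    also have "d - card c + card c = d" using that card_mono[of "{0..<d}" c] by auto
    finally show ?thesis using that assms by (auto simp: Ksets_def)
  qed
  then show "standard_poly d S = 0" unfolding standard_poly_eq using S by (intro sum.neutral) auto
qed

lemma standard_poly_polysym:
  assumes "2 * d \<le> r"
  shows "standard_poly d \<in> polysym r d d"
  unfolding polysym_def
proof (intro CollectI conjI allI impI standard_poly_Mperm[OF assms])
  let ?X = "\<lambda>c. (\<lambda>j. d + j) ` ({0..<d} - c) \<union> c"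
  fix j assume j: "j < d"
  let ?t = "transpose j (d + j)"
  \<comment> \<open>Exchanging the entries of column \<open>j\<close> toggles \<open>j\<close> in
    the set \<open>c\<close> of exchanged columns, and so reverses the sign.\<close>
  define flip where "flip c = (if j \<in> c then c - {j} else insert j c)" for c
  have ff: "flip (flip c) = c" for c by (auto simp: flip_def)
  have flipP: "flip c \<in> Pow {0..<d}" if "c \<in> Pow {0..<d}" for c using that j by (auto simp: flip_def)
  have X: "?t ` ?X c = ?X (flip c)" if c: "c \<in> Pow {0..<d}" for c
  proof -
    have sub: "?t ` ?X c \<subseteq> ?X (flip c)" if c: "c \<in> Pow {0..<d}" for c
    proof
      fix y assume "y \<in> ?t ` ?X c"
      then obtain x where x: "x \<in> ?X c" "y = ?t x" by auto
      show "y \<in> ?X (flip c)"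
      proof (cases "x \<in> c")
        case True
        then have "x < d" using c by auto
        then show ?thesis using x True j by (auto simp: flip_def transpose_def)
      next
        case False
        then obtain i where i: "x = d + i" "i < d" "i \<notin> c" using x by auto
        then show ?thesis using x j by (auto simp: flip_def transpose_def)
      qed
    qed
    have "?t ` ?t ` ?X (flip c) \<subseteq> ?t ` ?X (flip (flip c))" by (rule image_mono[OF sub[OF flipP[OF c]]])
    then have "?X (flip c) \<subseteq> ?t ` ?X c" by (simp add: ff image_image)
    with sub[OF c] show ?thesis by blast
  qed
  have sgn: "(-1) ^ card (flip c) = - ((-1) ^ card c :: 'a)" if "c \<in> Pow {0..<d}" for c
  proof -
    have f: "finite c" using that finite_subset by auto
    show ?thesis
    proof (cases "j \<in> c")
      case True
      then have "card c = Suc (card (flip c))" using f by (simp only: flip_def if_True card_Suc_Diff1)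
      then show ?thesis by (simp only: power_Suc mult_minus1 minus_minus)
    next
      case False
      then show ?thesis using f by (simp add: flip_def)
    qed
  qed
  show "act ?t (standard_poly d) = vscale (- 1) (standard_poly d :: nat set \<Rightarrow> 'a)"
  proof
    fix S
    have inv: "inv ?t = ?t" by (simp add: inv_transpose_eq)
    have "standard_poly d (?t ` S) = (\<Sum>c\<in>Pow {0..<d}. - (if S = ?X c then (-1) ^ card c else 0 :: 'a))"
      unfolding standard_poly_eq
    proof (rule sum.reindex_bij_witness[of _ flip flip])
      fix c assume c: "c \<in> Pow {0..<d}"
      have "S = ?X (flip c) \<longleftrightarrow> ?t ` S = ?X c"
      proof -
        have tt: "?t ` ?t ` A = A" for A by (simp add: image_image)
        show ?thesis using X[OF c] tt by metis
      qed
      then show "- (if S = ?X (flip c) then (-1) ^ card (flip c) else 0) = (if ?t ` S = ?X c then (-1) ^ card c else 0 :: 'a)"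
        using sgn[OF c] by simp
    qed (use ff flipP in auto)
    then show "act ?t (standard_poly d) S = vscale (- 1) (standard_poly d :: nat set \<Rightarrow> 'a) S"
      by (simp add: act_def inv vscale_def standard_poly_eq sum_negf)
  qed
next
  let ?X = "\<lambda>c. (\<lambda>j. d + j) ` ({0..<d} - c) \<union> c"
  fix \<sigma> assume \<sigma>: "\<sigma> permutes {2 * d..<r}"
  show "act \<sigma> (standard_poly d) = (standard_poly d :: nat set \<Rightarrow> 'a)"
  proof
    fix S
    have "inv \<sigma> ` S = ?X c \<longleftrightarrow> S = ?X c" if "c \<in> Pow {0..<d}" for c
    proof -
      have "\<sigma> ` ?X c = ?X c"
      proof -
        have "\<sigma> x = x" if "x \<in> ?X c" for x
          using that \<open>c \<in> Pow {0..<d}\<close> permutes_not_in[OF \<sigma>, of x] by auto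
        then show ?thesis by force
      qed
      then show ?thesis using permutes_image_inv[OF \<sigma>] by metis
    qed
    then show "act \<sigma> (standard_poly d) S = (standard_poly d S :: 'a)"
      unfolding act_def standard_poly_eq by (intro sum.cong refl) simp
  qed
qed

section \<open>Coordinates of the vectors with this symmetry\<close>

lemma eq_uminus_char3:
  assumes "(3::'a::field) = 0" "a = - (a::'a)"
  shows "a = 0"
proof -
  have "a + a = 0" using assms(2) by (metis add.right_inverse)
  then have "a + a + a = a" by (simp only: add_0)
  moreover have "a + a + a = 3 * a" by (simp add: algebra_simps)
  ultimately show ?thesis by (metis assms(1) mult_zero_left)
qed

lemma polysym_transpose:
  assumes "x \<in> polysym r k d" "j < d"
  shows "x (transpose j (d + j) ` T) = - x T"
proof -
  have "act (transpose j (d + j)) x T = vscale (- 1) x T" using assms by (simp add: polysym_def)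
  then show ?thesis by (simp add: act_def vscale_def inv_transpose_eq)
qed

text \<open>The transposition of column \<open>j\<close> fixes such a \<open>T\<close> but negates
  \<open>x\<close>, and 2 is invertible in characteristic 3.\<close>

lemma polysym_zero:
  assumes "(3::'a::field) = 0" "x \<in> (polysym r k d :: (nat set \<Rightarrow> 'a) set)" "j < d" "j \<in> T \<longleftrightarrow> d + j \<in> T"
  shows "x T = 0"
proof -
  have "transpose j (d + j) ` T = T"
    using assms(4) by (metis transpose_image_eq)
  then have "x T = - x T" using polysym_transpose[OF assms(2,3), of T] by metis
  then show ?thesis by (rule eq_uminus_char3[OF assms(1)])
qed

lemma polysym_const:
  assumes "2 * d \<le> r" "x \<in> polysym r k d" "S \<in> Ksets r k" "T \<in> Ksets r k"
    "{d..<2 * d} \<subseteq> S" "{d..<2 * d} \<subseteq> T" "S \<inter> {0..<d} = {}" "T \<inter> {0..<d} = {}"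
  shows "x S = x T"
proof -
  let ?A = "{2 * d..<r}" and ?D = "{d..<2 * d}"
  have dec: "R = ?D \<union> (R \<inter> ?A) \<and> card R = card ?D + card (R \<inter> ?A)"
    if R: "R \<in> Ksets r k" "?D \<subseteq> R" "R \<inter> {0..<d} = {}" for R
  proof -
    have "y \<in> ?D \<union> (R \<inter> ?A)" if "y \<in> R" for y
    proof -
      have "y \<notin> {0..<d}" "y < r" using that R by (auto simp: Ksets_def)
      then show ?thesis using that by auto
    qed
    then have e: "R = ?D \<union> (R \<inter> ?A)" using R(2) by blast
    have c: "card (?D \<union> (R \<inter> ?A)) = card ?D + card (R \<inter> ?A)" by (rule card_Un_disjoint) auto
    show ?thesis by (intro conjI e trans[OF arg_cong[OF e, of card] c])
  qed
  have ST: "S = ?D \<union> (S \<inter> ?A)" "T = ?D \<union> (T \<inter> ?A)"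
    "card S = card ?D + card (S \<inter> ?A)" "card T = card ?D + card (T \<inter> ?A)"
    using dec[OF assms(3,5,7)] dec[OF assms(4,6,8)] by blast+
  then have c: "card (S \<inter> ?A) = card (T \<inter> ?A)" using assms(3,4) by (simp add: Ksets_def)
  obtain \<sigma> where \<sigma>: "\<sigma> permutes ?A" "\<sigma> ` (S \<inter> ?A) = T \<inter> ?A"
    using ex_permutes_two_sets[of ?A "S \<inter> ?A" "S \<inter> ?A" "T \<inter> ?A" "T \<inter> ?A"] c by auto
  have "\<sigma> y = y" if "y \<in> ?D" for y using that permutes_not_in[OF \<sigma>(1), of y] by auto
  then have "\<sigma> ` ?D = ?D" by force
  then have "\<sigma> ` S = T" using \<sigma>(2) ST(1,2) by (metis image_Un)
  moreover have "act \<sigma> x T = x T" using assms(2) \<sigma>(1) by (simp add: polysym_def)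
  ultimately show ?thesis using permutes_image_inv(1)[OF \<sigma>(1), of S] by (simp add: act_def)
qed

text \<open>A nonzero coordinate takes exactly one entry from each column. Column transpositions
  move these entries to the second row at the cost of a sign, and permutations of the remaining
  positions identify all such coordinates with the one at \<open>{d..<d + k}\<close>. For
  \<open>k < d\<close> no set of size \<open>k\<close> meets all columns. So the space is at most a
  line.\<close>

lemma polysym_unique:
  assumes three: "(3::'a::field) = 0" and d: "2 * d \<le> r" and x: "x \<in> (polysym r k d :: (nat set \<Rightarrow> 'a) set)"
    and z: "k < d \<or> x {d..<d + k} = 0" and k: "2 * k \<le> r"
  shows "x = vzero"
proof -
  have "x T = 0" if "T \<in> Ksets r k" for T
    using that
  proof (induction "card (T \<inter> {0..<d})" arbitrary: T)
    case 0
    then have T: "T \<inter> {0..<d} = {}" by simp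
    show ?case
    proof (cases "{d..<2 * d} \<subseteq> T")
      case True
      have fT: "finite T" using 0 by (auto simp: Ksets_def intro: finite_subset)
      have "d \<le> k" using card_mono[OF fT True] 0 by (simp add: Ksets_def)
      then have S: "{d..<d + k} \<in> Ksets r k" "{d..<2 * d} \<subseteq> {d..<d + k}" "{d..<d + k} \<inter> {0..<d} = {}"
        using d k by (auto simp: Ksets_def)
      have "x T = x {d..<d + k}" by (rule polysym_const[OF d x]) (use 0 S T True in auto)
      then show ?thesis using z \<open>d \<le> k\<close> by simp
    next
      case False
      then obtain y where y: "y \<in> {d..<2 * d}" "y \<notin> T" by blast
      have "y - d < d" "y - d \<notin> T" "d + (y - d) \<notin> T" using y T by auto
      then show ?thesis using polysym_zero[OF three x, of "y - d" T] by blast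
    qed
  next
    case (Suc n)
    then obtain j where j: "j \<in> T" "j < d" by (metis Int_iff Suc_neq_Zero atLeastLessThan_iff card.empty ex_in_conv)
    show ?case
    proof (cases "d + j \<in> T")
      case True
      then show ?thesis using polysym_zero[OF three x j(2)] j by blast
    next
      case False
      let ?T = "transpose j (d + j) ` T"
      have "?T \<inter> {0..<d} = T \<inter> {0..<d} - {j}"
        using j False by (auto simp: transpose_def image_iff split: if_splits)
      then have "card (?T \<inter> {0..<d}) = n" using Suc(2) j by simp
      moreover have "?T \<in> Ksets r k"
        using permutes_image_Ksets[OF transpose_permutes_range[OF d j(2)]] Suc.prems by simp
      ultimately have "x ?T = 0" using Suc(1) by simp
      then show ?thesis using polysym_transpose[OF x j(2), of T] by simp
    qed
  qed
  moreover have "x T = 0" if "T \<notin> Ksets r k" for T using x that by (simp add: polysym_def Mperm_Ksets)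
  ultimately show ?thesis unfolding vzero_def by blast
qed

text \<open>The transposition of a column disjoint from \<open>U\<close> permutes the sets
  containing \<open>U\<close>, so the sum equals its own negative.\<close>

lemma upsum_polysym_zero:
  assumes three: "(3::'a::field) = 0" and d: "2 * d \<le> r" and x: "x \<in> (polysym r k d :: (nat set \<Rightarrow> 'a) set)"
    and j: "j < d" "j \<notin> U" "d + j \<notin> U"
  shows "upsum r k x U = 0"
proof -
  have "transpose j (d + j) ` U = U" using j by (metis transpose_image_eq)
  moreover have "act (transpose j (d + j)) x = vscale (- 1) x" using x j by (simp add: polysym_def)
  ultimately have "upsum r k (vscale (- 1) x) U = upsum r k x U"
    using upsum_act[OF transpose_permutes_range[OF d j(1)], of k x U] by simp
  moreover have "upsum r k (vscale (- 1) x) U = - upsum r k x U"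
    unfolding upsum_def vscale_def sum_negf[symmetric] by (rule sum.cong) auto
  ultimately show ?thesis using eq_uminus_char3[OF three] by metis
qed

text \<open>A set \<open>T\<close> above \<open>U\<close> contains the second entry of every column,
  so containing a first entry as well makes \<open>x T\<close> vanish. The remaining
  \<open>T\<close> lie in \<open>{d..<r}\<close> and all have the same coordinate; the binomial
  counts them.\<close>

lemma upsum_polysym_top:
  assumes three: "(3::'a::field) = 0" and d: "2 * d \<le> r" and x: "x \<in> (polysym r k d :: (nat set \<Rightarrow> 'a) set)"
    and k: "2 * k \<le> r" and U: "{d..<2 * d} \<subseteq> U" "U \<subseteq> {d..<r}" "card U \<le> k"
  shows "upsum r k x U = of_nat ((r - d - card U) choose (k - card U)) * x {d..<d + k}"
proof -
  have fU: "finite U" using U finite_subset by blast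
  have "d \<le> k" using card_mono[OF fU U(1)] U(3) by simp
  then have S: "{d..<d + k} \<in> Ksets r k" "{d..<2 * d} \<subseteq> {d..<d + k}" "{d..<d + k} \<inter> {0..<d} = {}"
    using d k by (auto simp: Ksets_def)
  let ?Q = "{T. U \<subseteq> T \<and> T \<subseteq> {d..<r} \<and> card T = k}"
  have "upsum r k x U = (\<Sum>T\<in>?Q. x {d..<d + k})"
    unfolding upsum_def
  proof (rule sum.mono_neutral_cong_right)
    show "?Q \<subseteq> Ksets r k" by (auto simp: Ksets_def)
    show "\<forall>T\<in>Ksets r k - ?Q. of_bool (U \<subseteq> T) * x T = 0"
    proof
      fix T assume T: "T \<in> Ksets r k - ?Q"
      show "of_bool (U \<subseteq> T) * x T = 0"
      proof (cases "U \<subseteq> T")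
        case True
        then have "\<not> T \<subseteq> {d..<r}" "T \<subseteq> {0..<r}" using T by (auto simp: Ksets_def)
        then obtain j where j: "j \<in> T" "j < d" by (metis atLeastLessThan_iff leI subsetD subsetI)
        then have "d + j \<in> {d..<2 * d}" by simp
        then have "d + j \<in> T" using U(1) True by blast
        then have "x T = 0" using polysym_zero[OF three x j(2)] j by blast
        then show ?thesis by simp
      qed simp
    qed
    fix T assume T: "T \<in> ?Q"
    have "x T = x {d..<d + k}"
      by (rule polysym_const[OF d x]) (use T S U in \<open>auto simp: Ksets_def\<close>)
    then show "of_bool (U \<subseteq> T) * x T = x {d..<d + k}" using T by simp
  qed simp
  also have "\<dots> = of_nat (card ?Q) * x {d..<d + k}" by simp
  also have "card ?Q = (card {d..<r} - card U) choose (k - card U)"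
    by (rule card_supersets) (use U in auto)
  finally show ?thesis by simp
qed

lemma polysym_schur:
  assumes "\<phi> \<in> schur r k" "x \<in> polysym r k d" "2 * d \<le> r"
  shows "\<phi> x \<in> polysym r k d"
proof -
  have x: "x \<in> Mperm r k" using assms by (simp add: polysym_def)
  have "act (transpose j (d + j)) (\<phi> x) = vscale (- 1) (\<phi> x)" if "j < d" for j
    using schurD(5)[OF assms(1) transpose_permutes_range[OF assms(3) that] x] schurD(4)[OF assms(1) x, of "- 1"]
      assms(2) that by (simp add: polysym_def)
  moreover have "act \<sigma> (\<phi> x) = \<phi> x" if "\<sigma> permutes {2 * d..<r}" for \<sigma>
    using schurD(5)[OF assms(1) permutes_upper[OF that] x] assms(2) that by (simp add: polysym_def)
  ultimately show ?thesis using schurD(2)[OF assms(1)] by (simp add: polysym_def)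
qed

text \<open>By \<open>polysym_unique\<close> it is enough to compare coordinates at
  \<open>{d..<d + k}\<close>. There only sets \<open>U\<close> containing \<open>{d..<2 * d}\<close>
  contribute: \<open>(k - d) choose i\<close> of them, each with the value from
  \<open>upsum_polysym_top\<close>.\<close>

lemma bop_polysym:
  assumes three: "(3::'a::field) = 0" and d: "2 * d \<le> r" and x: "x \<in> (polysym r k d :: (nat set \<Rightarrow> 'a) set)"
    and dk: "d \<le> k" and r: "r = m + 2 * k"
  shows "bop r k i x = vscale (of_nat (((k - d) choose i) * ((m + (k - d) + i) choose i))) x"
proof -
  let ?S = "{d..<d + k}" and ?D = "{d..<2 * d}"
  let ?c = "of_nat (((k - d) choose i) * ((m + (k - d) + i) choose i)) :: 'a"
  have S: "?S \<in> Ksets r k" using dk d r by (auto simp: Ksets_def)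
  have "bop r k i x ?S = (\<Sum>U\<in>Pow {0..<r}. of_bool (U \<subseteq> ?S \<and> card U + i = k) * upsum r k x U)"
    using S by (simp add: bop_apply)
  also have "\<dots> = (\<Sum>U\<in>{U. ?D \<subseteq> U \<and> U \<subseteq> ?S \<and> card U + i = k}. of_nat ((m + (k - d) + i) choose i) * x ?S)"
  proof (rule sum.mono_neutral_cong_right)
    show "{U. ?D \<subseteq> U \<and> U \<subseteq> ?S \<and> card U + i = k} \<subseteq> Pow {0..<r}" using dk d r by auto
    show "\<forall>U\<in>Pow {0..<r} - {U. ?D \<subseteq> U \<and> U \<subseteq> ?S \<and> card U + i = k}.
        of_bool (U \<subseteq> ?S \<and> card U + i = k) * upsum r k x U = 0"
    proof
      fix U assume U: "U \<in> Pow {0..<r} - {U. ?D \<subseteq> U \<and> U \<subseteq> ?S \<and> card U + i = k}"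
      show "of_bool (U \<subseteq> ?S \<and> card U + i = k) * upsum r k x U = 0"
      proof (cases "U \<subseteq> ?S \<and> card U + i = k")
        case True
        then have "\<not> ?D \<subseteq> U" using U by auto
        then obtain y where y: "y \<in> {d..<2 * d}" "y \<notin> U" by blast
        have "y - d < d" "y - d \<notin> U" "d + (y - d) \<notin> U" using y True by force+
        then have "upsum r k x U = 0" by (rule upsum_polysym_zero[OF three d x])
        then show ?thesis by simp
      qed simp
    qed
    fix U assume U: "U \<in> {U. ?D \<subseteq> U \<and> U \<subseteq> ?S \<and> card U + i = k}"
    then have "r - d - card U = m + (k - d) + i" "k - card U = i" using dk r by auto
    moreover have "upsum r k x U = of_nat ((r - d - card U) choose (k - card U)) * x ?S"
      by (rule upsum_polysym_top[OF three d x]) (use U r dk d in auto)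
    ultimately show "of_bool (U \<subseteq> ?S \<and> card U + i = k) * upsum r k x U = of_nat ((m + (k - d) + i) choose i) * x ?S"
      using U by simp
  qed simp
  also have "\<dots> = of_nat (card {U. ?D \<subseteq> U \<and> U \<subseteq> ?S \<and> card U + i = k}) * (of_nat ((m + (k - d) + i) choose i) * x ?S)"
    by simp
  also have "card {U. ?D \<subseteq> U \<and> U \<subseteq> ?S \<and> card U + i = k} = (k - d) choose i"
    using card_intermediate[of ?S k ?D i] dk by simp
  finally have val: "bop r k i x ?S = ?c * x ?S" by (simp add: ac_simps)
  define y where "y = vadd (bop r k i x) (vscale (- ?c) x)"
  have bx: "bop r k i x \<in> polysym r k d" by (rule polysym_schur[OF bop_schur x d])
  have "y \<in> Mperm r k"
    unfolding y_def using bx x by (intro Mperm_closed) (simp_all add: polysym_def)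
  then have y: "y \<in> polysym r k d"
    using bx x unfolding y_def polysym_def by (simp add: vadd_def vscale_def act_def fun_eq_iff)
  have "y = vzero"
    by (rule polysym_unique[OF three d y]) (use val r in \<open>auto simp: y_def vadd_def vscale_def\<close>)
  then show ?thesis by (simp add: y_def vadd_def vscale_def vzero_def fun_eq_iff)
qed

text \<open>This is why \<open>B(m, g)\<close> is nonzero when the Young module splits off.\<close>
lemma equivariant_polysym_nonzero:
  fixes \<theta> :: "(nat set \<Rightarrow> 'a::field) \<Rightarrow> nat set \<Rightarrow> 'a"
  assumes three: "(3::'a::field) = 0" and d: "2 * d \<le> r" and x: "x \<in> (polysym r k d :: (nat set \<Rightarrow> 'a) set)"
    and dk: "d \<le> k" and k: "2 * k \<le> r"
    and add: "\<And>x y. x \<in> Mperm r k \<Longrightarrow> y \<in> Mperm r k \<Longrightarrow> \<theta> (vadd x y) = vadd (\<theta> x) (\<theta> y)"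
    and scale: "\<And>c x. x \<in> Mperm r k \<Longrightarrow> \<theta> (vscale c x) = vscale c (\<theta> x)"
    and equi: "\<And>\<sigma> x. \<sigma> permutes {0..<r} \<Longrightarrow> x \<in> Mperm r k \<Longrightarrow> \<theta> (act \<sigma> x) = act \<sigma> (\<theta> x)"
    and nz: "\<theta> x {d..<2 * d} \<noteq> 0"
  shows "(of_nat ((r - 2 * d) choose (k - d)) :: 'a) \<noteq> 0"
proof -
  let ?D = "{d..<2 * d}"
  obtain c where c: "\<forall>x\<in>Mperm r k. \<forall>S\<in>Ksets r d. \<theta> x S = (\<Sum>U\<in>Pow S. c (card U) * upsum r k x U)"
    using equivariant_form[of r k \<theta> d] add scale equi by blast
  have "?D \<in> Ksets r d" using d by (auto simp: Ksets_def)
  then have "\<theta> x ?D = (\<Sum>U\<in>Pow ?D. c (card U) * upsum r k x U)" using c x by (simp add: polysym_def)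
  also have "\<dots> = (\<Sum>U\<in>{?D}. c (card U) * upsum r k x U)"
  proof (rule sum.mono_neutral_right)
    show "\<forall>U\<in>Pow ?D - {?D}. c (card U) * upsum r k x U = 0"
    proof
      fix U assume U: "U \<in> Pow ?D - {?D}"
      then obtain y where y: "y \<in> {d..<2 * d}" "y \<notin> U" by blast
      have "U \<subseteq> ?D" using U by blast
      then have "y - d < d" "y - d \<notin> U" "d + (y - d) \<notin> U" using y by force+
      then have "upsum r k x U = 0" by (rule upsum_polysym_zero[OF three d x])
      then show "c (card U) * upsum r k x U = 0" by simp
    qed
  qed auto
  also have "\<dots> = c d * (of_nat ((r - 2 * d) choose (k - d)) * x {d..<d + k})"
    using upsum_polysym_top[OF three d x k, of ?D] d dk by (simp add: mult_2)
  finally show ?thesis using nz by auto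
qed

section \<open>The idempotent of the Young module\<close>

lemma comp_at_factor3:
  "comp_at (factor3 (digit3 g u) (digit3 n u) (b_at m k (3 ^ u)) (b_at m k (2 * 3 ^ u))) m k
   = efactor (m + 2 * k) k n g u"
  by (simp add: factor3_def efactor_def comp_at_b_at Let_def)

lemma comp_at_prod_list:
  "comp_at (prod_list (map F xs)) m k = foldr (\<lambda>u acc. comp_at (F u) m k \<circ> acc) xs (proj (m + 2 * k) k)"
  by (induction xs) simp_all

lemma comp_at_E:
  assumes "CHAR('a::field) = 3" "r = m + 2 * k"
  shows "comp_at (b_ring.E (b_at m k) m g (Suc r)) m k = (e_mg r k m g :: 'a op)"
proof -
  interpret b_ring "b_at m k :: nat \<Rightarrow> 'a schurprod" m by (rule b_ring_b_at[OF assms(1)])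
  have "E g (Suc r) = prod_list (map (\<lambda>v. factor3 (digit3 g v) (digit3 (m + 2 * g) v) (b_at m k (3 ^ v)) (b_at m k (2 * 3 ^ v))) [0..<Suc r])"
    unfolding E_def by (subst prod.distinct_set_conv_list[symmetric]) (simp_all only: distinct_upt set_upt atLeast0LessThan)
  then show ?thesis by (simp only: comp_at_prod_list comp_at_factor3 e_mg_def assms(2))
qed

text \<open>Turns field elements into ring elements, so that the cube of a linear combination of the
  b(h) can be expanded inside the ring.\<close>

lift_definition scal :: "'a \<Rightarrow> 'a::field schurprod" is "\<lambda>c m k. oscale (m + 2 * k) k c"
  by (simp add: oscale_schur)

lemma comp_at_scal_mult: "comp_at (scal c * a) m k x S = c * comp_at a m k x S"
proof -
  have "comp_at (scal c) m k y S = c * y S" if "y \<in> Mperm (m + 2 * k) k" for y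
    using that by transfer (simp add: oscale_def proj_id)
  then show ?thesis using schurD(2)[OF comp_at_schur, of a m k x] by simp
qed

lemma sum_cube_char3:
  assumes "(3::'r::comm_ring_1) = 0"
  shows "(\<Sum>h\<in>A. f h) ^ 3 = (\<Sum>h\<in>A. f h ^ 3 :: 'r)"
proof -
  have "(x + y) ^ 3 = x ^ 3 + y ^ 3" for x y :: 'r
  proof -
    have "(x + y) ^ 3 = x ^ 3 + y ^ 3 + 3 * (x * x * y + x * y * y)"
      by (simp add: power3_eq_cube algebra_simps)
    then show ?thesis using assms by simp
  qed
  then show ?thesis by (induction A rule: infinite_finite_induct) simp_all
qed

lemma three_eq_zero: "CHAR('a::field) = 3 \<Longrightarrow> (3::'a) = 0"
  using of_nat_CHAR[where 'a = 'a] by simp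

lemma
  fixes e :: "'a::field op"
  assumes ch: "CHAR('a) = 3" and r: "r = m + 2 * k"
    and nz: "(of_nat ((m + 2 * g) choose g) :: 'a) \<noteq> 0"
  defines "e \<equiv> e_mg r k m g"
  shows e_mg_schur: "e \<in> schur r k"
    and e_mg_idem: "e \<circ> e = e"
    and e_mg_local: "f \<in> schur r k \<Longrightarrow> f \<circ> f = f \<Longrightarrow> f \<circ> e = f \<Longrightarrow> \<exists>c. \<forall>x S. f x S = c * e x S"
proof -
  interpret b_ring "b_at m k :: nat \<Rightarrow> 'a schurprod" m by (rule b_ring_b_at[OF ch])
  let ?E = "E g (Suc r)"
  have cE: "comp_at ?E m k = e" unfolding e_def by (rule comp_at_E[OF ch r])
  note dig = choose_nonzero_digit_le[OF three_eq_zero[OF ch] nz] choose_nonzero_mod_le[OF three_eq_zero[OF ch] nz]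
  have "comp_at ?E m k \<in> schur r k" unfolding r by (rule comp_at_schur)
  then show es: "e \<in> schur r k" unfolding cE .
  have "?E * ?E = ?E" by (rule E_invariant(1)[OF dig])
  then show "e \<circ> e = e" using comp_at_simps(5)[of ?E ?E m k] by (simp only: cE)
  assume f: "f \<in> schur r k" "f \<circ> f = f" "f \<circ> e = f"
  obtain c where c: "\<forall>x S. f x S = (\<Sum>h\<le>k. c h * bop r k h x S)" using schur_span[OF f(1)] by blast
  \<comment> \<open>\<open>F\<close> represents \<open>f\<close> in the component
    \<open>(m, k)\<close>; identities for \<open>F\<close> are read off there.\<close>
  define F where "F = (\<Sum>h\<le>k. scal (c h) * b_at m k h)"
  have cF: "comp_at F m k = f"
    by (intro ext) (simp only: F_def comp_at_sum comp_at_scal_mult comp_at_b_at c r)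
  have "\<exists>z. ?E * b_at m k h ^ 3 = of_nat z * ?E" if "h \<le> k" for h
  proof (rule E_cube_scalar[OF dig])
    \<comment> \<open>The positions 0, ..., r used in \<open>e_mg\<close> contain all digits of
      every \<open>h \<le> k\<close>.\<close>
    have "h < Suc r" using that r by simp
    also have "Suc r < 3 ^ Suc r" by (rule power_gt_expt) simp
    finally show "h < 3 ^ Suc r" .
  qed
  then obtain z where z: "\<And>h. h \<le> k \<Longrightarrow> ?E * b_at m k h ^ 3 = of_nat (z h) * ?E" by metis
  have "F ^ 3 * ?E = (\<Sum>h\<le>k. scal (c h) * (scal (c h) * (scal (c h) * (?E * b_at m k h ^ 3))))"
    unfolding F_def sum_cube_char3[OF three] sum_distrib_right
    by (rule sum.cong[OF refl]) (simp add: power_mult_distrib power3_eq_cube ac_simps)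
  also have "\<dots> = (\<Sum>h\<le>k. scal (c h) * (scal (c h) * (scal (c h) * (of_nat (z h) * ?E))))"
    by (rule sum.cong[OF refl]) (simp add: z)
  finally have eq: "F ^ 3 * ?E = \<dots>" .
  have "f x S = (\<Sum>h\<le>k. c h * (c h * (c h * of_nat (z h)))) * e x S" for x S
  proof -
    have "comp_at (F ^ 3 * ?E) m k = f \<circ> (f \<circ> f) \<circ> e"
      unfolding power3_eq_cube comp_at_simps(5) cF cE by (simp only: comp_assoc)
    then have "comp_at (F ^ 3 * ?E) m k = f" using f by (simp add: comp_assoc)
    then have "f x S = comp_at (F ^ 3 * ?E) m k x S" by simp
    then show ?thesis unfolding eq comp_at_sum comp_at_scal_mult comp_at_of_nat_mult cE
      by (simp add: sum_distrib_right mult.assoc)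
  qed
  then show "\<exists>c. \<forall>x S. f x S = c * e x S" by blast
qed

lemma digit3_add_multiple: "digit3 (a + c * 3 ^ u) u = (digit3 a u + c) mod 3"
  unfolding digit3_def by (simp add: mod_simps add.commute)

text \<open>Each factor fixes \<open>x\<close> by itself. By Lucas the eigenvalues of b(3^u) and b(2
  * 3^u) depend only on the digits \<open>gd\<close> of g and \<open>nd - gd\<close> of m + g, and
  \<open>gd \<le> nd\<close> leaves exactly the six cases of \<open>efactor\<close>, in each of
  which the factor takes the value 1.\<close>

lemma e_mg_polysym:
  assumes ch: "CHAR('a::field) = 3" and r: "r = m + 2 * k" and d: "2 * d \<le> r" "d \<le> k"
    and nz: "(of_nat ((m + 2 * (k - d)) choose (k - d)) :: 'a) \<noteq> 0"
    and x: "x \<in> (polysym r k d :: (nat set \<Rightarrow> 'a) set)"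
  shows "e_mg r k m (k - d) x = x"
proof -
  define g where "g = k - d"
  let ?n = "m + 2 * g"
  note three = three_eq_zero[OF ch]
  note num = three char3_numerals[OF three]
  have nz': "(of_nat (?n choose g) :: 'a) \<noteq> 0" using nz by (simp add: g_def)
  note dig = choose_nonzero_digit_le[OF three nz'] choose_nonzero_mod_le[OF three nz']
  have xM: "x \<in> Mperm r k" using x by (simp add: polysym_def)
  have fac: "efactor r k ?n g u x = x" for u
  proof -
    define gd nd where "gd = digit3 g u" and "nd = digit3 ?n u"
    have hd: "digit3 (m + g) u = nd - gd"
      using digit_diff[OF dig, of u] by (simp add: gd_def nd_def mult_2)
    have gn: "gd \<le> nd" "nd < 3" using dig(1)[of u] by (simp_all add: gd_def nd_def digit3_def)
    \<comment> \<open>Adding \<open>c * 3 ^ u\<close> may carry out of position \<open>u\<close>;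
      that carry does not affect this binomial mod 3, hence \<open>mod 3\<close> in the upper
      argument.\<close>
    have chi: "(of_nat ((g choose (c * 3 ^ u)) * ((m + g + c * 3 ^ u) choose (c * 3 ^ u))) :: 'a)
        = of_nat (gd choose c) * of_nat ((nd - gd + c) mod 3 choose c)" if "c < 3" for c
      unfolding of_nat_mult lucas_pow3_digit[OF three that] digit3_add_multiple hd gd_def ..
    have b: "bop r k (c * 3 ^ u) x S = of_nat (gd choose c) * of_nat ((nd - gd + c) mod 3 choose c) * x S" if "c < 3" for c S
      unfolding bop_polysym[OF three d(1) x d(2) r] chi[OF that, symmetric, unfolded g_def] vscale_def g_def ..
    have b1: "bop r k (3 ^ u) x S = of_nat gd * of_nat ((nd - gd + 1) mod 3) * x S" for S
      using b[of 1 S] by simp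
    have b2: "bop r k (2 * 3 ^ u) x S = of_nat (gd choose 2) * of_nat ((nd - gd + 2) mod 3 choose 2) * x S" for S
      using b[of 2 S] by simp
    have "gd = 0 \<or> gd = 1 \<or> gd = 2" "nd = 0 \<or> nd = 1 \<or> nd = 2" using gn by auto
    then show ?thesis
      using gn unfolding efactor_def Let_def gd_def[symmetric] nd_def[symmetric]
      by (elim disjE) (simp_all add: fun_eq_iff oadd_def osub_def b1 b2 proj_id[OF xM] choose_two num)
  qed
  have "foldr (\<lambda>u acc. efactor r k ?n g u \<circ> acc) us (proj r k) x = x" for us
    by (induction us) (simp_all add: fac proj_id[OF xM])
  then show ?thesis unfolding e_mg_def g_def .
qed

section \<open>Idempotents and direct summands\<close>

lemma schur_image_closed:
  assumes "e \<in> schur r k"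
  shows "vzero \<in> e ` Mperm r k"
    "x \<in> e ` Mperm r k \<Longrightarrow> y \<in> e ` Mperm r k \<Longrightarrow> vadd x y \<in> e ` Mperm r k"
    "x \<in> e ` Mperm r k \<Longrightarrow> vscale c x \<in> e ` Mperm r k"
    "\<sigma> permutes {0..<r} \<Longrightarrow> x \<in> e ` Mperm r k \<Longrightarrow> act \<sigma> x \<in> e ` Mperm r k"
    "e ` Mperm r k \<subseteq> Mperm r k"
proof -
  have "vscale 0 (e vzero) = vzero" by (simp add: vscale_def vzero_def)
  then have "vzero = e (vscale 0 vzero)" using schurD(4)[OF assms Mperm_closed(4), of 0] by simp
  then show "vzero \<in> e ` Mperm r k" using Mperm_closed(2,4) by blast
  show "vadd x y \<in> e ` Mperm r k" if xy: "x \<in> e ` Mperm r k" "y \<in> e ` Mperm r k"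
  proof -
    obtain p q where "p \<in> Mperm r k" "q \<in> Mperm r k" "x = e p" "y = e q" using xy by blast
    then show ?thesis using schurD(3)[OF assms, of p q] Mperm_closed(1)[of p r k q] by (metis imageI)
  qed
  show "vscale c x \<in> e ` Mperm r k" if x: "x \<in> e ` Mperm r k"
  proof -
    obtain p where "p \<in> Mperm r k" "x = e p" using x by blast
    then show ?thesis using schurD(4)[OF assms, of p c] Mperm_closed(2)[of p r k c] by (metis imageI)
  qed
  show "act \<sigma> x \<in> e ` Mperm r k" if x: "\<sigma> permutes {0..<r}" "x \<in> e ` Mperm r k"
  proof -
    obtain p where "p \<in> Mperm r k" "x = e p" using x by blast
    then show ?thesis using schurD(5)[OF assms x(1), of p] Mperm_closed(3)[OF x(1), of p k] by (metis imageI)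
  qed
  show "e ` Mperm r k \<subseteq> Mperm r k" using schurD(2)[OF assms] by blast
qed


lemma summand_idempotent:
  fixes U W :: "(nat set \<Rightarrow> 'a::field) set"
  assumes "is_direct_sum r (Mperm r k) U W"
  shows "\<exists>e\<in>schur r k. e \<circ> e = e \<and> e ` Mperm r k = U"
proof -
  let ?M = "Mperm r k"
  have U: "submodule r U" "submodule r W" "U \<subseteq> ?M" "W \<subseteq> ?M" "U \<inter> W = {vzero}"
    and dec: "\<And>v. v \<in> ?M \<Longrightarrow> \<exists>u\<in>U. \<exists>w\<in>W. v = vadd u w"
    using assms by (auto simp: is_direct_sum_def)
  note sub = U(1)[unfolded submodule_def] U(2)[unfolded submodule_def]
  define c where "c v u \<longleftrightarrow> u \<in> U \<and> (\<exists>w\<in>W. v = vadd u w)" for v u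
  have uniq: "u = u'" if cc: "c v u" "c v u'" for v u u'
  proof -
    obtain w w' where w: "w \<in> W" "w' \<in> W" "v = vadd u w" "v = vadd u' w'" "u \<in> U" "u' \<in> U"
      using cc unfolding c_def by blast
    let ?d = "vadd u (vscale (- 1) u')"
    have "?d = vadd w' (vscale (- 1) w)"
      using w(3,4) by (auto simp: vadd_def vscale_def fun_eq_iff algebra_simps)
    then have "?d \<in> U \<inter> W" using sub w by (metis IntI)
    then have "?d = vzero" using U(5) by simp
    then show ?thesis by (auto simp: vadd_def vscale_def vzero_def fun_eq_iff)
  qed
  \<comment> \<open>The projection onto \<open>U\<close> along \<open>W\<close>. Elements of
    \<open>schur\<close> act on all functions, so \<open>proj\<close> is applied first.\<close>
  define e where "e x = (THE u. c (proj r k x) u)" for x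
  have ce: "c (proj r k x) (e x)" for x
  proof -
    obtain u where u: "c (proj r k x) u" using dec[OF proj_Mperm, of x] unfolding c_def by blast
    show ?thesis unfolding e_def by (rule theI[of "c (proj r k x)", OF u]) (rule uniq[OF _ u])
  qed
  have eI: "e x = u" if "c x u" "x \<in> ?M" for x u
    using ce[of x] that uniq proj_id[OF that(2)] by metis
  have cM: "c x (e x)" if "x \<in> ?M" for x using ce[of x] proj_id[OF that] by simp
  have "e \<in> schur r k"
  proof (rule schurI)
    fix x :: "nat set \<Rightarrow> 'a" show "e (proj r k x) = e x" by (simp add: e_def proj_id)
    show "e x \<in> ?M" using ce[of x] U(3) by (auto simp: c_def)
  next
    fix x y :: "nat set \<Rightarrow> 'a" assume xy: "x \<in> ?M" "y \<in> ?M"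
    obtain w w' where w: "w \<in> W" "w' \<in> W" "x = vadd (e x) w" "y = vadd (e y) w'" "e x \<in> U" "e y \<in> U"
      using cM[OF xy(1)] cM[OF xy(2)] unfolding c_def by blast
    have "vadd x y = vadd (vadd (e x) (e y)) (vadd w w')"
      by (subst w(3), subst w(4)) (simp add: vadd_def ac_simps)
    then have "c (vadd x y) (vadd (e x) (e y))" unfolding c_def using sub w by blast
    then show "e (vadd x y) = vadd (e x) (e y)" using eI Mperm_closed(1)[OF xy] by blast
  next
    fix a and x :: "nat set \<Rightarrow> 'a" assume x: "x \<in> ?M"
    obtain w where w: "w \<in> W" "x = vadd (e x) w" "e x \<in> U" using cM[OF x] unfolding c_def by blast
    have "vscale a x = vadd (vscale a (e x)) (vscale a w)"
      by (subst w(2)) (simp add: vadd_def vscale_def distrib_left)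
    then have "c (vscale a x) (vscale a (e x))" unfolding c_def using sub w by blast
    then show "e (vscale a x) = vscale a (e x)" using eI Mperm_closed(2)[OF x] by blast
  next
    fix \<sigma> and x :: "nat set \<Rightarrow> 'a" assume \<sigma>: "\<sigma> permutes {0..<r}" and x: "x \<in> ?M"
    obtain w where w: "w \<in> W" "x = vadd (e x) w" "e x \<in> U" using cM[OF x] unfolding c_def by blast
    have "act \<sigma> x = vadd (act \<sigma> (e x)) (act \<sigma> w)"
      by (subst w(2)) (simp add: vadd_def act_def)
    then have "c (act \<sigma> x) (act \<sigma> (e x))" unfolding c_def using sub w \<sigma> by blast
    then show "e (act \<sigma> x) = act \<sigma> (e x)" using eI Mperm_closed(3)[OF \<sigma> x] by blast
  qed
  moreover have eu: "e u = u" if "u \<in> U" for u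
  proof (rule eI)
    have "u = vadd u vzero" by (simp add: vadd_def vzero_def)
    then show "c u u" unfolding c_def using that sub by blast
    show "u \<in> ?M" using that U(3) by blast
  qed
  moreover have "e x \<in> U" for x using ce[of x] by (simp add: c_def)
  ultimately have "e \<circ> e = e" "e ` ?M = U" "e \<in> schur r k" using U(3) by (auto simp: fun_eq_iff image_iff) (metis subsetD)
  then show ?thesis by blast
qed

text \<open>Stated for any idempotent with image isomorphic to \<open>Y\<close>, because it is
  applied twice: to the projection onto the given summand, which shows that \<open>e_mg\<close> has
  the required image, and to a competing idempotent, which gives uniqueness.\<close>

lemma young_idempotent:
  fixes Y :: "(nat set \<Rightarrow> 'a::field) set"
  assumes ch: "CHAR('a) = 3" and r: "r = m + 2 * k" and d: "2 * d \<le> r"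
    and Y: "young r d Y" and e': "e' \<in> schur r k" "e' \<circ> e' = e'"
    and iso: "module_iso r (e' ` Mperm r k) Y"
  shows "(of_nat ((m + 2 * (k - d)) choose (k - d)) :: 'a) \<noteq> 0" (is ?nz)
    and "\<exists>w :: nat set \<Rightarrow> 'a. w \<noteq> vzero \<and> e_mg r k m (k - d) w = w" (is ?fix)
    and "e' = e_mg r k m (k - d)" (is ?eq)
proof -
  let ?M = "Mperm r k"
  define U where "U = e' ` ?M"
  note three = three_eq_zero[OF ch]
  note cl = schur_image_closed[OF e'(1), folded U_def]
  obtain \<psi> where bij: "bij_betw \<psi> U Y"
    and add: "\<forall>x\<in>U. \<forall>y\<in>U. \<psi> (vadd x y) = vadd (\<psi> x) (\<psi> y)"
    and scale: "\<forall>c. \<forall>x\<in>U. \<psi> (vscale c x) = vscale c (\<psi> x)"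
    and equi: "\<forall>\<sigma>. \<sigma> permutes {0..<r} \<longrightarrow> (\<forall>x\<in>U. \<psi> (act \<sigma> x) = act \<sigma> (\<psi> x))"
    using iso unfolding module_iso_def U_def[symmetric] by (elim exE conjE) (rule that; assumption)
  have inj: "inj_on \<psi> U" and surj: "\<psi> ` U = Y" using bij by (auto simp: bij_betw_def)
  have zero: "\<psi> vzero = vzero"
  proof -
    have "vscale 0 vzero = (vzero :: nat set \<Rightarrow> 'a)" "vscale 0 (\<psi> vzero) = vzero"
      by (simp_all add: vscale_def vzero_def)
    then show ?thesis using scale cl(1) by metis
  qed
  let ?t = "standard_poly d :: nat set \<Rightarrow> 'a"
  have "specht r d \<subseteq> Y" using Y by (simp add: young_def)
  then have "?t \<in> \<psi> ` U" unfolding surj by (rule subsetD) (rule standard_poly_specht[OF d])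
  then obtain w where w: "w \<in> U" "\<psi> w = ?t" by (elim imageE) (rule that, assumption, rule sym)
  have tnz: "?t \<noteq> vzero" using standard_poly_top[of d, where 'a = 'a] by (auto simp: vzero_def)
  have wnz: "w \<noteq> vzero" using w zero tnz by auto
  have ew: "e' w = w" using w(1) fun_cong[OF e'(2)] by (auto simp: U_def)
  have wM: "w \<in> ?M" using w cl(5) by blast
  have ts: "?t \<in> polysym r d d" by (rule standard_poly_polysym[OF d])
  have wp: "w \<in> polysym r k d"
    unfolding polysym_def
  proof (intro CollectI conjI wM allI impI)
    fix j assume j: "j < d"
    note p = transpose_permutes_range[OF d j]
    have "\<psi> (act (transpose j (d + j)) w) = \<psi> (vscale (- 1) w)"
      using equi scale p w ts j by (simp add: polysym_def)
    then show "act (transpose j (d + j)) w = vscale (- 1) w"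
      using inj cl(3)[OF w(1)] cl(4)[OF p w(1)] by (simp add: inj_on_eq_iff)
  next
    fix \<sigma> assume \<sigma>: "\<sigma> permutes {2 * d..<r}"
    note p = permutes_upper[OF \<sigma>]
    have "\<psi> (act \<sigma> w) = \<psi> w" using equi p w ts \<sigma> by (simp add: polysym_def)
    then show "act \<sigma> w = w" using inj cl(4)[OF p w(1)] w(1) by (simp add: inj_on_eq_iff)
  qed
  have e'U: "e' x \<in> U" for x using schurD(1)[OF e'(1), of x] unfolding U_def by (metis imageI proj_Mperm)
  have dk: "d \<le> k"
  proof (rule ccontr)
    assume "\<not> d \<le> k"
    then have "w = vzero" using polysym_unique[OF three d wp] r by simp
    then show False using wnz by simp
  qed
  \<comment> \<open>\<open>\<psi> \<circ> e'\<close> maps M^\<lambda> into M^\<mu> and sends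
    \<open>w\<close> to the standard polytabloid, whose coordinate at \<open>{d..<2 * d}\<close> is
    1.\<close>
  have "(of_nat ((r - 2 * d) choose (k - d)) :: 'a) \<noteq> 0"
  proof (rule equivariant_polysym_nonzero[OF three d wp dk, where \<theta> = "\<psi> \<circ> e'"])
    show "(\<psi> \<circ> e') w {d..<2 * d} \<noteq> 0" using ew w(2) standard_poly_top[of d, where 'a = 'a] by simp
    show "2 * k \<le> r" using r by simp
  qed (simp_all add: schurD(3-5)[OF e'(1)] add scale equi e'U)
  moreover have "r - 2 * d = m + 2 * (k - d)" using r dk by simp
  ultimately show nz: ?nz by simp
  define e :: "'a op" where "e = e_mg r k m (k - d)"
  have es: "e \<in> schur r k" and ee: "e \<circ> e = e"
    and loc: "\<And>f. f \<in> schur r k \<Longrightarrow> f \<circ> f = f \<Longrightarrow> f \<circ> e = f \<Longrightarrow> \<exists>c. \<forall>x S. f x S = c * e x S"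
    unfolding e_def using e_mg_schur[OF ch r nz] e_mg_idem[OF ch r nz] e_mg_local[OF ch r nz] by blast+
  have ew2: "e w = w" unfolding e_def by (rule e_mg_polysym[OF ch r d dk nz wp])
  then show ?fix using wnz unfolding e_def by blast
  have comm: "e \<circ> e' = e' \<circ> e" by (rule schur_commute[OF r es e'(1)])
  have ee': "e \<circ> e' = e"
  proof -
    have 1: "(e \<circ> e') \<circ> (e \<circ> e') = e \<circ> e'"
      using ee e'(2) comm by (metis comp_assoc)
    have 2: "(e \<circ> e') \<circ> e = e \<circ> e'" using ee comm by (metis comp_assoc)
    obtain c where c: "\<forall>x S. (e \<circ> e') x S = c * e x S"
      using loc[OF comp_schur[OF es e'(1)] 1 2] by blast
    obtain S where S: "w S \<noteq> 0" using wnz by (auto simp: vzero_def)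
    have "w S = c * w S" using c ew ew2 by (metis comp_apply)
    then have "c = 1" using S by simp
    then show ?thesis using c by (simp add: fun_eq_iff)
  qed
  have eap: "e (e x) = e x" "e (e' x) = e x" "e' (e x) = e x" for x
    using fun_cong[OF ee, of x] fun_cong[OF ee', of x] fun_cong[OF comm, of x] by simp_all
  \<comment> \<open>The part of \<open>e'\<close> complementary to \<open>e\<close>. Transported by
    \<open>\<psi>\<close>, the images of \<open>e\<close> and \<open>h\<close> split
    \<open>Y\<close>; the first contains the polytabloid, so indecomposability forces the second to
    vanish.\<close>
  define h where "h = osub e' e"
  have hs: "h \<in> schur r k" unfolding h_def by (rule osub_schur[OF e'(1) es])
  have hx: "h x = vadd (e' x) (vscale (- 1) (e x))" for x
    by (simp add: h_def osub_def vadd_def vscale_def)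
  have eU: "e x \<in> U" for x using eap(3)[of x] schurD(2)[OF es, of x] unfolding U_def by (metis imageI)
  have hU: "h x \<in> U" for x unfolding hx by (intro cl(2,3) eU e'U)
  have eh: "e (h x) = vzero" for x
  proof -
    have "e (h x) = vadd (e (e' x)) (vscale (- 1) (e (e x)))"
      unfolding hx by (simp only: schurD(3)[OF es schurD(2)[OF e'(1)] Mperm_closed(2)[OF schurD(2)[OF es]]]
          schurD(4)[OF es schurD(2)[OF es]])
    then show ?thesis unfolding eap by (simp add: vadd_def vscale_def vzero_def)
  qed
  have subU: "submodule r (\<psi> ` (f ` ?M))" if f: "f \<in> schur r k" "\<And>x. f x \<in> U" for f
    unfolding submodule_def
  proof (intro conjI ballI allI impI)
    note fcl = schur_image_closed[OF f(1)]
    have fU: "f ` ?M \<subseteq> U" using f(2) by blast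
    have "Y \<subseteq> tensor_sp r" using Y by (simp add: young_def indecomposable_def submodule_def)
    then show "\<psi> ` (f ` ?M) \<subseteq> tensor_sp r" using fU surj by blast
    show "vzero \<in> \<psi> ` (f ` ?M)" using fcl(1) zero by (metis imageI)
    fix x assume x: "x \<in> \<psi> ` (f ` ?M)"
    then obtain p where p: "p \<in> f ` ?M" "x = \<psi> p" by blast
    show "vadd x y \<in> \<psi> ` (f ` ?M)" if y: "y \<in> \<psi> ` (f ` ?M)" for y
    proof -
      obtain q where q: "q \<in> f ` ?M" "y = \<psi> q" using y by blast
      have "vadd x y = \<psi> (vadd p q)" using add p q fU by (metis subsetD)
      then show ?thesis using fcl(2)[OF p(1) q(1)] by blast
    qed
    show "vscale c x \<in> \<psi> ` (f ` ?M)" for c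
    proof -
      have "vscale c x = \<psi> (vscale c p)" using scale p fU by (metis subsetD)
      then show ?thesis using fcl(3)[OF p(1)] by blast
    qed
    show "act \<sigma> x \<in> \<psi> ` (f ` ?M)" if "\<sigma> permutes {0..<r}" for \<sigma>
    proof -
      have "act \<sigma> x = \<psi> (act \<sigma> p)" using equi p fU that by (metis subsetD)
      then show ?thesis using fcl(4)[OF that p(1)] by blast
    qed
  qed
  have "is_direct_sum r Y (\<psi> ` (e ` ?M)) (\<psi> ` (h ` ?M))"
    unfolding is_direct_sum_def
  proof (intro conjI subU es hs eU hU ballI)
    show "\<psi> ` (e ` ?M) \<subseteq> Y" "\<psi> ` (h ` ?M) \<subseteq> Y" using surj eU hU by blast+
    have "x = vzero" if x: "x \<in> \<psi> ` (e ` ?M)" "x \<in> \<psi> ` (h ` ?M)" for x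
    proof -
      obtain p q where pq: "x = \<psi> (e p)" "x = \<psi> (h q)" using x by blast
      then have "e p = h q" using inj eU hU by (metis inj_onD)
      then have "e p = vzero" using eap(1)[of p] eh[of q] by simp
      then show ?thesis using pq zero by simp
    qed
    moreover have "vzero \<in> \<psi> ` (e ` ?M)" "vzero \<in> \<psi> ` (h ` ?M)"
      using schur_image_closed(1)[OF es] schur_image_closed(1)[OF hs] zero by (metis imageI)+
    ultimately show "\<psi> ` (e ` ?M) \<inter> \<psi> ` (h ` ?M) = {vzero}" by blast
    fix y assume "y \<in> Y"
    then obtain p where p: "p \<in> ?M" "y = \<psi> (e' p)" unfolding surj[symmetric] U_def by blast
    have "e' p = vadd (e p) (h p)" by (simp add: h_def osub_def vadd_def)
    then have "y = vadd (\<psi> (e p)) (\<psi> (h p))" using p add eU hU by metis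
    then show "\<exists>u\<in>\<psi> ` (e ` ?M). \<exists>w\<in>\<psi> ` (h ` ?M). y = vadd u w" using p(1) by blast
  qed
  moreover have "\<psi> ` (e ` ?M) \<noteq> {vzero}"
  proof -
    have "?t \<in> \<psi> ` (e ` ?M)" using w(2) ew2 wM by (metis imageI)
    then show ?thesis using tnz by blast
  qed
  ultimately have hz: "\<psi> ` (h ` ?M) = {vzero}" using Y unfolding young_def indecomposable_def by blast
  have "e' x = e x" for x
  proof -
    have "\<psi> (h (proj r k x)) = vzero" using hz by (metis imageI proj_Mperm singletonD)
    then have "h (proj r k x) = vzero" using inj hU cl(1) zero by (metis inj_onD)
    then have "e' (proj r k x) = e (proj r k x)" by (simp add: h_def osub_def vzero_def fun_eq_iff)
    then show ?thesis by (simp add: schurD(1)[OF e'(1)] schurD(1)[OF es])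
  qed
  then show ?eq unfolding e_def by blast
qed

theorem theorem1p3:
  fixes l1 l2 m1 m2 r :: nat and Y :: "(nat set \<Rightarrow> 'a::field) set"
  assumes "CHAR('a) = 3"
    and "l2 \<le> l1" and "l1 + l2 = r"
    and "m2 \<le> m1" and "m1 + m2 = r"
    and "young r m2 Y"
    and "\<exists>U. direct_summand r U (Mperm r l2) \<and> module_iso r U Y"
  shows "primitive_idem r l2 (e_mg r l2 (l1 - l2) (l2 - m2) :: 'a op)
       \<and> module_iso r ((e_mg r l2 (l1 - l2) (l2 - m2)) ` Mperm r l2) Y
       \<and> (\<forall>e'. primitive_idem r l2 e' \<and> module_iso r (e' ` Mperm r l2) Y
               \<longrightarrow> e' = e_mg r l2 (l1 - l2) (l2 - m2))"
proof -
  define m k where "m = l1 - l2" and "k = l2"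
  have r: "r = m + 2 * k" and d: "2 * m2 \<le> r" using assms(2-5) by (auto simp: m_def k_def)
  let ?e = "e_mg r k m (k - m2) :: 'a op"
  obtain U W where "is_direct_sum r (Mperm r k) U W" and iso: "module_iso r U Y"
    using assms(7) unfolding direct_summand_def k_def by blast
  then obtain e where e: "e \<in> schur r k" "e \<circ> e = e" "e ` Mperm r k = U"
    using summand_idempotent by blast
  note yi = young_idempotent[OF assms(1) r d assms(6)]
  have isoe: "module_iso r (e ` Mperm r k) Y" using iso e(3) by simp
  note nz = yi(1)[OF e(1,2) isoe]
  have eq: "e = ?e" by (rule yi(3)[OF e(1,2) isoe])
  obtain w where w: "w \<noteq> vzero" "?e w = w" using yi(2)[OF e(1,2) isoe] by blast
  obtain S where S: "w S \<noteq> 0" using w(1) by (auto simp: vzero_def)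
  have "primitive_idem r k ?e"
    unfolding primitive_idem_def
  proof (intro conjI notI)
    show "?e \<in> schur r k" "?e \<circ> ?e = ?e" using e eq by simp_all
    show False if "?e = ozero" using that w by (auto simp: ozero_def vzero_def)
    assume "\<exists>e1\<in>schur r k. \<exists>e2\<in>schur r k. e1 \<circ> e1 = e1 \<and> e2 \<circ> e2 = e2 \<and>
      e1 \<noteq> ozero \<and> e2 \<noteq> ozero \<and> e1 \<circ> e2 = ozero \<and> e2 \<circ> e1 = ozero \<and> ?e = oadd e1 e2"
    then obtain e1 e2 where e12: "e1 \<in> schur r k" "e2 \<in> schur r k" "e1 \<circ> e1 = e1" "e1 \<noteq> ozero" "e2 \<noteq> ozero"
      "e1 \<circ> e2 = ozero" "?e = oadd e1 e2" by blast
    have "e1 \<circ> ?e = e1"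
      unfolding e12(7) comp_oadd_schur[OF e12(1,1,2)] e12(3,6) by (simp add: oadd_def ozero_def)
    then obtain c where c: "\<forall>x S. e1 x S = c * ?e x S"
      using e_mg_local[OF assms(1) r nz e12(1,3)] by blast
    have e1w: "e1 w = vscale c w" using c w(2) by (simp add: vscale_def fun_eq_iff)
    have wM: "w \<in> Mperm r k" using w(2) schurD(2)[OF e(1), of w] eq by simp
    \<comment> \<open>Idempotency of \<open>e1\<close>, tested on the nonzero fixed vector
      \<open>w\<close>, gives c^2 = c; the two values of c make \<open>e1\<close> or
      \<open>e2\<close> zero.\<close>
    have "e1 (e1 w) = e1 w" using fun_cong[OF e12(3), of w] by simp
    then have "vscale c (vscale c w) = vscale c w"
      using schurD(4)[OF e12(1) wM, of c] e1w by simp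
    then have "vscale c (vscale c w) S = vscale c w S" by simp
    then have "c * (c * w S) = c * w S" by (simp only: vscale_def)
    then have "c = 0 \<or> c = 1" using S by auto
    then show False
    proof
      assume "c = 0"
      then have "e1 = ozero" using c by (simp add: ozero_def fun_eq_iff)
      then show False using e12(4) by simp
    next
      assume "c = 1"
      then have "e1 x S = e1 x S + e2 x S" for x S using c e12(7) by (simp add: oadd_def)
      then have "e2 = ozero" by (simp add: ozero_def fun_eq_iff)
      then show False using e12(5) by simp
    qed
  qed
  moreover have "module_iso r (?e ` Mperm r k) Y" using isoe eq by simp
  moreover have "e' = ?e" if "primitive_idem r k e'" "module_iso r (e' ` Mperm r k) Y" for e'
    using yi(3)[of e'] that by (simp add: primitive_idem_def)
  ultimately show ?thesis unfolding m_def k_def by blast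
qed

end
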